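(* Let $0\le\alpha<n$ and $b\in BMO(\mathbb{R}^n)$. Let $\Phi$ be a Young function and let $\Psi$ be defined via its inverse by $\Psi^{-1}(t)=\Phi^{-1}(t)t^{-\alpha/n}$ for $t\in(0,\infty)$, with $1<a_{\Phi}\le b_{\Phi}<\infty$ and $1<a_{\Psi}\le b_{\Psi}<\infty$. Let $\varphi_1,\varphi_2$ be positive measurable functions on $\mathbb{R}^n\times(0,\infty)$ satisfying $$\sup_{r<t<\infty} \Big(1+\ln \frac{t}{r}\Big) \Psi^{-1}(t^{-n}) \operatorname*{ess\,sup}_{t<s<\infty}\frac{\varphi_1(x,s)}{\Phi^{-1}(s^{-n})} \le C \, \varphi_2(x,r)$$ for all $x\in\mathbb{R}^n$, $r>0$, with $C$ independent of $x$ and $r$. Then $M_{b,\alpha}$ is bounded from $M_{\Phi,\varphi_1}(\mathbb{R}^n)$ to $M_{\Psi,\varphi_2}(\mathbb{R}^n)$; moreover there is $C'>0$ independent of $b$ and $f$ such that $\|M_{b,\alpha} f\|_{M_{\Psi,\varphi_2}} \le C' \|b\|_{*}\|f\|_{M_{\Phi,\varphi_1}}$.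
   Context: A Young function is a convex, left-continuous $\Phi:[0,\infty)\to[0,\infty]$ with $\lim_{r\to0+}\Phi(r)=\Phi(0)=0$ and $\lim_{r\to\infty}\Phi(r)=\infty$; $\Phi^{-1}(s)=\inf\{r\ge0:\Phi(r)>s\}$. The Orlicz norm is $\|f\|_{L_\Phi}=\inf\{\lambda>0:\int_{\mathbb{R}^n}\Phi(|f|/\lambda)\le1\}$, $\|f\|_{L_\Phi(B)}=\|f\chi_B\|_{L_\Phi}$. For positive measurable $\varphi$ on $\mathbb{R}^n\times(0,\infty)$, $M_{\Phi,\varphi}(\mathbb{R}^n)$ is the space of $f\in L_\Phi^{\rm loc}$ with $\|f\|_{M_{\Phi,\varphi}}=\sup_{x\in\mathbb{R}^n,r>0}\varphi(x,r)^{-1}\Phi^{-1}(r^{-n})\|f\|_{L_\Phi(B(x,r))}<\infty$. For a Young function $\Phi$, $a_\Phi=\inf_{t>0}t\Phi'(t)/\Phi(t)$ and $b_\Phi=\sup_{t>0}t\Phi'(t)/\Phi(t)$. $BMO(\mathbb{R}^n)$ is the space of $b\in L^1_{\rm loc}$ with $\|b\|_\ast=\sup_{x,r>0}|B(x,r)|^{-1}\int_{B(x,r)}|b(y)-b_{B(x,r)}|dy<\infty$. $M_{b,\alpha}f(x)=\sup_{t>0}|B(x,t)|^{-1+\alpha/n}\int_{B(x,t)}|b(x)-b(y)||f(y)|dy$. *)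

theory Defs
  imports "HOL-Analysis.Analysis" "HOL-Probability.Essential_Supremum"
begin

text \<open>Young functions, taking values in [0,\<infinity>]; only the restriction to [0,\<infinity>) matters.\<close>
definition young_function :: "(real \<Rightarrow> ennreal) \<Rightarrow> bool" where
  "young_function \<Phi> \<longleftrightarrow>
     (\<forall>x y u. 0 \<le> x \<longrightarrow> 0 \<le> y \<longrightarrow> 0 \<le> u \<longrightarrow> u \<le> 1 \<longrightarrow>
        \<Phi> (u * x + (1 - u) * y) \<le> ennreal u * \<Phi> x + ennreal (1 - u) * \<Phi> y)
   \<and> (\<forall>r>0. (\<Phi> \<longlongrightarrow> \<Phi> r) (at_left r))
   \<and> \<Phi> 0 = 0 \<and> (\<Phi> \<longlongrightarrow> 0) (at_right 0)
   \<and> (\<Phi> \<longlongrightarrow> \<infinity>) at_top"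

definition young_inv :: "(real \<Rightarrow> ennreal) \<Rightarrow> real \<Rightarrow> real" where
  "young_inv \<Phi> s = Inf {r. 0 \<le> r \<and> ennreal s < \<Phi> r}"

definition young_ext :: "(real \<Rightarrow> ennreal) \<Rightarrow> ennreal \<Rightarrow> ennreal" where
  "young_ext \<Phi> x = (if x = \<infinity> then \<infinity> else \<Phi> (enn2real x))"

text \<open>Orlicz (Luxemburg) norm of a nonnegative (possibly infinite valued) function g = |f|.\<close>
definition orlicz_norm :: "(real \<Rightarrow> ennreal) \<Rightarrow> ('a::euclidean_space \<Rightarrow> ennreal) \<Rightarrow> ennreal" where
  "orlicz_norm \<Phi> g =
     (INF c\<in>{c::real. 0 < c \<and> (\<integral>\<^sup>+ x. young_ext \<Phi> (g x / ennreal c) \<partial>lebesgue) \<le> 1}. ennreal c)"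

definition orlicz_norm_ball :: "(real \<Rightarrow> ennreal) \<Rightarrow> ('a::euclidean_space \<Rightarrow> ennreal) \<Rightarrow> 'a \<Rightarrow> real \<Rightarrow> ennreal" where
  "orlicz_norm_ball \<Phi> g x r = orlicz_norm \<Phi> (\<lambda>y. indicator (ball x r) y * g y)"

definition orlicz_loc :: "(real \<Rightarrow> ennreal) \<Rightarrow> ('a::euclidean_space \<Rightarrow> ennreal) \<Rightarrow> bool" where
  "orlicz_loc \<Phi> g \<longleftrightarrow> g \<in> borel_measurable lebesgue \<and>
     (\<forall>x. \<forall>r>0. orlicz_norm_ball \<Phi> g x r < \<infinity>)"

definition morrey_norm :: "(real \<Rightarrow> ennreal) \<Rightarrow> ('a::euclidean_space \<Rightarrow> real \<Rightarrow> real) \<Rightarrow> ('a \<Rightarrow> ennreal) \<Rightarrow> ennreal" where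
  "morrey_norm \<Phi> \<phi> g =
     (SUP p\<in>UNIV \<times> {0<..}. ennreal (young_inv \<Phi> (1 / snd p ^ DIM('a)) / \<phi> (fst p) (snd p))
                             * orlicz_norm_ball \<Phi> g (fst p) (snd p))"

definition in_morrey :: "(real \<Rightarrow> ennreal) \<Rightarrow> ('a::euclidean_space \<Rightarrow> real \<Rightarrow> real) \<Rightarrow> ('a \<Rightarrow> ennreal) \<Rightarrow> bool" where
  "in_morrey \<Phi> \<phi> g \<longleftrightarrow> orlicz_loc \<Phi> g \<and> morrey_norm \<Phi> \<phi> g < \<infinity>"

text \<open>Right derivative \<Phi>'(t) (exists everywhere on (0,\<infinity>) for finite convex \<Phi>).\<close>
definition right_deriv :: "(real \<Rightarrow> real) \<Rightarrow> real \<Rightarrow> real" where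
  "right_deriv f t = Lim (at_right 0) (\<lambda>h. (f (t + h) - f t) / h)"

definition young_lower_index :: "(real \<Rightarrow> ennreal) \<Rightarrow> ereal" where
  "young_lower_index \<Phi> =
     (INF t\<in>{0<..}. ereal (t * right_deriv (\<lambda>s. enn2real (\<Phi> s)) t / enn2real (\<Phi> t)))"

definition young_upper_index :: "(real \<Rightarrow> ennreal) \<Rightarrow> ereal" where
  "young_upper_index \<Phi> =
     (SUP t\<in>{0<..}. ereal (t * right_deriv (\<lambda>s. enn2real (\<Phi> s)) t / enn2real (\<Phi> t)))"

text \<open>The quotient t\<Phi>'(t)/\<Phi>(t) is meaningful only when 0 < \<Phi>(t) < \<infinity> for all t > 0.\<close>
definition young_indices_defined :: "(real \<Rightarrow> ennreal) \<Rightarrow> bool" where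
  "young_indices_defined \<Phi> \<longleftrightarrow> (\<forall>t>0. 0 < \<Phi> t \<and> \<Phi> t < \<infinity>)"

definition ball_avg :: "('a::euclidean_space \<Rightarrow> real) \<Rightarrow> 'a \<Rightarrow> real \<Rightarrow> real" where
  "ball_avg b x r = (\<integral>y\<in>ball x r. b y \<partial>lebesgue) / measure lebesgue (ball x r)"

definition bmo_norm :: "('a::euclidean_space \<Rightarrow> real) \<Rightarrow> ennreal" where
  "bmo_norm b = (SUP p\<in>UNIV \<times> {0<..}.
      ennreal ((\<integral>y\<in>ball (fst p) (snd p). \<bar>b y - ball_avg b (fst p) (snd p)\<bar> \<partial>lebesgue)
               / measure lebesgue (ball (fst p) (snd p))))"

definition in_BMO :: "('a::euclidean_space \<Rightarrow> real) \<Rightarrow> bool" where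
  "in_BMO b \<longleftrightarrow> (\<forall>x. \<forall>r>0. set_integrable lebesgue (ball x r) b) \<and> bmo_norm b < \<infinity>"

definition frac_max_comm :: "('a::euclidean_space \<Rightarrow> real) \<Rightarrow> real \<Rightarrow> ('a \<Rightarrow> real) \<Rightarrow> 'a \<Rightarrow> ennreal" where
  "frac_max_comm b \<alpha> f x =
     (SUP t\<in>{0<..}. ennreal (measure lebesgue (ball x t) powr (-1 + \<alpha> / real DIM('a)))
        * (\<integral>\<^sup>+ y\<in>ball x t. ennreal (\<bar>b x - b y\<bar> * \<bar>f y\<bar>) \<partial>lebesgue))"

end

theory Submission
  imports Defs
begin

text \<open>
  The commutator is split as \<open>b x - b y = (b x - b\<^sub>B) - (b y - b\<^sub>B)\<close> on each ball \<open>B = ball x t\<close>. Taking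
  \<open>q > 1\<close> so close to 1 that \<open>\<Phi>\<close> still doubles faster than \<open>2\<^sup>q\<close>, the John--Nirenberg inequality reduces
  every average to \<open>c(x,t) (\<bar>b x - b\<^sub>B\<bar> + \<parallel>b\<parallel>)\<close>, where \<open>c(x,t)\<close> is \<open>t\<^sup>\<alpha>\<close> times the \<open>L\<^sup>q\<close> mean of \<open>f\<close> over
  \<open>B\<close>.

  No pointwise bound by iterated maximal functions of \<open>f\<close> exists for \<open>sup\<^sub>t c(x,t) \<bar>b x - b\<^sub>B\<bar>\<close>, as
  \<open>b = ln \<bar>x\<bar>\<close> shows, so it is treated level by level: on \<open>2\<^sup>k < c \<le> 2\<^sup>k\<^sup>+\<^sup>1\<close> a Vitali selection
  provides balls \<open>B'\<close> containing all relevant \<open>B\<close>, so that \<open>\<bar>b x - b\<^sub>B\<bar>\<close> is at most \<open>\<bar>b x - b\<^sub>B\<^sub>'\<bar>\<close> plus the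
  maximal function of \<open>\<bar>b - b\<^sub>B\<^sub>'\<bar>\<close> restricted to \<open>B'\<close>, all of whose powers are integrable by John--Nirenberg.
  Summing over \<open>k\<close> leaves the distribution of \<open>sup\<^sub>t c(x,t)\<close>, which Hedberg's trick compares with the
  maximal function of \<open>f\<^sup>q\<close>. This gives the bound from \<open>L\<^sub>\<Phi>\<close> to \<open>L\<^sub>\<Psi>\<close>.

  On a fixed ball of radius \<open>r\<close>, radii \<open>t < r\<close> only see \<open>f\<close> on the doubled ball and are covered by the global
  bound; for \<open>t \<ge> r\<close> the means of \<open>b\<close> drift by at most \<open>\<parallel>b\<parallel> (1 + ln (t/r))\<close>, which is the weight in the
  hypothesis on \<open>\<phi>1\<close> and \<open>\<phi>2\<close>.
\<close>

section \<open>Balls, growth functions and dyadic sums\<close>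

text \<open>For \<open>b = ln |x|\<close> and \<open>f\<close> the indicator of the unit ball, every
  iterated maximal function of \<open>f\<close> is bounded, while the product of
  \<open>c(x,t)\<close> and the oscillation factor is unbounded near the origin; hence an argument
  on distributions. The two factors can be separated because the upper index of \<Psi> forces
  polynomial growth: \<Psi> of the product is at most \<Psi> of the dyadic size of \<open>c\<close>
  times a fixed power of the oscillation. The lower index of \<Phi> gives the doubling ratio above 2
  that leaves room for \<open>q > 1\<close>, so that \<open>f\<close> can be paired with a moment of
  \<open>b\<close>; the lower index of \<Psi> makes the sum over levels geometric. All estimates are
  for modulars, that is integrals of \<Phi> and \<Psi>, and norms return only at the end, where
  \<open>contract\<close> lowers a modular bound to 1. Suprema over radii are never integrated:
  measurable majorants valid for all radii at once (\<open>layer\<close>, \<open>W\<close>) replace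
  them.\<close>

declare emeasure_completion [simp del]

abbreviation vol :: "'a::euclidean_space \<Rightarrow> real \<Rightarrow> real" where
  "vol x r \<equiv> measure lebesgue (ball x r)"

abbreviation ball_int :: "'a::euclidean_space \<Rightarrow> real \<Rightarrow> ('a \<Rightarrow> ennreal) \<Rightarrow> ennreal" where
  "ball_int x r g \<equiv> \<integral>\<^sup>+y\<in>ball x r. g y \<partial>lebesgue"

lemma measure_ball_leb:
  "0 \<le> r \<Longrightarrow> vol (x::'a::euclidean_space) r = unit_ball_vol (real DIM('a)) * r ^ DIM('a)"
  by (simp add: content_ball)

lemma measure_ball_scale:
  assumes "0 \<le> r" "0 \<le> c"
  shows "vol (x::'a::euclidean_space) (c * r) = c ^ DIM('a) * vol (y::'a) r"
  using assms by (simp add: content_ball power_mult_distrib)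

lemma measure_ball_pos: "0 < r \<Longrightarrow> 0 < vol (x::'a::euclidean_space) r"
  by (simp add: content_ball_pos)

lemma emeasure_ball_leb:
  "emeasure lebesgue (ball (x::'a::euclidean_space) r) = ennreal (vol x r)"
  by (meson lmeasurable_ball emeasure_eq_measure2)

lemma ball_in_sets_lebesgue [measurable, simp]: "ball (x::'a::euclidean_space) r \<in> sets lebesgue"
  by simp

lemma nn_integral_mono_set:
  assumes "A \<subseteq> B"
  shows "(\<integral>\<^sup>+x\<in>A. g x \<partial>M) \<le> (\<integral>\<^sup>+x\<in>B. g x \<partial>M)"
  using assms by (intro nn_integral_mono) (auto simp: indicator_def)

lemma nn_integral_const_ball:
  assumes "0 \<le> c"
  shows "ball_int (x::'a::euclidean_space) t (\<lambda>y. ennreal c) = ennreal (c * vol x t)"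
  using assms by (simp add: nn_integral_cmult_indicator emeasure_ball_leb ennreal_mult)

lemma ball_subset_ballI: "dist x y + t \<le> R \<Longrightarrow> ball x t \<subseteq> ball (y :: 'a::metric_space) R"
  by (intro subsetI) (simp, metric)

text \<open>Sums over countable families of balls are written as integrals over
  \<open>count_space\<close>, which puts Tonelli at hand without fixing an enumeration; only
  measurability goes back to a series over the naturals.\<close>

lemma borel_measurable_count_space:
  fixes h :: "'i \<Rightarrow> 'a \<Rightarrow> ennreal"
  assumes C: "countable C" and h: "\<And>i. i \<in> C \<Longrightarrow> h i \<in> borel_measurable M"
  shows "(\<lambda>x. \<integral>\<^sup>+i. h i x \<partial>count_space C) \<in> borel_measurable M"
proof -
  let ?N = "to_nat_on C ` C"
  have bij: "bij_betw (from_nat_into C) ?N C"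
    using C by (intro bij_betw_byWitness[where f' = "to_nat_on C"]) auto
  have "(\<integral>\<^sup>+i. h i x \<partial>count_space C) = (\<Sum>j. h (from_nat_into C j) x * indicator ?N j)" for x
    by (subst nn_integral_bij_count_space[OF bij, symmetric])
      (simp add: nn_integral_count_space_indicator nn_integral_count_space_nat)
  moreover have "(\<lambda>x. \<Sum>j. h (from_nat_into C j) x * indicator ?N j) \<in> borel_measurable M"
  proof (rule borel_measurable_suminf_order)
    fix j
    show "(\<lambda>x. h (from_nat_into C j) x * indicator ?N j) \<in> borel_measurable M"
      using h[of "from_nat_into C j"] C by (cases "j \<in> ?N") auto
  qed
  ultimately show ?thesis by simp
qed

text \<open>What the level-set arguments need of a Young function: at least the ratio \<rho> and at
  most \<open>2 ^ p\<close> per doubling. Besides \<Phi> and \<Psi> it covers \<open>t ^ p\<close>,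
  so that one maximal inequality serves both \<open>f\<close> and the oscillation of
  \<open>b\<close>.\<close>

locale growth =
  fixes P :: "real \<Rightarrow> real" and \<rho> :: real and p :: nat
  assumes zero: "P 0 = 0"
    and pos: "0 < t \<Longrightarrow> 0 < P t"
    and mono: "0 \<le> s \<Longrightarrow> s \<le> t \<Longrightarrow> P s \<le> P t"
    and double_lower: "0 \<le> t \<Longrightarrow> \<rho> * P t \<le> P (2 * t)"
    and double_upper: "0 \<le> t \<Longrightarrow> P (2 * t) \<le> 2 ^ p * P t"
    and rho: "2 < \<rho>"
begin

lemma nonneg: "0 \<le> t \<Longrightarrow> 0 \<le> P t"
  using mono[of 0 t] zero by simp

lemma pow_lower: "0 \<le> t \<Longrightarrow> \<rho> ^ j * P t \<le> P (2 ^ j * t)"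
proof (induction j)
  case (Suc j)
  have "\<rho> ^ Suc j * P t \<le> \<rho> * P (2 ^ j * t)" using Suc rho by (simp add: mult.assoc)
  also have "... \<le> P (2 ^ Suc j * t)" using double_lower[of "2 ^ j * t"] Suc by (simp add: mult.assoc)
  finally show ?case .
qed simp

lemma pow_upper: "0 \<le> t \<Longrightarrow> P (2 ^ j * t) \<le> (2 ^ j) ^ p * P t"
proof (induction j)
  case (Suc j)
  have "P (2 ^ Suc j * t) \<le> 2 ^ p * P (2 ^ j * t)" using double_upper[of "2 ^ j * t"] Suc by (simp add: mult.assoc)
  also have "... \<le> 2 ^ p * ((2 ^ j) ^ p * P t)" using Suc by (intro mult_left_mono) auto
  finally show ?case by (simp add: power_mult_distrib mult.assoc)
qed simp

text \<open>Rounding \<open>s\<close> up to a power of 2 costs at most a factor 2, hence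
  \<open>2 * s\<close> on the right.\<close>

lemma mult_upper:
  assumes "1 \<le> s" "0 \<le> t"
  shows "P (s * t) \<le> (2 * s) ^ p * P t"
proof -
  define j where "j = nat \<lceil>log 2 s\<rceil>"
  have l0: "0 \<le> log 2 s" using assms by simp
  have 1: "s \<le> 2 ^ j"
  proof -
    have "log 2 s \<le> real j" unfolding j_def using l0 by linarith
    then show ?thesis using assms by (simp add: log_le_iff powr_realpow)
  qed
  have 2: "2 ^ j \<le> 2 * s"
  proof -
    have "real j - 1 \<le> log 2 s" unfolding j_def using l0 by linarith
    then have "2 powr (real j - 1) \<le> s" using assms by (simp add: le_log_iff)
    then show ?thesis by (simp add: powr_diff powr_realpow)
  qed
  have "P (s * t) \<le> P (2 ^ j * t)" using assms 1 by (intro mono mult_right_mono) auto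
  also have "... \<le> (2 ^ j) ^ p * P t" using pow_upper assms by simp
  also have "... \<le> (2 * s) ^ p * P t" using 2 assms nonneg by (intro mult_right_mono power_mono) auto
  finally show ?thesis .
qed

text \<open>Lower doubling read downwards: each dyadic level below \<open>k\<close> gains a factor
  \<open>1 / \<rho>\<close>, the ratio of the geometric series below.\<close>

lemma powr_lower: "P (2 powr (k - real j) * c) \<le> (1 / \<rho>) ^ j * P (2 powr k * c)" if "0 \<le> c" for k :: real
proof -
  have "\<rho> ^ j * P (2 powr (k - real j) * c) \<le> P (2 ^ j * (2 powr (k - real j) * c))"
    using that by (intro pow_lower) auto
  also have "2 ^ j * (2 powr (k - real j) * c) = 2 powr k * c"
    by (simp add: powr_diff powr_realpow)
  finally show ?thesis using rho by (simp add: field_simps power_divide)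
qed

lemma measurable_comp [measurable]:
  assumes [measurable]: "f \<in> borel_measurable M" and "\<And>x. 0 \<le> f x"
  shows "(\<lambda>x. P (f x)) \<in> borel_measurable M"
proof -
  have "mono (\<lambda>t. P (max 0 t))" by (auto intro!: monoI mono)
  then have "(\<lambda>t. P (max 0 t)) \<in> borel_measurable borel" by (rule borel_measurable_mono)
  from measurable_compose[OF assms(1) this] show ?thesis using assms(2) by (simp add: max_absorb2)
qed

end

text \<open>Reindexing by the distance below the top level \<kappa> turns a sum over all integer
  levels into an ordinary geometric series.\<close>

lemma nn_integral_int_geometric:
  fixes h :: "int \<Rightarrow> ennreal"
  assumes "\<And>k. k > \<kappa> \<Longrightarrow> h k = 0"
    and "\<And>j. h (\<kappa> - int j) \<le> ennreal (A * \<theta> ^ j)"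
    and "0 \<le> A" "0 \<le> \<theta>" "\<theta> < 1"
  shows "(\<integral>\<^sup>+k. h k \<partial>count_space UNIV) \<le> ennreal (A / (1 - \<theta>))"
proof -
  have bij: "bij_betw (\<lambda>j. \<kappa> - int j) UNIV {..\<kappa>}"
    by (rule bij_betw_byWitness[where f'="\<lambda>k. nat (\<kappa> - k)"]) auto
  have "(\<integral>\<^sup>+k. h k \<partial>count_space UNIV) = (\<integral>\<^sup>+k. h k \<partial>count_space {..\<kappa>})"
    by (intro nn_integral_count_space_eq) (use assms(1) in \<open>auto simp: not_le\<close>)
  also have "... = (\<integral>\<^sup>+j. h (\<kappa> - int j) \<partial>count_space UNIV)"
    by (rule nn_integral_bij_count_space[OF bij, symmetric])
  also have "... = (\<Sum>j. h (\<kappa> - int j))" by (rule nn_integral_count_space_nat)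
  also have "... \<le> (\<Sum>j. ennreal (A * \<theta> ^ j))" by (intro suminf_le assms) auto
  also have "... = ennreal (\<Sum>j. A * \<theta> ^ j)"
    using assms by (intro suminf_ennreal2) auto
  also have "(\<Sum>j. A * \<theta> ^ j) = A / (1 - \<theta>)"
    using assms by (simp add: suminf_mult suminf_geometric)
  finally show ?thesis .
qed

abbreviation dyadic :: "int \<Rightarrow> real" where "dyadic k \<equiv> 2 powr real_of_int k"

lemma dyadic_exponent:
  assumes "0 < (a::real)"
  obtains k :: int where "dyadic k < a" "a \<le> 2 powr (real_of_int k + 1)"
proof
  define k where "k = \<lceil>log 2 a\<rceil> - 1"
  have "real_of_int k < log 2 a" "log 2 a \<le> real_of_int k + 1" unfolding k_def by linarith+
  then show "dyadic k < a" "a \<le> 2 powr (real_of_int k + 1)"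
    using assms by (simp_all add: less_log_iff log_le_iff)
qed

text \<open>The set where the centred Hardy--Littlewood maximal function of \<open>g\<close> exceeds \<open>l\<close>; only these sets
  are used, never the maximal function itself.\<close>

definition HLset :: "('a::euclidean_space \<Rightarrow> ennreal) \<Rightarrow> real \<Rightarrow> 'a set" where
  "HLset g l = {x. \<exists>t>0. ennreal (l * vol x t) < ball_int x t g}"

text \<open>The strict inequality survives a slight increase of the radius, by continuity of the
  volume, and \<open>ball z (t + d)\<close> contains \<open>ball x t\<close> once \<open>z\<close>
  is within \<open>d\<close> of \<open>x\<close>. Measurability of the set then holds for any
  \<open>g\<close>.\<close>

lemma open_HLset: "open (HLset g l)"
  unfolding open_dist
proof
  fix x assume "x \<in> HLset g l"
  then obtain t where t: "t > 0" "ennreal (l * vol x t) < ball_int x t g"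
    by (auto simp: HLset_def)
  have "((\<lambda>d. ennreal (l * (unit_ball_vol (real DIM('a)) * (t + d) ^ DIM('a)))) \<longlongrightarrow>
      ennreal (l * (unit_ball_vol (real DIM('a)) * (t + 0) ^ DIM('a)))) (at_right 0)"
    by (intro tendsto_intros)
  then have "((\<lambda>d. ennreal (l * (unit_ball_vol (real DIM('a)) * (t + d) ^ DIM('a)))) \<longlongrightarrow>
      ennreal (l * vol x t)) (at_right 0)"
    using t by (simp add: content_ball)
  from order_tendstoD(2)[OF this t(2)]
  have "\<forall>\<^sub>F d in at_right 0. ennreal (l * (unit_ball_vol (real DIM('a)) * (t + d) ^ DIM('a))) < ball_int x t g \<and> d > 0"
    by (simp add: eventually_at_right_less eventually_conj)
  then obtain d where d: "d > 0" "ennreal (l * (unit_ball_vol (real DIM('a)) * (t + d) ^ DIM('a))) < ball_int x t g"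
    by (metis (mono_tags, lifting) eventually_happens' trivial_limit_at_right_real)
  show "\<exists>e>0. \<forall>z. dist z x < e \<longrightarrow> z \<in> HLset g l"
  proof (intro exI conjI allI impI)
    show "d > 0" by fact
    fix z assume "dist z x < d"
    then have "ball x t \<subseteq> ball z (t + d)" by (intro subsetI) (simp, metric)
    then have "ball_int x t g \<le> ball_int z (t+d) g"
      by (rule nn_integral_mono_set)
    with d t show "z \<in> HLset g l"
      unfolding HLset_def by (auto simp: content_ball intro!: exI[of _ "t+d"] elim: less_le_trans)
  qed
qed

lemma HLset_measurable [measurable, simp]: "HLset g l \<in> sets lebesgue"
  by (metis open_HLset borel_open sets_completionI_sets sets_lborel)

section \<open>Covering arguments\<close>

lemma sum_disjoint_le:
  assumes C: "countable C" and dis: "pairwise (\<lambda>i j. disjnt (A i) (A j)) C"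
    and [measurable]: "\<And>i. i \<in> C \<Longrightarrow> A i \<in> sets M" "g \<in> borel_measurable M"
  shows "(\<integral>\<^sup>+i. (\<integral>\<^sup>+y\<in>A i. g y \<partial>M) \<partial>count_space C) \<le> (\<integral>\<^sup>+y\<in>(\<Union>i\<in>C. A i). g y \<partial>M)"
proof -
  have "(\<integral>\<^sup>+i. (\<integral>\<^sup>+y\<in>A i. g y \<partial>M) \<partial>count_space C) = (\<integral>\<^sup>+y. (\<integral>\<^sup>+i. g y * indicator (A i) y \<partial>count_space C) \<partial>M)"
    by (rule nn_integral_count_space_nn_integral[symmetric]) (use C in auto)
  also have "... \<le> (\<integral>\<^sup>+y\<in>(\<Union>i\<in>C. A i). g y \<partial>M)"
  proof (rule nn_integral_mono)
    fix y
    show "(\<integral>\<^sup>+i. g y * indicator (A i) y \<partial>count_space C) \<le> g y * indicator (\<Union>i\<in>C. A i) y"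
    proof (cases "\<exists>i\<in>C. y \<in> A i")
      case True
      then obtain i where i: "i \<in> C" "y \<in> A i" by auto
      have "(\<integral>\<^sup>+j. g y * indicator (A j) y \<partial>count_space C) = (\<integral>\<^sup>+j. g y * indicator {i} j \<partial>count_space C)"
      proof (intro nn_integral_cong)
        fix j assume "j \<in> space (count_space C)"
        then show "g y * indicator (A j) y = g y * indicator {i} j"
          using dis i by (auto simp: indicator_def pairwise_def disjnt_iff)
      qed
      also have "... = g y" using i by (simp add: nn_integral_cmult_indicator)
      finally show ?thesis using i by (auto simp: indicator_def)
    next
      case False
      then have "(\<integral>\<^sup>+i. g y * indicator (A i) y \<partial>count_space C) = (\<integral>\<^sup>+i. 0 \<partial>count_space C)"
        by (intro nn_integral_cong) (auto simp: indicator_def)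
      then show ?thesis by simp
    qed
  qed
  finally show ?thesis .
qed

text \<open>Covering is required only almost everywhere, because the Vitali covering theorem and the
  differentiation argument each lose a null set.\<close>

lemma cover_le_sum:
  assumes C: "countable C" and S: "AE y in M. y \<in> S \<longrightarrow> y \<in> (\<Union>i\<in>C. A i)"
    and [measurable]: "\<And>i. i \<in> C \<Longrightarrow> A i \<in> sets M" "g \<in> borel_measurable M"
  shows "(\<integral>\<^sup>+y\<in>S. g y \<partial>M) \<le> (\<integral>\<^sup>+i. (\<integral>\<^sup>+y\<in>A i. g y \<partial>M) \<partial>count_space C)"
proof -
  have "(\<integral>\<^sup>+y\<in>S. g y \<partial>M) \<le> (\<integral>\<^sup>+y. (\<integral>\<^sup>+i. g y * indicator (A i) y \<partial>count_space C) \<partial>M)"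
  proof (rule nn_integral_mono_AE)
    show "AE y in M. g y * indicator S y \<le> (\<integral>\<^sup>+i. g y * indicator (A i) y \<partial>count_space C)"
      using S
    proof eventually_elim
      case (elim y)
      show ?case
      proof (cases "y \<in> S")
        case True
        then obtain i where i: "i \<in> C" "y \<in> A i" using elim by auto
        show ?thesis
          using nn_integral_ge_point[OF i(1), of "\<lambda>i. g y * indicator (A i) y"] i True by simp
      qed simp
    qed
  qed
  also have "... = (\<integral>\<^sup>+i. (\<integral>\<^sup>+y\<in>A i. g y \<partial>M) \<partial>count_space C)"
    by (rule nn_integral_count_space_nn_integral) (use C in auto)
  finally show ?thesis .
qed

lemma cover_emeasure_le_sum:
  assumes C: "countable C" and S: "AE y in M. y \<in> S \<longrightarrow> y \<in> (\<Union>i\<in>C. A i)" and S_meas: "S \<in> sets M"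
    and A: "\<And>i. i \<in> C \<Longrightarrow> A i \<in> sets M"
  shows "emeasure M S \<le> (\<integral>\<^sup>+i. emeasure M (A i) \<partial>count_space C)"
proof -
  have "emeasure M S \<le> (\<integral>\<^sup>+i. (\<integral>\<^sup>+y\<in>A i. 1 \<partial>M) \<partial>count_space C)"
    using cover_le_sum[OF C S A, of "\<lambda>_. 1"] S_meas by simp
  also have "... = (\<integral>\<^sup>+i. emeasure M (A i) \<partial>count_space C)"
    using A by (intro nn_integral_cong) simp
  finally show ?thesis .
qed

text \<open>Vitali's selection yields disjoint balls whose fivefold dilates cover, whence
  \<open>5 ^ DIM('a)\<close>. It needs bounded radii; these follow from the finite integral of
  \<open>g\<close>, so an infinite one is treated apart.\<close>

lemma HLset_weak_type:
  fixes g :: "'a::euclidean_space \<Rightarrow> ennreal"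
  assumes [measurable]: "g \<in> borel_measurable lebesgue" and l: "0 < l"
  shows "ennreal l * emeasure lebesgue (HLset g l) \<le> 5 ^ DIM('a) * (\<integral>\<^sup>+y. g y \<partial>lebesgue)"
proof (cases "(\<integral>\<^sup>+y. g y \<partial>lebesgue) = \<infinity>")
  case True
  then show ?thesis by (simp add: ennreal_mult_top)
next
  case False
  then obtain I where I: "I \<ge> 0" "(\<integral>\<^sup>+y. g y \<partial>lebesgue) = ennreal I"
    by (metis ennreal_cases infinity_ennreal_def)
  let ?v = "unit_ball_vol (real DIM('a))"
  have v: "?v > 0" by simp
  define t where "t x = (SOME t. t > 0 \<and> ennreal (l * vol x t) < ball_int x t g)" for x
  have t: "t x > 0" "ennreal (l * vol x (t x)) < ball_int x (t x) g"
    if "x \<in> HLset g l" for x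
    using that someI_ex[of "\<lambda>t. t > 0 \<and> ennreal (l * vol x t) < ball_int x t g"]
    unfolding t_def HLset_def by auto
  have bd: "t x \<le> max 1 (I / (l * ?v))" if x: "x \<in> HLset g l" for x
  proof (cases "t x \<le> 1")
    case False
    have "ennreal (l * vol x (t x)) \<le> (\<integral>\<^sup>+y. g y \<partial>lebesgue)"
      by (rule order.trans[OF less_imp_le[OF t(2)[OF x]]]) (auto intro!: nn_integral_mono simp: indicator_def)
    then have "l * vol x (t x) \<le> I" using I by simp
    then have "t x ^ DIM('a) \<le> I / (l * ?v)"
      using False l v by (simp add: content_ball field_simps)
    moreover have "t x \<le> t x ^ DIM('a)" using False by (intro self_le_power) auto
    ultimately show ?thesis by linarith
  qed auto
  have sub: "HLset g l \<subseteq> (\<Union>i\<in>HLset g l. ball i (t i))" using t(1) by auto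
  have r: "0 < t i \<and> t i \<le> max 1 (I / (l * ?v))" if "i \<in> HLset g l" for i
    using t(1) bd that by simp
  obtain C where C: "countable C" "C \<subseteq> HLset g l"
     "pairwise (\<lambda>i j. disjnt (ball i (t i)) (ball j (t j))) C"
     "HLset g l \<subseteq> (\<Union>i\<in>C. ball i (5 * t i))"
    by (rule Vitali_covering_lemma_balls[OF sub r])
  have "emeasure lebesgue (HLset g l) \<le> (\<integral>\<^sup>+i. emeasure lebesgue (ball i (5 * t i)) \<partial>count_space C)"
    by (rule cover_emeasure_le_sum[OF C(1)]) (use C(4) in \<open>auto simp del: mem_ball intro!: AE_I2\<close>)
  then have "ennreal l * emeasure lebesgue (HLset g l) \<le> ennreal l * (\<integral>\<^sup>+i. emeasure lebesgue (ball i (5 * t i)) \<partial>count_space C)"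
    by (rule mult_left_mono) simp
  also have "... = (\<integral>\<^sup>+i. ennreal l * emeasure lebesgue (ball i (5 * t i)) \<partial>count_space C)"
    by (simp add: nn_integral_cmult)
  also have "... \<le> (\<integral>\<^sup>+i. 5 ^ DIM('a) * ball_int i (t i) g \<partial>count_space C)"
  proof (rule nn_integral_mono)
    fix i assume "i \<in> space (count_space C)"
    then have i: "i \<in> HLset g l" using C by auto
    have "ennreal l * emeasure lebesgue (ball i (5 * t i)) = ennreal (5 ^ DIM('a) * (l * vol i (t i)))"
      using measure_ball_scale[of "t i" 5 i i] t(1)[OF i] l
      by (simp add: emeasure_ball_leb ennreal_mult[symmetric] algebra_simps)
    also have "... = 5 ^ DIM('a) * ennreal (l * vol i (t i))"
      using l by (simp add: ennreal_mult ennreal_power[symmetric])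
    also have "... \<le> 5 ^ DIM('a) * ball_int i (t i) g"
      using t(2)[OF i] by (intro mult_left_mono) auto
    finally show "ennreal l * emeasure lebesgue (ball i (5 * t i)) \<le> 5 ^ DIM('a) * ball_int i (t i) g" .
  qed
  also have "... = 5 ^ DIM('a) * (\<integral>\<^sup>+i. (ball_int i (t i) g) \<partial>count_space C)"
    by (simp add: nn_integral_cmult)
  also have "(\<integral>\<^sup>+i. (ball_int i (t i) g) \<partial>count_space C) \<le> (\<integral>\<^sup>+y\<in>(\<Union>i\<in>C. ball i (t i)). g y \<partial>lebesgue)"
    by (rule sum_disjoint_le) (use C in auto)
  also have "... \<le> (\<integral>\<^sup>+y. g y \<partial>lebesgue)" by (auto intro!: nn_integral_mono simp: indicator_def)
  finally show ?thesis by (simp add: mult_left_mono)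
qed

text \<open>Values of \<open>g\<close> up to \<open>l / 2\<close> contribute at most
  \<open>l / 2\<close> to any mean, so the rest must still have a mean above \<open>l / 2\<close>.
  The truncation is what makes the sum over all levels converge in the interpolation below.\<close>

lemma HLset_weak_type_truncated:
  fixes g :: "'a::euclidean_space \<Rightarrow> ennreal"
  assumes [measurable]: "g \<in> borel_measurable lebesgue" and l: "0 < l"
  shows "ennreal l * emeasure lebesgue (HLset g l)
    \<le> 2 * 5 ^ DIM('a) * (\<integral>\<^sup>+y. g y * indicator {y. ennreal (l / 2) < g y} y \<partial>lebesgue)"
proof -
  let ?g = "\<lambda>y. g y * indicator {y. ennreal (l / 2) < g y} y"
  have [measurable]: "{y. ennreal (l / 2) < g y} \<in> sets lebesgue"
    using measurable_sets[OF assms(1), of "{ennreal (l/2) <..}"] by (simp add: vimage_def)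
  have "HLset g l \<subseteq> HLset ?g (l / 2)"
  proof
    fix x assume "x \<in> HLset g l"
    then obtain t where t: "t > 0" "ennreal (l * vol x t) < ball_int x t g"
      by (auto simp: HLset_def)
    let ?h = "l / 2 * vol x t"
    have "ball_int x t g \<le> (\<integral>\<^sup>+y. ?g y * indicator (ball x t) y + ennreal (l / 2) * indicator (ball x t) y \<partial>lebesgue)"
      by (intro nn_integral_mono) (auto simp: indicator_def not_less)
    also have "... = ball_int x t (\<lambda>y. ?g y) + ennreal ?h"
      using l by (subst nn_integral_add) (auto simp: nn_integral_const_ball)
    finally have "ennreal (?h + ?h) < ball_int x t (\<lambda>y. ?g y) + ennreal ?h"
      using t by (simp add: less_le_trans)
    moreover have "ennreal (?h + ?h) = ennreal ?h + ennreal ?h"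
      using l by (intro ennreal_plus) auto
    ultimately have "ennreal ?h + ennreal ?h < ball_int x t (\<lambda>y. ?g y) + ennreal ?h"
      by simp
    then have "ennreal ?h < ball_int x t (\<lambda>y. ?g y)"
      using add_right_mono[of "\<integral>\<^sup>+y\<in>ball x t. ?g y \<partial>lebesgue" "ennreal ?h" "ennreal ?h"]
      by (meson leD not_le_imp_less)
    then show "x \<in> HLset ?g (l / 2)" using t by (auto simp: HLset_def)
  qed
  then have "emeasure lebesgue (HLset g l) \<le> emeasure lebesgue (HLset ?g (l / 2))"
    by (intro emeasure_mono) auto
  then have "ennreal l * emeasure lebesgue (HLset g l) \<le> ennreal (2 * (l / 2)) * emeasure lebesgue (HLset ?g (l / 2))"
    by (simp add: mult_left_mono)
  also have "... = 2 * (ennreal (l / 2) * emeasure lebesgue (HLset ?g (l / 2)))"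
    using l by (subst ennreal_mult) (auto simp: mult.assoc)
  also have "... \<le> 2 * (5 ^ DIM('a) * (\<integral>\<^sup>+y. ?g y \<partial>lebesgue))"
    using l by (intro mult_left_mono HLset_weak_type) auto
  finally show ?thesis by (simp add: mult.assoc)
qed

text \<open>A substitute for the Lebesgue differentiation theorem: if \<open>E\<close> had positive measure, cover it by small
  disjoint balls inside an open set of almost the same measure.\<close>

lemma density_bound_null:
  fixes u :: "'a::euclidean_space \<Rightarrow> ennreal"
  assumes E: "E \<in> sets lebesgue" "emeasure lebesgue E < \<infinity>" and [measurable]: "u \<in> borel_measurable lebesgue"
    and l: "0 \<le> l" "l < l'" and d: "0 < d"
    and lower: "\<And>x. x \<in> E \<Longrightarrow> ennreal l' \<le> u x"
    and upper: "\<And>x t. x \<in> E \<Longrightarrow> 0 < t \<Longrightarrow> t < d \<Longrightarrow> (ball_int x t u) \<le> ennreal (l * vol x t)"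
  shows "emeasure lebesgue E = 0"
proof (rule ccontr)
  assume ne: "emeasure lebesgue E \<noteq> 0"
  obtain e where e: "emeasure lebesgue E = ennreal e" "e > 0"
    using ne E by (cases "emeasure lebesgue E") (auto simp: less_le)
  \<comment> \<open>Chosen to make \<open>l * (e + \<epsilon>) < l' * e\<close>; the summand 1 in
    the denominator admits \<open>l = 0\<close>.\<close>
  define \<epsilon> where "\<epsilon> = e * (l' - l) / (l + 1)"
  have eps: "\<epsilon> > 0" using e l by (simp add: \<epsilon>_def)
  have "l * \<epsilon> < e * (l' - l)"
    using e l by (simp add: \<epsilon>_def field_simps)
  then have less: "l * (e + \<epsilon>) < l' * e" by (simp add: algebra_simps)
  obtain T where T: "open T" "E \<subseteq> T" "T - E \<in> lmeasurable" "emeasure lebesgue (T - E) < ennreal \<epsilon>"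
    using sets_lebesgue_outer_open[OF E(1) eps] by blast
  have Tm: "T \<in> sets lebesgue" using T(1) by (metis borel_open sets_completionI_sets sets_lborel)
  have "emeasure lebesgue T = emeasure lebesgue E + emeasure lebesgue (T - E)"
  proof -
    have "E \<union> (T - E) = T" using T by auto
    then show ?thesis using plus_emeasure[OF E(1), of "T - E"] T E by (simp add: fmeasurableD)
  qed
  also have "... \<le> ennreal e + ennreal \<epsilon>" using T e by (intro add_mono) auto
  finally have Tle: "emeasure lebesgue T \<le> ennreal (e + \<epsilon>)" using e eps by simp
  define K where "K = {(x, t). x \<in> E \<and> 0 < t \<and> t < d \<and> ball x t \<subseteq> T}"
  have K: "\<exists>i. i \<in> K \<and> x \<in> ball (fst i) (snd i) \<and> snd i < d'" if xE: "x \<in> E" "0 < d'" for x d'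
  proof -
    obtain s where s: "s > 0" "ball x s \<subseteq> T" using T xE open_contains_ball[of T] by blast
    define t where "t = Min {s, d / 2, d' / 2}"
    have t: "0 < t" "t \<le> s" "t < d" "t < d'" unfolding t_def using s d that by auto
    have "ball x t \<subseteq> T" using s t by (meson subset_ball subset_trans)
    then show ?thesis using t that by (intro exI[of _ "(x, t)"]) (auto simp: K_def)
  qed
  obtain C where C: "countable C" "C \<subseteq> K"
     "pairwise (\<lambda>i j. disjnt (ball (fst i) (snd i)) (ball (fst j) (snd j))) C"
     "negligible (E - (\<Union>i\<in>C. ball (fst i) (snd i)))"
    by (rule Vitali_covering_theorem_balls[OF K])
  have AE: "AE y in lebesgue. y \<in> E \<longrightarrow> y \<in> (\<Union>i\<in>C. ball (fst i) (snd i))"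
  proof -
    have "AE y in lebesgue. y \<notin> E - (\<Union>i\<in>C. ball (fst i) (snd i))"
      using C(4) by (intro AE_not_in) (simp add: negligible_iff_null_sets)
    then show ?thesis by eventually_elim blast
  qed
  have "ennreal (l' * e) = ennreal l' * emeasure lebesgue E"
    using e l by (simp add: ennreal_mult)
  also have "... = (\<integral>\<^sup>+y\<in>E. ennreal l' \<partial>lebesgue)"
    using E by (simp add: nn_integral_cmult_indicator)
  also have "... \<le> (\<integral>\<^sup>+y\<in>E. u y \<partial>lebesgue)"
    using lower by (intro nn_integral_mono) (auto simp: indicator_def)
  also have "... \<le> (\<integral>\<^sup>+i. (ball_int (fst i) (snd i) u) \<partial>count_space C)"
    by (rule cover_le_sum) (use C AE in auto)
  also have "... \<le> (\<integral>\<^sup>+i. (ball_int (fst i) (snd i) (\<lambda>y. ennreal l)) \<partial>count_space C)"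
  proof (rule nn_integral_mono)
    fix i assume "i \<in> space (count_space C)"
    then have "i \<in> K" using C by auto
    then show "ball_int (fst i) (snd i) u \<le> ball_int (fst i) (snd i) (\<lambda>y. ennreal l)"
      using upper[of "fst i" "snd i"] l by (auto simp: K_def nn_integral_const_ball)
  qed
  also have "... \<le> (\<integral>\<^sup>+y\<in>(\<Union>i\<in>C. ball (fst i) (snd i)). ennreal l \<partial>lebesgue)"
    by (rule sum_disjoint_le) (use C in auto)
  also have "... \<le> (\<integral>\<^sup>+y\<in>T. ennreal l \<partial>lebesgue)"
  proof (intro nn_integral_mono_set UN_least)
    fix i assume "i \<in> C"
    then have "i \<in> K" using C(2) by auto
    then show "ball (fst i) (snd i) \<subseteq> T" by (cases i) (simp add: K_def)
  qed
  also have "... = ennreal l * emeasure lebesgue T" using Tm by (simp add: nn_integral_cmult_indicator)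
  also have "... \<le> ennreal l * ennreal (e + \<epsilon>)" using Tle by (rule mult_left_mono) simp
  also have "... = ennreal (l * (e + \<epsilon>))" using l e eps by (simp add: ennreal_mult)
  finally have "l' * e \<le> l * (e + \<epsilon>)" using l e eps by (subst (asm) ennreal_le_iff) auto
  with less show False by simp
qed

text \<open>A measurable dyadic majorant of \<open>P\<close> applied to the \<open>q\<close>-th root of the maximal function of \<open>f\<^sup>q\<close>.\<close>

definition layer :: "(real \<Rightarrow> real) \<Rightarrow> real \<Rightarrow> ('a::euclidean_space \<Rightarrow> real) \<Rightarrow> 'a \<Rightarrow> ennreal" where
  "layer P q f x = (\<integral>\<^sup>+k. ennreal (P (2 powr (real_of_int k + 1))) *
     indicator (HLset (\<lambda>y. ennreal (f y powr q)) (2 powr (real_of_int k * q))) x \<partial>count_space UNIV)"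

lemma layer_measurable [measurable]: "layer P q f \<in> borel_measurable lebesgue"
  unfolding layer_def by (rule borel_measurable_count_space) auto

section \<open>Maximal inequality for modulars, by interpolation over dyadic levels\<close>

context growth
begin

text \<open>The contribution of one value \<open>z = f y\<close> after sum and integral are
  exchanged. One level down, \<open>P\<close> shrinks by at least \<rho> while the weight grows by
  \<open>2 powr q\<close>, so \<open>2 powr q < \<rho>\<close> gives a geometric series; the
  indicator cuts off the levels above \<open>z\<close>.\<close>

lemma layer_pointwise:
  assumes q: "1 \<le> q" "2 powr q < \<rho>" and z: "0 \<le> z"
  shows "(\<integral>\<^sup>+k. ennreal (P (2 powr (real_of_int k + 1)) * 2 powr - (real_of_int k * q) * z powr q) *
      indicator {k. 2 powr (real_of_int k * q) / 2 < z powr q} k \<partial>count_space UNIV)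
    \<le> ennreal (4 ^ p / (1 - 2 powr q / \<rho>) * P z)"
proof (cases "z = 0")
  case True
  then show ?thesis by simp
next
  case False
  with z have z: "z > 0" by simp
  \<comment> \<open>Taking the exponent of \<open>2 * z\<close> gives both
    \<open>z \<le> dyadic \<kappa>\<close>, which kills all levels above \<kappa>, and
    \<open>2 powr (\<kappa> + 1) < 4 * z\<close>, the source of \<open>4 ^ p\<close>.\<close>
  obtain \<kappa> :: int where \<kappa>: "dyadic \<kappa> < 2 * z" "2 * z \<le> 2 powr (real_of_int \<kappa> + 1)"
    using dyadic_exponent[of "2 * z"] z by auto
  have zk: "z \<le> dyadic \<kappa>" using \<kappa>(2) by (simp add: powr_add)
  define h :: "int \<Rightarrow> ennreal" where "h k = ennreal (P (2 powr (real_of_int k + 1)) * 2 powr - (real_of_int k * q) * z powr q) *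
      indicator {k. 2 powr (real_of_int k * q) / 2 < z powr q} k" for k
  have "(\<integral>\<^sup>+k. h k \<partial>count_space UNIV) \<le> ennreal ((4 ^ p * P z) / (1 - 2 powr q / \<rho>))"
  proof (rule nn_integral_int_geometric)
    fix k assume k: "k > \<kappa>"
    have "z powr q \<le> (dyadic \<kappa>) powr q" using zk z q by (intro powr_mono2) auto
    also have "... = 2 powr (real_of_int \<kappa> * q)" by (simp add: powr_powr)
    also have "... \<le> 2 powr (real_of_int k * q - 1)"
    proof -
      have "real_of_int \<kappa> + 1 \<le> real_of_int k" using k by linarith
      then have "(real_of_int \<kappa> + 1) * q \<le> real_of_int k * q" using q by (intro mult_right_mono) auto
      then show ?thesis using q by (intro powr_mono) (auto simp: algebra_simps)
    qed
    also have "... = 2 powr (real_of_int k * q) / 2" by (simp add: powr_diff)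
    finally show "h k = 0" by (simp add: h_def)
  next
    fix j :: nat
    let ?k = "real_of_int (\<kappa> - int j)"
    have "P (2 powr (?k + 1)) = P (2 powr ((real_of_int \<kappa> + 1) - real j) * 1)" by (simp add: algebra_simps)
    also have "... \<le> (1 / \<rho>) ^ j * P (2 powr (real_of_int \<kappa> + 1) * 1)" by (rule powr_lower) simp
    also have "... \<le> (1 / \<rho>) ^ j * (4 ^ p * P z)"
    proof (rule mult_left_mono)
      have "P (2 powr (real_of_int \<kappa> + 1) * 1) \<le> P (2 ^ 2 * z)"
        using \<kappa>(1) by (intro mono) (auto simp: powr_add)
      also have "... \<le> (2 ^ 2) ^ p * P z" using z by (intro pow_upper) auto
      finally show "P (2 powr (real_of_int \<kappa> + 1) * 1) \<le> 4 ^ p * P z" by simp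
    qed (use rho in auto)
    finally have 1: "P (2 powr (?k + 1)) \<le> (1 / \<rho>) ^ j * (4 ^ p * P z)" .
    have "2 powr - (?k * q) * z powr q \<le> 2 powr - (?k * q) * (dyadic \<kappa>) powr q"
      using zk z q by (intro mult_left_mono powr_mono2) auto
    also have "... = (2 powr q) powr real j"
      by (simp add: powr_powr powr_add[symmetric] algebra_simps)
    also have "... = (2 powr q) ^ j" by (simp add: powr_realpow)
    finally have 2: "2 powr - (?k * q) * z powr q \<le> (2 powr q) ^ j" .
    have "P (2 powr (?k + 1)) * (2 powr - (?k * q) * z powr q) \<le> ((1 / \<rho>) ^ j * (4 ^ p * P z)) * (2 powr q) ^ j"
      using 1 2 rho z nonneg[of z] by (intro mult_mono) auto
    also have "... = (4 ^ p * P z) * (2 powr q / \<rho>) ^ j" by (simp add: power_divide)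
    finally show "h (\<kappa> - int j) \<le> ennreal ((4 ^ p * P z) * (2 powr q / \<rho>) ^ j)"
      by (auto simp: h_def indicator_def mult.assoc intro!: ennreal_leI)
  next
    show "2 powr q / \<rho> < 1" using q rho by simp
  qed (use rho z nonneg[of z] in auto)
  then show ?thesis by (simp add: h_def)
qed

text \<open>Marcinkiewicz interpolation in modular form: the truncated weak-type bound on each
  level, then Tonelli and \<open>layer_pointwise\<close> at every point.\<close>

lemma layer_integral_le:
  fixes f :: "'a::euclidean_space \<Rightarrow> real"
  assumes q: "1 \<le> q" "2 powr q < \<rho>"
    and [measurable]: "f \<in> borel_measurable lebesgue" and f: "\<And>x. 0 \<le> f x"
  shows "(\<integral>\<^sup>+x. layer P q f x \<partial>lebesgue)
    \<le> ennreal (2 * 5 ^ DIM('a) * (4 ^ p / (1 - 2 powr q / \<rho>))) * (\<integral>\<^sup>+x. ennreal (P (f x)) \<partial>lebesgue)"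
proof -
  let ?g = "\<lambda>y. ennreal (f y powr q)"
  let ?c = "ennreal (2 * 5 ^ DIM('a))"
  let ?d = "4 ^ p / (1 - 2 powr q / \<rho>)"
  let ?a = "\<lambda>k::int. P (2 powr (real_of_int k + 1))"
  let ?l = "\<lambda>k::int. 2 powr (real_of_int k * q)"
  let ?E = "\<lambda>k. {y. ?l k / 2 < f y powr q}"
  let ?h = "\<lambda>k y. ennreal (?a k * 2 powr - (real_of_int k * q) * f y powr q) * indicator (?E k) y"
  have a: "0 \<le> ?a k" for k by (intro nonneg) auto
  have fq [measurable]: "(\<lambda>y. f y powr q) \<in> borel_measurable lebesgue"
    by (rule powr_real_measurable) (use assms(3) in auto)
  have [measurable]: "?E k \<in> sets lebesgue" for k
  proof -
    have "{y \<in> space lebesgue. ?l k / 2 < f y powr q} \<in> sets lebesgue"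
      using fq unfolding borel_measurable_iff_greater by blast
    then show ?thesis by (simp only: space_completion space_lborel space_borel UNIV_I simp_thms)
  qed
  have *: "ennreal (?a k) * emeasure lebesgue (HLset ?g (?l k))
      \<le> ?c * (\<integral>\<^sup>+y. ?h k y \<partial>lebesgue)" for k
  proof -
    have l: "ennreal (?l k) * emeasure lebesgue (HLset ?g (?l k))
      \<le> ?c * (\<integral>\<^sup>+y. ?g y * indicator (?E k) y \<partial>lebesgue)"
    proof -
      have "{y. ennreal (?l k / 2) < ?g y} = ?E k"
        by (subst ennreal_less_iff) auto
      with HLset_weak_type_truncated[of ?g "?l k"] show ?thesis
        by (simp add: ennreal_mult ennreal_power[symmetric])
    qed
    have "ennreal (?a k) * emeasure lebesgue (HLset ?g (?l k))
      = ennreal (?a k * 2 powr - (real_of_int k * q)) * (ennreal (?l k) * emeasure lebesgue (HLset ?g (?l k)))"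
    proof -
      have e: "?a k * 2 powr - (real_of_int k * q) * ?l k = ?a k"
        by (simp add: powr_minus)
      have "ennreal (?a k) = ennreal (?a k * 2 powr - (real_of_int k * q)) * ennreal (?l k)"
        using a by (subst ennreal_mult[symmetric]) (simp_all only: e powr_ge_zero mult_nonneg_nonneg)
      then show ?thesis by (simp only: mult.assoc)
    qed
    also have "... \<le> ennreal (?a k * 2 powr - (real_of_int k * q)) * (?c * (\<integral>\<^sup>+y. ?g y * indicator (?E k) y \<partial>lebesgue))"
      using l by (rule mult_left_mono) simp
    also have "... = ?c * (ennreal (?a k * 2 powr - (real_of_int k * q)) * (\<integral>\<^sup>+y. ?g y * indicator (?E k) y \<partial>lebesgue))"
      by (simp only: mult.left_commute)
    also have "ennreal (?a k * 2 powr - (real_of_int k * q)) * (\<integral>\<^sup>+y. ?g y * indicator (?E k) y \<partial>lebesgue)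
       = (\<integral>\<^sup>+y. ennreal (?a k * 2 powr - (real_of_int k * q)) * (?g y * indicator (?E k) y) \<partial>lebesgue)"
      by (rule nn_integral_cmult[symmetric]) measurable
    also have "... = (\<integral>\<^sup>+y. ?h k y \<partial>lebesgue)"
      using a by (intro nn_integral_cong) (simp add: ennreal_mult mult.assoc)
    finally show ?thesis .
  qed
  have "(\<integral>\<^sup>+x. layer P q f x \<partial>lebesgue)
    = (\<integral>\<^sup>+k. (\<integral>\<^sup>+x. ennreal (?a k) * indicator (HLset ?g (?l k)) x \<partial>lebesgue) \<partial>count_space UNIV)"
    unfolding layer_def by (rule nn_integral_count_space_nn_integral) auto
  also have "... = (\<integral>\<^sup>+k. ennreal (?a k) * emeasure lebesgue (HLset ?g (?l k)) \<partial>count_space UNIV)"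
    by (simp add: nn_integral_cmult_indicator)
  also have "... \<le> (\<integral>\<^sup>+k. ?c * (\<integral>\<^sup>+y. ?h k y \<partial>lebesgue) \<partial>count_space UNIV)"
    using * by (intro nn_integral_mono) auto
  also have "... = ?c * (\<integral>\<^sup>+k. (\<integral>\<^sup>+y. ?h k y \<partial>lebesgue) \<partial>count_space UNIV)"
    by (rule nn_integral_cmult) simp
  also have "(\<integral>\<^sup>+k. (\<integral>\<^sup>+y. ?h k y \<partial>lebesgue) \<partial>count_space UNIV)
     = (\<integral>\<^sup>+y. (\<integral>\<^sup>+k. ?h k y \<partial>count_space UNIV) \<partial>lebesgue)"
    by (rule nn_integral_count_space_nn_integral[symmetric]) measurable
  also have "... \<le> (\<integral>\<^sup>+y. ennreal (?d * P (f y)) \<partial>lebesgue)"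
  proof (rule nn_integral_mono)
    fix y
    show "(\<integral>\<^sup>+k. ?h k y \<partial>count_space UNIV)
      \<le> ennreal (?d * P (f y))"
      using layer_pointwise[OF q f[of y]] by (simp add: indicator_def)
  qed
  also have "... = ennreal (?d) * (\<integral>\<^sup>+y. ennreal (P (f y)) \<partial>lebesgue)"
  proof -
    have "0 \<le> ?d" using q rho by simp
    then have "(\<integral>\<^sup>+y. ennreal (?d * P (f y)) \<partial>lebesgue)
        = (\<integral>\<^sup>+y. ennreal (?d) * ennreal (P (f y)) \<partial>lebesgue)"
      by (intro nn_integral_cong ennreal_mult nonneg f)
    also have "... = ennreal (?d) * (\<integral>\<^sup>+y. ennreal (P (f y)) \<partial>lebesgue)"
      using measurable_comp[OF assms(3) f] by (intro nn_integral_cmult) simp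
    finally show ?thesis .
  qed
  finally have "(\<integral>\<^sup>+x. layer P q f x \<partial>lebesgue)
      \<le> ?c * (ennreal (?d) * (\<integral>\<^sup>+y. ennreal (P (f y)) \<partial>lebesgue))"
    by (simp only: mult_left_mono zero_le)
  moreover have "ennreal (2 * 5 ^ DIM('a) * (?d))
      = ?c * ennreal (?d)"
    using q rho by (intro ennreal_mult) auto
  ultimately show ?thesis by (simp only: mult.assoc)
qed

text \<open>One summand suffices, the dyadic level just below \<open>a\<close>. This is why
  \<open>layer\<close> weights the set at level \<open>2 ^ k\<close> by \<open>P\<close> at
  \<open>2 ^ (k + 1)\<close>.\<close>

lemma layer_ge:
  assumes a: "0 < a" and t: "0 < t"
    and ge: "ennreal (a powr q * vol x t) \<le> ball_int x t (\<lambda>y. ennreal (f y powr q))"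
    and q: "0 < q"
  shows "ennreal (P a) \<le> layer P q f x"
proof -
  obtain k :: int where k: "dyadic k < a" "a \<le> 2 powr (real_of_int k + 1)"
    using dyadic_exponent[OF a] .
  have "2 powr (real_of_int k * q) = (dyadic k) powr q" by (simp add: powr_powr)
  also have "... < a powr q" using k a q by (intro powr_less_mono2) auto
  finally have "2 powr (real_of_int k * q) * vol x t < a powr q * vol x t"
    using measure_ball_pos[OF t, of x] by simp
  then have "ennreal (2 powr (real_of_int k * q) * vol x t) < ennreal (a powr q * vol x t)"
    by (subst ennreal_less_iff) auto
  with ge t have x: "x \<in> HLset (\<lambda>y. ennreal (f y powr q)) (2 powr (real_of_int k * q))"
    unfolding HLset_def using less_le_trans by blast
  have "ennreal (P a) \<le> ennreal (P (2 powr (real_of_int k + 1)))"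
    using k a by (intro ennreal_leI mono) auto
  also have "... \<le> layer P q f x"
    unfolding layer_def
    using nn_integral_ge_point[of k UNIV "\<lambda>k. ennreal (P (2 powr (real_of_int k + 1))) *
     indicator (HLset (\<lambda>y. ennreal (f y powr q)) (2 powr (real_of_int k * q))) x"] x by simp
  finally show ?thesis .
qed

end

section \<open>Mean oscillation over nested balls\<close>

text \<open>A positive majorant \<beta> takes the place of the norm, so that division by it is
  possible even for constant \<open>b\<close>; the nonnegative integral fits the covering
  lemmas.\<close>

definition bmo_le :: "('a::euclidean_space \<Rightarrow> real) \<Rightarrow> real \<Rightarrow> bool" where
  "bmo_le b \<beta> \<longleftrightarrow> 0 < \<beta> \<and> (\<forall>x. \<forall>r>0. set_integrable lebesgue (ball x r) b \<and>
     (ball_int x r (\<lambda>y. ennreal \<bar>b y - ball_avg b x r\<bar>)) \<le> ennreal (\<beta> * vol x r))"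

lemma bmo_leD:
  assumes "bmo_le b \<beta>"
  shows "0 < \<beta>" "0 < r \<Longrightarrow> set_integrable lebesgue (ball x r) b"
    "0 < r \<Longrightarrow> (ball_int x r (\<lambda>y. ennreal \<bar>b y - ball_avg b x r\<bar>)) \<le> ennreal (\<beta> * vol x r)"
  using assms by (auto simp: bmo_le_def)

lemma locally_integrable_measurable:
  fixes b :: "'a::euclidean_space \<Rightarrow> real"
  assumes "\<And>r. 0 < r \<Longrightarrow> set_integrable lebesgue (ball 0 r) b"
  shows "b \<in> borel_measurable lebesgue"
proof (rule borel_measurable_LIMSEQ_real)
  fix i :: nat
  show "(\<lambda>x. indicator (ball 0 (real (Suc i))) x *\<^sub>R b x) \<in> borel_measurable lebesgue"
    using assms[of "real (Suc i)"] by (simp add: set_integrable_def borel_measurable_integrable)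
next
  fix x
  have "\<forall>\<^sub>F i in sequentially. indicator (ball 0 (real (Suc i))) x *\<^sub>R b x = b x"
    using eventually_ge_at_top[of "nat \<lceil>norm x\<rceil>"]
  proof eventually_elim
    case (elim i)
    then have "norm x < real (Suc i)" by linarith
    then show ?case by (simp add: indicator_def)
  qed
  then show "(\<lambda>i. indicator (ball 0 (real (Suc i))) x *\<^sub>R b x) \<longlonglongrightarrow> b x"
    by (rule tendsto_eventually)
qed

lemma ball_avg_diff_le:
  fixes b :: "'a::euclidean_space \<Rightarrow> real"
  assumes b: "set_integrable lebesgue (ball x r) b" and r: "0 < r"
  shows "ennreal (\<bar>ball_avg b x r - c\<bar> * vol x r) \<le> ball_int x r (\<lambda>y. ennreal \<bar>b y - c\<bar>)"
proof -
  let ?B = "ball x r"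
  have m: "measure lebesgue ?B > 0" using measure_ball_pos[OF r] .
  have c: "set_integrable lebesgue ?B (\<lambda>_. c)"
    unfolding set_integrable_def by (intro integrable_scaleR_left integrable_real_indicator) (auto simp: emeasure_ball_leb)
  have ic: "set_integrable lebesgue ?B (\<lambda>y. b y - c)" using b c by (rule set_integral_diff)
  have "(LINT y:?B|lebesgue. c) = c * measure lebesgue ?B"
    by (subst set_integral_const) (auto simp: emeasure_ball_leb)
  then have "(LINT y:?B|lebesgue. b y - c) = (ball_avg b x r - c) * measure lebesgue ?B"
    using set_integral_diff(2)[OF b c] m by (simp add: ball_avg_def left_diff_distrib)
  then have "ennreal (\<bar>ball_avg b x r - c\<bar> * measure lebesgue ?B) = ennreal (norm (LINT y:?B|lebesgue. b y - c))"
    by (simp add: abs_mult)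
  also have "... \<le> (\<integral>\<^sup>+y. ennreal (norm (indicator ?B y *\<^sub>R (b y - c))) \<partial>lebesgue)"
    unfolding set_lebesgue_integral_def
    by (rule integral_norm_bound_ennreal) (use ic in \<open>simp add: set_integrable_def\<close>)
  also have "... = (\<integral>\<^sup>+y\<in>?B. ennreal \<bar>b y - c\<bar> \<partial>lebesgue)"
    by (intro nn_integral_cong) (auto simp: indicator_def)
  finally show ?thesis .
qed

text \<open>The oscillation about the outer mean, integrated over the inner ball, is at most its
  integral over the outer ball; dividing by the inner volume costs the ratio
  \<open>M\<close>.\<close>

lemma bmo_nested:
  assumes b: "bmo_le b \<beta>" and r: "0 < r'" "0 < r" and sub: "ball x' r' \<subseteq> ball x r"
    and M: "vol x r \<le> M * vol x' r'"
  shows "\<bar>ball_avg b x' r' - ball_avg b x r\<bar> \<le> M * \<beta>"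
proof -
  have "ennreal (\<bar>ball_avg b x' r' - ball_avg b x r\<bar> * vol x' r')
     \<le> ball_int x' r' (\<lambda>y. ennreal \<bar>b y - ball_avg b x r\<bar>)"
    using bmo_leD(2)[OF b r(1)] r(1) by (rule ball_avg_diff_le)
  also have "... \<le> ball_int x r (\<lambda>y. ennreal \<bar>b y - ball_avg b x r\<bar>)"
    using sub by (rule nn_integral_mono_set)
  also have "... \<le> ennreal (\<beta> * vol x r)" using bmo_leD(3)[OF b r(2)] .
  also have "... \<le> ennreal (\<beta> * (M * vol x' r'))"
    using M bmo_leD(1)[OF b] by (intro ennreal_leI mult_left_mono) auto
  finally have le: "\<bar>ball_avg b x' r' - ball_avg b x r\<bar> * vol x' r' \<le> M * \<beta> * vol x' r'"
  proof (subst (asm) ennreal_le_iff)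
    have "0 \<le> vol x r" by simp
    with M have "0 \<le> M * vol x' r'" by linarith
    then show "0 \<le> \<beta> * (M * vol x' r')" using bmo_leD(1)[OF b] by simp
  qed (simp add: algebra_simps)
  show ?thesis
    by (rule mult_right_le_imp_le[OF le measure_ball_pos[OF r(1)]])
qed

section \<open>The John--Nirenberg inequality\<close>

lemma osc_set_measurable:
  fixes b :: "'a::euclidean_space \<Rightarrow> real"
  assumes [measurable]: "b \<in> borel_measurable lebesgue"
  shows "{y \<in> ball x r. c < \<bar>b y - d\<bar>} \<in> sets lebesgue"
proof -
  have "{y \<in> space lebesgue. c < \<bar>b y - d\<bar>} \<inter> ball x r \<in> sets lebesgue" by (intro sets.Int) measurable
  moreover have "{y \<in> space lebesgue. c < \<bar>b y - d\<bar>} \<inter> ball x r = {y \<in> ball x r. c < \<bar>b y - d\<bar>}" by auto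
  ultimately show ?thesis by (simp only:)
qed

text \<open>Stopping radii: the supremum need not be attained, but a factor 2 is enough for the selections below.\<close>

lemma near_maximal:
  fixes Q :: "real \<Rightarrow> bool"
  assumes "0 < t0" "Q t0" and bd: "\<And>t. 0 < t \<Longrightarrow> Q t \<Longrightarrow> t \<le> M"
  shows "\<exists>t>0. Q t \<and> (\<forall>t'>0. Q t' \<longrightarrow> t' < 2 * t)"
proof -
  define S where "S = {t. 0 < t \<and> Q t}"
  have S: "S \<noteq> {}" "bdd_above S" using assms by (auto simp: S_def intro!: bdd_aboveI[of _ M])
  have "0 < Sup S" using cSup_upper[of t0 S] S assms by (auto simp: S_def)
  then have "Sup S / 2 < Sup S" by simp
  then obtain t where t: "t \<in> S" "Sup S / 2 < t" using less_cSup_iff[OF S] by blast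
  have "t' < 2 * t" if "0 < t'" "Q t'" for t'
    using cSup_upper[of t' S] S t that by (auto simp: S_def)
  then show ?thesis using t by (auto simp: S_def)
qed

text \<open>\<open>density_bound_null\<close> requires a gap between the means and the values, so
  the exceptional set is exhausted by the countably many \<open>F m\<close> with gap
  \<open>1 / Suc m\<close>.\<close>

lemma density_bound_AE:
  fixes u :: "'a::euclidean_space \<Rightarrow> ennreal"
  assumes E: "E \<in> sets lebesgue" "emeasure lebesgue E < \<infinity>" and u[measurable]: "u \<in> borel_measurable lebesgue"
    and l: "0 \<le> l" and d: "0 < d"
    and upper: "\<And>x t. x \<in> E \<Longrightarrow> 0 < t \<Longrightarrow> t < d \<Longrightarrow> (ball_int x t u) \<le> ennreal (l * vol x t)"
  shows "AE x in lebesgue. x \<in> E \<longrightarrow> u x \<le> ennreal l"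
proof -
  define F where "F m = E \<inter> {x. ennreal (l + 1 / real (Suc m)) \<le> u x}" for m
  have Fm: "F m \<in> sets lebesgue" for m
    using measurable_sets[OF u, of "{ennreal (l + 1 / real (Suc m))..}"] E
    by (auto simp: F_def vimage_def)
  have "emeasure lebesgue (F m) = 0" for m
  proof (rule density_bound_null[OF Fm _ u l _ d])
    show "emeasure lebesgue (F m) < \<infinity>"
      using E(2) emeasure_mono[of "F m" E lebesgue] E(1) by (auto simp: F_def)
  qed (use upper in \<open>auto simp: F_def\<close>)
  then have "AE x in lebesgue. \<forall>m. x \<notin> F m"
    using Fm by (subst AE_all_countable) (auto intro!: AE_not_in simp: null_sets_def)
  then show ?thesis
  proof eventually_elim
    case (elim x)
    show ?case
    proof
      assume x: "x \<in> E"
      show "u x \<le> ennreal l"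
      proof (rule ccontr)
        assume "\<not> u x \<le> ennreal l"
        then have lt: "ennreal l < u x" by simp
        obtain c where c: "ennreal l < c" "c < u x" using dense[OF lt] by blast
        then obtain c' where c': "c = ennreal c'" "c' \<ge> 0" by (cases c) auto
        have "l < c'" using c c' l by (simp add: ennreal_less_iff)
        then obtain m where "1 / real (Suc m) < c' - l" by (metis diff_gt_0_iff_gt nat_approx_posE)
        then have "ennreal (l + 1 / real (Suc m)) \<le> ennreal c'" by (intro ennreal_leI) simp
        with c c' have "ennreal (l + 1 / real (Suc m)) \<le> u x" by (metis less_imp_le order.trans)
        with elim x show False by (auto simp: F_def)
      qed
    qed
  qed
qed

text \<open>Induction on \<open>k\<close> for all balls at once. Measuring from the mean over the
  doubled ball gives room: stopping balls about points of \<open>ball x R\<close> stay inside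
  \<open>ball x (2 * R)\<close>, and a fivefold dilate together with the mean over the tenfold one
  is again an instance of the claim. In \<open>20 ^ n = 2 ^ n * 10 ^ n\<close> the first factor pays
  for the doubled ball, the second keeps tenfold radii below \<open>R\<close>.\<close>

lemma john_nirenberg:
  fixes b :: "'a::euclidean_space \<Rightarrow> real"
  assumes b: "bmo_le b \<beta>" and R: "0 < R"
  shows "emeasure lebesgue {y \<in> ball x R. real k * (2 * 20 ^ DIM('a) * \<beta>) < \<bar>b y - ball_avg b x (2 * R)\<bar>}
    \<le> ennreal ((1 / 2) ^ k * vol x R)"
  using R
proof (induction k arbitrary: x R)
  case 0
  have "emeasure lebesgue {y \<in> ball x R. real 0 * (2 * 20 ^ DIM('a) * \<beta>) < \<bar>b y - ball_avg b x (2 * R)\<bar>} \<le> emeasure lebesgue (ball x R)"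
    by (rule emeasure_mono) auto
  then show ?case by (simp add: emeasure_ball_leb)
next
  case (Suc k)
  note R = \<open>0 < R\<close>
  note bm [measurable] = locally_integrable_measurable[OF bmo_leD(2)[OF b]]
  have \<beta>: "\<beta> > 0" using bmo_leD(1)[OF b] .
  define s where "s = 2 * 20 ^ DIM('a) * \<beta>"
  have s: "s > 0" using \<beta> by (simp add: s_def)
  define c where "c = ball_avg b x (2 * R)"
  define u where "u y = ennreal \<bar>b y - c\<bar>" for y
  have um [measurable]: "u \<in> borel_measurable lebesgue" unfolding u_def by measurable
  have u2: "ball_int x (2 * R) u \<le> ennreal (\<beta> * 2 ^ DIM('a) * vol x R)"
    using bmo_leD(3)[OF b, of "2 * R" x] R measure_ball_scale[of R 2 x x]
    by (simp add: u_def c_def mult.assoc)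
  \<comment> \<open>Stop at a nearly maximal ball on which the mean oscillation exceeds \<open>s\<close>. By the choice of \<open>s\<close>
    these balls have radius below \<open>R / 10\<close> and total measure at most half of that of \<open>ball x R\<close> after
    dilation by 5, and the mean of \<open>b\<close> over a tenfold dilate moves by at most \<open>s\<close>.\<close>
  define Q where "Q z t \<longleftrightarrow> t \<le> R \<and> ennreal (s * vol z t) < ball_int z t u" for z t
  define K where "K = {z \<in> ball x R. \<exists>t>0. Q z t}"
  have "\<forall>z\<in>K. \<exists>t>0. Q z t \<and> (\<forall>t'>0. Q z t' \<longrightarrow> t' < 2 * t)"
  proof
    fix z assume "z \<in> K"
    then obtain t0 where "t0 > 0" "Q z t0" by (auto simp: K_def)
    then show "\<exists>t>0. Q z t \<and> (\<forall>t'>0. Q z t' \<longrightarrow> t' < 2 * t)"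
      by (rule near_maximal[of t0 "Q z" R]) (simp add: Q_def)
  qed
  then obtain t where t: "\<And>z. z \<in> K \<Longrightarrow> 0 < t z" "\<And>z. z \<in> K \<Longrightarrow> Q z (t z)"
    "\<And>z t'. z \<in> K \<Longrightarrow> 0 < t' \<Longrightarrow> Q z t' \<Longrightarrow> t' < 2 * t z"
    unfolding bchoice_iff by metis
  have sub2: "ball z (t z) \<subseteq> ball x (2 * R)" if "z \<in> K" for z
  proof -
    have "t z \<le> R" "dist x z < R" using t(2)[OF that] that by (auto simp: Q_def K_def)
    then show ?thesis by (intro subsetI) (simp, metric)
  qed
  have small: "10 * t z < R" if z: "z \<in> K" for z
  proof -
    have "ennreal (s * vol z (t z)) < ball_int z (t z) u"
      using t(2)[OF z] by (simp add: Q_def)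
    also have "... \<le> ennreal (\<beta> * 2 ^ DIM('a) * vol x R)"
      using nn_integral_mono_set[OF sub2[OF z], where g = u] u2 by (rule order.trans)
    finally have "s * vol z (t z) < \<beta> * 2 ^ DIM('a) * vol x R"
      using s by (subst (asm) ennreal_less_iff) auto
    then have "\<beta> * unit_ball_vol (real DIM('a)) * (2 * 20 ^ DIM('a) * t z ^ DIM('a)) < \<beta> * unit_ball_vol (real DIM('a)) * (2 ^ DIM('a) * R ^ DIM('a))"
      using t(1)[OF z] R by (simp add: content_ball s_def mult_ac)
    then have "2 * 20 ^ DIM('a) * t z ^ DIM('a) < 2 ^ DIM('a) * R ^ DIM('a)"
      using \<beta> by (subst (asm) mult_less_cancel_left_pos) auto
    moreover have "(20::real) ^ DIM('a) = 2 ^ DIM('a) * 10 ^ DIM('a)"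
      by (simp add: power_mult_distrib[symmetric])
    ultimately have "2 ^ DIM('a) * (2 * (10 * t z) ^ DIM('a)) < 2 ^ DIM('a) * R ^ DIM('a)"
      by (simp add: power_mult_distrib mult_ac)
    then have "2 * (10 * t z) ^ DIM('a) < R ^ DIM('a)"
      by (subst (asm) mult_less_cancel_left_pos) auto
    moreover have "0 \<le> (10 * t z) ^ DIM('a)" using t(1)[OF z] by simp
    ultimately have "(10 * t z) ^ DIM('a) < R ^ DIM('a)" by linarith
    then show ?thesis using R by (intro power_less_imp_less_base[of "10 * t z" "DIM('a)" R]) auto
  qed
  have sub: "K \<subseteq> (\<Union>i\<in>K. ball i (t i))" using t(1) by auto
  have r: "0 < t i \<and> t i \<le> R" if "i \<in> K" for i using t(1,2)[OF that] by (auto simp: Q_def)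
  obtain C where C: "countable C" "C \<subseteq> K"
     "pairwise (\<lambda>i j. disjnt (ball i (t i)) (ball j (t j))) C"
     "K \<subseteq> (\<Union>i\<in>C. ball i (5 * t i))"
    by (rule Vitali_covering_lemma_balls[OF sub r])
  define G where "G = (\<Union>i\<in>C. ball i (5 * t i))"
  have Gm: "G \<in> sets lebesgue" unfolding G_def using C(1) by (intro sets.countable_UN') auto
  define E where "E = {y \<in> ball x R. real (Suc k) * s < \<bar>b y - c\<bar>}"
  have Em: "E \<in> sets lebesgue" unfolding E_def by (rule osc_set_measurable[OF bm])
  have Efin: "emeasure lebesgue (ball x R - G) < \<infinity>"
    using emeasure_mono[of "ball x R - G" "ball x R" lebesgue] by (auto simp: emeasure_ball_leb intro: le_less_trans)
  \<comment> \<open>Off \<open>G\<close> no stopping radius exists, so all means over radii below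
    \<open>R\<close> are at most \<open>s\<close>, and by differentiation so is \<open>u\<close>.
    Hence almost all of \<open>E\<close> lies in \<open>G\<close>.\<close>
  have "AE y in lebesgue. y \<in> ball x R - G \<longrightarrow> u y \<le> ennreal s"
  proof (rule density_bound_AE[OF _ Efin um _ R])
    fix z r assume z: "z \<in> ball x R - G" and r: "0 < r" "r < R"
    then have "\<not> Q z r" using C(4) by (auto simp: K_def G_def)
    then show "ball_int z r u \<le> ennreal (s * vol z r)"
      using r by (auto simp: Q_def)
  qed (use s Gm in auto)
  then have AE1: "AE y in lebesgue. y \<in> E \<longrightarrow> y \<in> G"
  proof eventually_elim
    case (elim y)
    show ?case
    proof (intro impI, rule ccontr)
      assume y: "y \<in> E" "y \<notin> G"
      then have "\<bar>b y - c\<bar> \<le> s" using elim s by (auto simp: E_def u_def)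
      moreover have "s \<le> real (Suc k) * s" using s by simp
      ultimately show False using y by (simp add: E_def)
    qed
  qed
  define F where "F i = {y \<in> ball i (5 * t i). real k * s < \<bar>b y - ball_avg b i (10 * t i)\<bar>}" for i
  have Fm: "F i \<in> sets lebesgue" for i unfolding F_def by (rule osc_set_measurable[OF bm])
  have EF: "y \<in> F i" if y: "y \<in> E" "y \<in> ball i (5 * t i)" and i: "i \<in> C" for y i
  proof -
    have iK: "i \<in> K" using i C by auto
    have ti: "0 < t i" "10 * t i < R" using t(1)[OF iK] small[OF iK] by auto
    \<comment> \<open>The tenfold radius exceeds twice the nearly maximal one and, being below
      \<open>R\<close>, can fail \<open>Q\<close> only through its mean, which is therefore at most
      \<open>s\<close>.\<close>
    have "\<not> Q i (10 * t i)" using t(3)[OF iK, of "10 * t i"] ti by auto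
    then have "ball_int i (10 * t i) u \<le> ennreal (s * vol i (10 * t i))"
      using ti by (auto simp: Q_def)
    with ball_avg_diff_le[OF bmo_leD(2)[OF b], of "10 * t i" i c] ti
    have "ennreal (\<bar>ball_avg b i (10 * t i) - c\<bar> * vol i (10 * t i)) \<le> ennreal (s * vol i (10 * t i))"
      by (auto simp: u_def intro: order.trans)
    then have "\<bar>ball_avg b i (10 * t i) - c\<bar> * vol i (10 * t i) \<le> s * vol i (10 * t i)"
      using s by (subst (asm) ennreal_le_iff) auto
    then have "\<bar>ball_avg b i (10 * t i) - c\<bar> \<le> s"
      using measure_ball_pos[of "10 * t i" i] ti by (simp add: mult_le_cancel_right)
    moreover have "real (Suc k) * s < \<bar>b y - c\<bar>" using y by (simp add: E_def)
    ultimately have "real k * s < \<bar>b y - ball_avg b i (10 * t i)\<bar>" by (simp add: algebra_simps)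
    then show ?thesis using y by (simp add: F_def)
  qed
  have AE2: "AE y in lebesgue. y \<in> E \<longrightarrow> y \<in> (\<Union>i\<in>C. F i)"
    using AE1 by eventually_elim (use EF in \<open>auto simp: G_def simp del: mem_ball\<close>)
  have "emeasure lebesgue E \<le> (\<integral>\<^sup>+i. emeasure lebesgue (F i) \<partial>count_space C)"
    by (rule cover_emeasure_le_sum[OF C(1) AE2 Em Fm])
  also have "... \<le> (\<integral>\<^sup>+i. ennreal ((1 / 2) ^ k * 5 ^ DIM('a) / s) * ball_int i (t i) u \<partial>count_space C)"
  proof (rule nn_integral_mono)
    fix i assume "i \<in> space (count_space C)"
    then have i: "i \<in> K" using C by auto
    note ti = t(1)[OF i]
    have "emeasure lebesgue (F i) \<le> ennreal ((1 / 2) ^ k * vol i (5 * t i))"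
      using Suc.IH[of "5 * t i" i] ti by (simp add: F_def s_def)
    also have "... = ennreal (((1 / 2) ^ k * 5 ^ DIM('a) / s) * (s * vol i (t i)))"
      using s ti measure_ball_scale[of "t i" 5 i i] by simp
    also have "... = ennreal ((1 / 2) ^ k * 5 ^ DIM('a) / s) * ennreal (s * vol i (t i))"
      using s by (intro ennreal_mult) auto
    also have "... \<le> ennreal ((1 / 2) ^ k * 5 ^ DIM('a) / s) * ball_int i (t i) u"
      using t(2)[OF i] by (intro mult_left_mono) (auto simp: Q_def)
    finally show "emeasure lebesgue (F i) \<le> ennreal ((1 / 2) ^ k * 5 ^ DIM('a) / s) * ball_int i (t i) u" .
  qed
  also have "... = ennreal ((1 / 2) ^ k * 5 ^ DIM('a) / s) * (\<integral>\<^sup>+i. (ball_int i (t i) u) \<partial>count_space C)"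
    by (rule nn_integral_cmult) simp
  also have "... \<le> ennreal ((1 / 2) ^ k * 5 ^ DIM('a) / s) * ennreal (\<beta> * 2 ^ DIM('a) * vol x R)"
  proof (rule mult_left_mono)
    have "(\<integral>\<^sup>+i. (ball_int i (t i) u) \<partial>count_space C) \<le> (\<integral>\<^sup>+y\<in>(\<Union>i\<in>C. ball i (t i)). u y \<partial>lebesgue)"
      by (rule sum_disjoint_le[OF C(1,3)]) auto
    also have "... \<le> ball_int x (2 * R) u"
      using sub2 C(2) by (intro nn_integral_mono_set) blast
    also note u2
    finally show "(\<integral>\<^sup>+i. (ball_int i (t i) u) \<partial>count_space C) \<le> ennreal (\<beta> * 2 ^ DIM('a) * vol x R)" .
  qed simp
  also have "... = ennreal (((1 / 2) ^ k * 5 ^ DIM('a) / s) * (\<beta> * 2 ^ DIM('a) * vol x R))"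
    using s \<beta> by (intro ennreal_mult[symmetric]) auto
  also have "... \<le> ennreal ((1 / 2) ^ Suc k * vol x R)"
  proof (rule ennreal_leI)
    have "((1 / 2) ^ k * 5 ^ DIM('a) / s) * (\<beta> * 2 ^ DIM('a) * vol x R)
       = ((1 / 2) ^ Suc k * vol x R) * ((5 ^ DIM('a) * 2 ^ DIM('a)) / 20 ^ DIM('a))"
      using \<beta> by (simp add: s_def field_simps)
    also have "... \<le> ((1 / 2) ^ Suc k * vol x R) * 1"
    proof (rule mult_left_mono)
      have "(5::real) ^ DIM('a) * 2 ^ DIM('a) = 10 ^ DIM('a)" by (simp add: power_mult_distrib[symmetric])
      also have "... \<le> 20 ^ DIM('a)" by (intro power_mono) auto
      finally show "(5::real) ^ DIM('a) * 2 ^ DIM('a) / 20 ^ DIM('a) \<le> 1" by simp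
    qed simp
    finally show "((1 / 2) ^ k * 5 ^ DIM('a) / s) * (\<beta> * 2 ^ DIM('a) * vol x R) \<le> (1 / 2) ^ Suc k * vol x R" by simp
  qed
  finally show ?case by (simp add: E_def s_def c_def)
qed

section \<open>Moments of the oscillation\<close>

text \<open>Since \<open>x ^ m / fact m \<le> exp x\<close> at \<open>x = (k + 1) / 4\<close> and
  \<open>exp (1 / 4) < 2\<close>, a geometric series dominates.\<close>

lemma summable_power_half: "summable (\<lambda>k. real (Suc k) ^ m * (1 / 2) ^ k)"
proof (rule summable_comparison_test')
  show "summable (\<lambda>k. (4 ^ m * fact m * exp (1 / 4)) * (exp (1 / 4) / 2 :: real) ^ k)"
  proof (intro summable_mult summable_geometric)
    have "exp (1 / 4 :: real) < exp 1 powr (1 / 2)" by (simp add: powr_def)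
    also have "... \<le> 2"
      using exp_half_le2 by (simp add: powr_def)
    finally show "norm (exp (1 / 4) / 2 :: real) < 1" by simp
  qed
next
  fix k :: nat
  let ?x = "real (Suc k) / 4"
  have "?x ^ m / fact m \<le> exp ?x"
  proof -
    have "(\<Sum>i\<in>{m}. ?x ^ i /\<^sub>R fact i) \<le> exp ?x"
      unfolding exp_def by (rule sum_le_suminf) (use summable_exp[of ?x] in \<open>auto simp: field_simps\<close>)
    then show ?thesis by (simp add: field_simps)
  qed
  then have "?x ^ m \<le> fact m * exp ?x" by (simp add: field_simps)
  then have "4 ^ m * ?x ^ m \<le> 4 ^ m * (fact m * exp ?x)" by (intro mult_left_mono) auto
  moreover have "4 ^ m * ?x ^ m = real (Suc k) ^ m" by (simp add: power_divide)
  moreover have "exp ?x = exp (1 / 4) * exp (1 / 4) ^ k"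
    by (simp add: exp_add[symmetric] exp_of_nat_mult[symmetric] add_divide_distrib)
  ultimately have "real (Suc k) ^ m \<le> 4 ^ m * (fact m * (exp (1 / 4) * exp (1 / 4) ^ k))" by (simp only:)
  then have "real (Suc k) ^ m * (1 / 2) ^ k \<le> 4 ^ m * (fact m * (exp (1 / 4) * exp (1 / 4) ^ k)) * (1 / 2) ^ k"
    by (intro mult_right_mono) auto
  then show "norm (real (Suc k) ^ m * (1 / 2) ^ k) \<le> (4 ^ m * fact m * exp (1 / 4)) * (exp (1 / 4) / 2 :: real) ^ k"
    by (simp add: power_divide mult_ac)
qed

lemma power_add_le: "0 \<le> u \<Longrightarrow> 0 \<le> v \<Longrightarrow> (u + v) ^ m \<le> 2 ^ m * (u ^ m + v ^ m)" for u v :: real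
proof -
  assume uv: "0 \<le> u" "0 \<le> v"
  have "(u + v) ^ m \<le> (2 * max u v) ^ m" using uv by (intro power_mono) auto
  also have "... = 2 ^ m * max u v ^ m" by (simp add: power_mult_distrib)
  also have "... \<le> 2 ^ m * (u ^ m + v ^ m)" using uv by (intro mult_left_mono) (auto simp: max_def)
  finally show ?thesis .
qed

text \<open>Slicing the oscillation into steps of height \<open>s\<close> gives a series of the
  measures of \<open>E k\<close>, which halve at each step; the constant does not depend on
  \<open>b\<close> or the ball.\<close>

lemma bmo_moment:
  assumes m: "1 \<le> m"
  shows "\<exists>C>0. \<forall>(b :: 'a::euclidean_space \<Rightarrow> real) \<beta> x r. bmo_le b \<beta> \<longrightarrow> 0 < r \<longrightarrow>
    ball_int x r (\<lambda>y. ennreal (\<bar>b y - ball_avg b x r\<bar> ^ m)) \<le> ennreal (C * \<beta> ^ m * vol x r)"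
proof -
  define L :: real where "L = 2 * 20 ^ DIM('a)"
  define S where "S = (\<Sum>k. real (Suc k) ^ m * (1 / 2) ^ k)"
  have S0: "0 \<le> S" unfolding S_def by (intro suminf_nonneg summable_power_half) auto
  define C where "C = 2 ^ m * (L ^ m * S + (2 ^ DIM('a)) ^ m)"
  have L: "L > 0" by (simp add: L_def)
  have C: "C > 0" unfolding C_def using S0 L by (intro mult_pos_pos add_nonneg_pos) auto
  show ?thesis
  proof (intro exI[of _ C] conjI C allI impI)
    fix b :: "'a \<Rightarrow> real" and \<beta> r :: real and x :: 'a
    assume b: "bmo_le b \<beta>" and r: "0 < r"
    have \<beta>: "\<beta> > 0" using bmo_leD(1)[OF b] .
    note bm [measurable] = locally_integrable_measurable[OF bmo_leD(2)[OF b]]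
    define s where "s = L * \<beta>"
    have s: "s > 0" using L \<beta> by (simp add: s_def)
    let ?B = "ball x r" and ?c = "ball_avg b x (2 * r)"
    define E where "E k = {y \<in> ?B. real k * s < \<bar>b y - ?c\<bar>}" for k
    have Em [measurable]: "E k \<in> sets lebesgue" for k unfolding E_def by (rule osc_set_measurable[OF bm])
    have pw: "ennreal (\<bar>b y - ?c\<bar> ^ m) * indicator ?B y \<le> (\<Sum>k. ennreal ((real (Suc k) * s) ^ m) * indicator (E k) y)" for y
    proof (cases "y \<in> ?B \<and> b y \<noteq> ?c")
      case True
      let ?w = "\<bar>b y - ?c\<bar>"
      have w: "?w > 0" using True by simp
      \<comment> \<open>Ceiling minus one, so that the lower bound \<open>real k * s < ?w\<close> is
        strict, as membership in \<open>E k\<close> demands.\<close>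
      define k where "k = nat (\<lceil>?w / s\<rceil> - 1)"
      have ws: "?w / s > 0" using w s by simp
      have k1: "real k < ?w / s" "?w / s \<le> real (Suc k)" unfolding k_def using ws by linarith+
      have k: "real k * s < ?w" "?w \<le> real (Suc k) * s"
        using k1 s by (simp_all add: pos_less_divide_eq pos_divide_le_eq)
      have "ennreal (?w ^ m) * indicator ?B y \<le> ennreal ((real (Suc k) * s) ^ m) * indicator (E k) y"
        using True k by (auto simp: E_def intro!: ennreal_leI power_mono)
      also have "... \<le> (\<Sum>k. ennreal ((real (Suc k) * s) ^ m) * indicator (E k) y)"
        using nn_integral_ge_point[of k UNIV "\<lambda>k. ennreal ((real (Suc k) * s) ^ m) * indicator (E k) y"]
        by (simp add: nn_integral_count_space_nat)
      finally show ?thesis .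
    qed (use m in \<open>auto simp: indicator_def power_0_left\<close>)
    have "(\<integral>\<^sup>+y\<in>?B. ennreal (\<bar>b y - ?c\<bar> ^ m) \<partial>lebesgue) \<le> (\<integral>\<^sup>+y. (\<Sum>k. ennreal ((real (Suc k) * s) ^ m) * indicator (E k) y) \<partial>lebesgue)"
      using pw by (intro nn_integral_mono) auto
    also have "... = (\<Sum>k. \<integral>\<^sup>+y. ennreal ((real (Suc k) * s) ^ m) * indicator (E k) y \<partial>lebesgue)"
      by (rule nn_integral_suminf) measurable
    also have "... \<le> (\<Sum>k. ennreal ((s ^ m * measure lebesgue ?B) * (real (Suc k) ^ m * (1 / 2) ^ k)))"
    proof (rule suminf_le)
      fix k
      have "(\<integral>\<^sup>+y. ennreal ((real (Suc k) * s) ^ m) * indicator (E k) y \<partial>lebesgue) = ennreal ((real (Suc k) * s) ^ m) * emeasure lebesgue (E k)"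
        by (rule nn_integral_cmult_indicator) measurable
      also have "... \<le> ennreal ((real (Suc k) * s) ^ m) * ennreal ((1 / 2) ^ k * measure lebesgue ?B)"
        using john_nirenberg[OF b r, of x k] by (intro mult_left_mono) (auto simp: E_def s_def L_def)
      also have "... = ennreal ((real (Suc k) * s) ^ m * ((1 / 2) ^ k * measure lebesgue ?B))"
        using s by (intro ennreal_mult[symmetric]) auto
      also have "(real (Suc k) * s) ^ m * ((1 / 2) ^ k * measure lebesgue ?B) = (s ^ m * measure lebesgue ?B) * (real (Suc k) ^ m * (1 / 2) ^ k)"
        by (simp only: power_mult_distrib mult_ac)
      finally show "(\<integral>\<^sup>+y. ennreal ((real (Suc k) * s) ^ m) * indicator (E k) y \<partial>lebesgue) \<le> ennreal ((s ^ m * measure lebesgue ?B) * (real (Suc k) ^ m * (1 / 2) ^ k))" .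
    qed auto
    also have "... = ennreal (\<Sum>k. (s ^ m * measure lebesgue ?B) * (real (Suc k) ^ m * (1 / 2) ^ k))"
      using s by (intro suminf_ennreal2 summable_mult summable_power_half) auto
    also have "(\<Sum>k. (s ^ m * measure lebesgue ?B) * (real (Suc k) ^ m * (1 / 2) ^ k)) = s ^ m * measure lebesgue ?B * S"
      unfolding S_def by (rule suminf_mult) (rule summable_power_half)
    finally have 1: "(\<integral>\<^sup>+y\<in>?B. ennreal (\<bar>b y - ?c\<bar> ^ m) \<partial>lebesgue) \<le> ennreal (s ^ m * measure lebesgue ?B * S)" .
    \<comment> \<open>John--Nirenberg measures from the mean over the doubled ball; returning to the
      mean over the ball itself shifts by a multiple of \<beta>.\<close>
    have avg: "\<bar>ball_avg b x r - ?c\<bar> \<le> 2 ^ DIM('a) * \<beta>"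
      using r measure_ball_scale[of r 2 x x] by (intro bmo_nested[OF b]) (auto intro!: subset_ball)
    have "(\<integral>\<^sup>+y\<in>?B. ennreal (\<bar>b y - ball_avg b x r\<bar> ^ m) \<partial>lebesgue)
      \<le> (\<integral>\<^sup>+y. ennreal (2 ^ m) * (ennreal (\<bar>b y - ?c\<bar> ^ m) * indicator ?B y) + ennreal (2 ^ m * (2 ^ DIM('a) * \<beta>) ^ m) * indicator ?B y \<partial>lebesgue)"
    proof (rule nn_integral_mono)
      fix y
      have "\<bar>b y - ball_avg b x r\<bar> ^ m \<le> (\<bar>b y - ?c\<bar> + 2 ^ DIM('a) * \<beta>) ^ m"
        using avg by (intro power_mono) auto
      also have "... \<le> 2 ^ m * (\<bar>b y - ?c\<bar> ^ m + (2 ^ DIM('a) * \<beta>) ^ m)"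
        using \<beta> by (intro power_add_le) auto
      finally have "ennreal (\<bar>b y - ball_avg b x r\<bar> ^ m) \<le> ennreal (2 ^ m * \<bar>b y - ?c\<bar> ^ m + 2 ^ m * (2 ^ DIM('a) * \<beta>) ^ m)"
        by (intro ennreal_leI) (simp add: distrib_left)
      also have "... = ennreal (2 ^ m) * ennreal (\<bar>b y - ?c\<bar> ^ m) + ennreal (2 ^ m * (2 ^ DIM('a) * \<beta>) ^ m)"
        using \<beta> by (subst ennreal_plus) (auto simp: ennreal_mult)
      finally show "ennreal (\<bar>b y - ball_avg b x r\<bar> ^ m) * indicator ?B y
        \<le> ennreal (2 ^ m) * (ennreal (\<bar>b y - ?c\<bar> ^ m) * indicator ?B y) + ennreal (2 ^ m * (2 ^ DIM('a) * \<beta>) ^ m) * indicator ?B y"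
        by (auto simp: indicator_def)
    qed
    also have "... = ennreal (2 ^ m) * (\<integral>\<^sup>+y\<in>?B. ennreal (\<bar>b y - ?c\<bar> ^ m) \<partial>lebesgue) + ennreal (2 ^ m * (2 ^ DIM('a) * \<beta>) ^ m * measure lebesgue ?B)"
    proof -
      have "(\<integral>\<^sup>+y. ennreal (2 ^ m * (2 ^ DIM('a) * \<beta>) ^ m) * indicator ?B y \<partial>lebesgue) = ennreal (2 ^ m * (2 ^ DIM('a) * \<beta>) ^ m * measure lebesgue ?B)"
        using \<beta> by (intro nn_integral_const_ball) auto
      then show ?thesis
        by (subst nn_integral_add) (auto simp: nn_integral_cmult)
    qed
    also have "... \<le> ennreal (2 ^ m) * ennreal (s ^ m * measure lebesgue ?B * S) + ennreal (2 ^ m * (2 ^ DIM('a) * \<beta>) ^ m * measure lebesgue ?B)"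
      using 1 by (intro add_right_mono mult_left_mono) auto
    also have "... = ennreal (2 ^ m * (s ^ m * measure lebesgue ?B * S) + 2 ^ m * (2 ^ DIM('a) * \<beta>) ^ m * measure lebesgue ?B)"
      using s S0 \<beta> by (subst ennreal_plus) (auto simp: ennreal_mult)
    also have "2 ^ m * (s ^ m * measure lebesgue ?B * S) + 2 ^ m * (2 ^ DIM('a) * \<beta>) ^ m * measure lebesgue ?B = C * \<beta> ^ m * measure lebesgue ?B"
      by (simp only: C_def s_def power_mult_distrib) (simp add: algebra_simps)
    finally show "(\<integral>\<^sup>+y\<in>?B. ennreal (\<bar>b y - ball_avg b x r\<bar> ^ m) \<partial>lebesgue) \<le> ennreal (C * \<beta> ^ m * measure lebesgue ?B)" .
  qed
qed

section \<open>Young functions and Hedberg's inequality\<close>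

text \<open>Young's inequality with constants 1: whichever of \<open>u ^ (m - 1)\<close> and
  \<open>w\<close> is larger absorbs the product into its own term.\<close>

lemma mult_le_power_plus_powr:
  fixes u w :: real
  assumes "0 \<le> u" "0 \<le> w" and m: "2 \<le> m"
  shows "u * w \<le> u ^ m + w powr (real m / (real m - 1))"
proof (cases "u ^ (m - 1) \<le> w")
  case True
  show ?thesis
  proof (cases "u = 0")
    case False
    then have u: "u > 0" using assms by simp
    then have w: "w > 0" using True by (smt (verit) zero_less_power)
    have r: "real (m - 1) = real m - 1" using m by (simp add: of_nat_diff)
    have "u = (u ^ (m - 1)) powr (1 / (real m - 1))"
      using u m by (simp add: powr_realpow[symmetric] powr_powr r)
    also have "... \<le> w powr (1 / (real m - 1))" using True u m by (intro powr_mono2) auto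
    finally have "u * w \<le> w powr (1 / (real m - 1)) * w powr 1" using w by simp
    also have "... = w powr (1 / (real m - 1) + 1)" by (simp add: powr_add)
    also have "1 / (real m - 1) + 1 = real m / (real m - 1)" using m by (simp add: field_simps)
    finally show ?thesis using u by (smt (verit) zero_le_power)
  qed simp
next
  case False
  then have "u * w \<le> u * u ^ (m - 1)" using assms by (intro mult_left_mono) auto
  also have "... = u ^ m" using m by (simp flip: power_Suc)
  finally show ?thesis by (smt (verit) powr_ge_zero)
qed

text \<open>Hoelder's inequality obtained pointwise: \<open>f / a\<close> and
  \<open>\<bar>b - c\<bar> / \<beta>\<close> have \<open>q\<close>-th and \<open>m\<close>-th means
  at most 1 and \<open>C\<close>, so Young's inequality can be integrated term by term. The constant
  part \<open>\<bar>w - c\<bar>\<close> only needs \<open>g \<le> 1 + g powr q\<close>. The number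
  \<open>w\<close> stands for \<open>b x\<close>.\<close>

lemma comm_ball_estimate:
  fixes b f :: "'a::euclidean_space \<Rightarrow> real"
  assumes m: "2 \<le> m" and q: "q = real m / (real m - 1)" and a: "0 < a" and \<beta>: "0 < \<beta>" and C: "0 \<le> C"
    and [measurable]: "f \<in> borel_measurable lebesgue" "b \<in> borel_measurable lebesgue"
    and f: "\<And>y. 0 \<le> f y"
    and If: "ball_int z t (\<lambda>y. ennreal (f y powr q)) \<le> ennreal (a powr q * vol z t)"
    and Ib: "ball_int z t (\<lambda>y. ennreal (\<bar>b y - c\<bar> ^ m)) \<le> ennreal (C * \<beta> ^ m * vol z t)"
  shows "ball_int z t (\<lambda>y. ennreal (\<bar>w - b y\<bar> * f y))
    \<le> ennreal (vol z t * (a * (2 * \<bar>w - c\<bar> + (1 + C) * \<beta>)))"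
proof -
  let ?B = "ball z t" and ?w = "\<bar>w - c\<bar>"
  define k1 where "k1 = a * (?w + \<beta>) / a powr q"
  define k2 where "k2 = a * \<beta> / \<beta> ^ m"
  have k: "0 \<le> k1" "0 \<le> k2" using a \<beta> by (auto simp: k1_def k2_def)
  have q1: "1 \<le> q" using m by (simp add: q field_simps)
  have fq [measurable]: "(\<lambda>y. f y powr q) \<in> borel_measurable lebesgue"
    by (rule powr_real_measurable) (use assms(6) in auto)
  have pw: "\<bar>w - b y\<bar> * f y \<le> a * ?w + k1 * f y powr q + k2 * \<bar>b y - c\<bar> ^ m" for y
  proof -
    let ?g = "f y / a" and ?u = "\<bar>b y - c\<bar> / \<beta>"
    have g0: "0 \<le> ?g" using f a by simp
    have g1: "?g \<le> 1 + ?g powr q"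
    proof (cases "?g \<le> 1")
      case False
      then have "?g powr 1 \<le> ?g powr q" using q1 by (intro powr_mono) auto
      then show ?thesis using powr_one[OF g0] by linarith
    qed (smt (verit) powr_ge_zero)
    have g2: "?u * ?g \<le> ?u ^ m + ?g powr q"
      unfolding q using g0 \<beta> m by (intro mult_le_power_plus_powr) auto
    have gq: "?g powr q = f y powr q / a powr q" using f a by (simp add: powr_divide)
    have "\<bar>w - b y\<bar> * f y \<le> (?w + \<bar>b y - c\<bar>) * f y" using f by (intro mult_right_mono) auto
    also have "... = (a * ?w) * ?g + (a * \<beta>) * (?u * ?g)" using a \<beta> by (simp add: field_simps)
    also have "... \<le> (a * ?w) * (1 + ?g powr q) + (a * \<beta>) * (?u ^ m + ?g powr q)"
      using g1 g2 a \<beta> by (intro add_mono mult_left_mono) auto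
    also have "... = a * ?w + k1 * f y powr q + k2 * \<bar>b y - c\<bar> ^ m"
      by (simp add: gq k1_def k2_def power_divide algebra_simps add_divide_distrib)
    finally show ?thesis .
  qed
  have "(\<integral>\<^sup>+y\<in>?B. ennreal (\<bar>w - b y\<bar> * f y) \<partial>lebesgue)
    \<le> (\<integral>\<^sup>+y. ennreal (a * ?w) * indicator ?B y + (ennreal k1 * (ennreal (f y powr q) * indicator ?B y) + ennreal k2 * (ennreal (\<bar>b y - c\<bar> ^ m) * indicator ?B y)) \<partial>lebesgue)"
  proof (rule nn_integral_mono)
    fix y
    have "ennreal (\<bar>w - b y\<bar> * f y) \<le> ennreal (a * ?w + (k1 * f y powr q + k2 * \<bar>b y - c\<bar> ^ m))"
      using pw[of y] by (intro ennreal_leI) simp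
    also have "... = ennreal (a * ?w) + (ennreal k1 * ennreal (f y powr q) + ennreal k2 * ennreal (\<bar>b y - c\<bar> ^ m))"
      using a k by (simp add: ennreal_plus ennreal_mult)
    finally show "ennreal (\<bar>w - b y\<bar> * f y) * indicator ?B y
      \<le> ennreal (a * ?w) * indicator ?B y + (ennreal k1 * (ennreal (f y powr q) * indicator ?B y) + ennreal k2 * (ennreal (\<bar>b y - c\<bar> ^ m) * indicator ?B y))"
      by (auto simp: indicator_def)
  qed
  also have "... = ennreal (a * ?w * measure lebesgue ?B) + (ennreal k1 * (\<integral>\<^sup>+y\<in>?B. ennreal (f y powr q) \<partial>lebesgue)
     + ennreal k2 * (\<integral>\<^sup>+y\<in>?B. ennreal (\<bar>b y - c\<bar> ^ m) \<partial>lebesgue))"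
    using a by (subst nn_integral_add; (simp add: nn_integral_cmult nn_integral_add emeasure_ball_leb ennreal_mult)?)
  also have "... \<le> ennreal (a * ?w * measure lebesgue ?B) + (ennreal k1 * ennreal (a powr q * measure lebesgue ?B)
     + ennreal k2 * ennreal (C * \<beta> ^ m * measure lebesgue ?B))"
    using If Ib by (intro add_left_mono add_mono mult_left_mono) auto
  also have "... = ennreal (a * ?w * measure lebesgue ?B + (k1 * (a powr q * measure lebesgue ?B) + k2 * (C * \<beta> ^ m * measure lebesgue ?B)))"
    using a k C \<beta> by (simp add: ennreal_plus ennreal_mult)
  also have "a * ?w * measure lebesgue ?B + (k1 * (a powr q * measure lebesgue ?B) + k2 * (C * \<beta> ^ m * measure lebesgue ?B))
     = measure lebesgue ?B * (a * (2 * ?w + (1 + C) * \<beta>))"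
  proof -
    have "k1 * a powr q = a * (?w + \<beta>)" using a by (simp add: k1_def)
    moreover have "k2 * \<beta> ^ m = a * \<beta>" using \<beta> by (simp add: k2_def)
    ultimately have "k1 * (a powr q * measure lebesgue ?B) = a * (?w + \<beta>) * measure lebesgue ?B"
      "k2 * (C * \<beta> ^ m * measure lebesgue ?B) = a * \<beta> * C * measure lebesgue ?B"
      by (simp_all add: mult_ac)
    then show ?thesis by (simp add: algebra_simps)
  qed
  finally show ?thesis .
qed

section \<open>Growth functions with an inverse\<close>

text \<open>\<open>contract\<close> is what remains of convexity. \<open>I\<close> stands for
  \<open>young_inv\<close>, a genuine two-sided inverse on the positive reals because the functions
  concerned are finite, continuous and strictly increasing.\<close>

locale young_growth = growth +
  fixes I :: "real \<Rightarrow> real"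
  assumes contract: "0 \<le> \<theta> \<Longrightarrow> \<theta> \<le> 1 \<Longrightarrow> 0 \<le> t \<Longrightarrow> P (\<theta> * t) \<le> \<theta> * P t"
    and inv_right: "0 < s \<Longrightarrow> P (I s) = s"
    and inv_left: "0 < t \<Longrightarrow> I (P t) = t"
    and inv_pos: "0 < s \<Longrightarrow> 0 < I s"
begin

lemma inv_mono: "0 < s \<Longrightarrow> s \<le> s' \<Longrightarrow> I s \<le> I s'"
proof (rule ccontr)
  assume s: "0 < s" "s \<le> s'" and "\<not> I s \<le> I s'"
  then have "P (I s') \<le> P (I s)" using inv_pos[of s'] by (intro mono) auto
  then have "s' \<le> s" using s by (simp add: inv_right)
  with s have "s = s'" by simp
  with \<open>\<not> I s \<le> I s'\<close> show False by simp
qed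

lemma expand: "1 \<le> c \<Longrightarrow> 0 \<le> t \<Longrightarrow> c * P t \<le> P (c * t)"
  using contract[of "1 / c" "c * t"] by (simp add: field_simps)

lemma inv_scale:
  assumes "1 \<le> c" "0 < s" shows "I (c * s) \<le> c * I s"
proof -
  have "c * s \<le> P (c * I s)" using expand[of c "I s"] assms inv_pos[of s] by (simp add: inv_right)
  then have "I (c * s) \<le> I (P (c * I s))" using assms by (intro inv_mono) auto
  then show ?thesis using assms inv_pos[of s] by (simp add: inv_left)
qed

lemma le_inv_iff: "0 \<le> t \<Longrightarrow> 0 < s \<Longrightarrow> P t \<le> s \<longleftrightarrow> t \<le> I s"
proof
  assume t: "0 \<le> t" "0 < s" "P t \<le> s"
  show "t \<le> I s"
  proof (cases "t = 0")
    case False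
    then have "I (P t) \<le> I s" using t pos[of t] by (intro inv_mono) auto
    then show ?thesis using False t by (simp add: inv_left)
  qed (use t inv_pos[of s] in auto)
next
  assume t: "0 \<le> t" "0 < s" "t \<le> I s"
  then show "P t \<le> s" using mono[of t "I s"] by (simp add: inv_right)
qed

text \<open>The quotient \<open>P t / t powr q\<close> is increasing up to a constant: a doubling
  multiplies \<open>P\<close> by at least \<rho> but the power only by \<open>2 powr q\<close>.
  Rounding \<open>t / s\<close> to a power of 2 costs \<open>2 powr q\<close>.\<close>

lemma powr_le:
  assumes q: "0 \<le> q" "2 powr q < \<rho>" and s: "0 < s" "s \<le> t"
  shows "t powr q * P s \<le> 2 powr q * s powr q * P t"
proof -
  \<comment> \<open>The extra factor 2 makes \<open>k\<close> nonnegative, with \<open>t / s\<close>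
    in the interval from \<open>2 ^ (k - 1)\<close> to \<open>2 ^ k\<close>; \<open>k = 0\<close>
    then forces \<open>t = s\<close>.\<close>
  obtain k :: int where k: "dyadic k < t / s * 2" "t / s * 2 \<le> 2 powr (real_of_int k + 1)"
    using dyadic_exponent[of "t / s * 2"] s by auto
  have "1 \<le> t / s" using s by simp
  then have "1 * 2 \<le> t / s * 2" by (rule mult_right_mono) simp
  then have "1 * 2 \<le> 2 powr (real_of_int k + 1)" using k(2) by (rule order.trans)
  then have "2 powr 1 \<le> 2 powr (real_of_int k + 1)"
    by (simp only: powr_one mult_1_left zero_le_numeral)
  then have k0: "0 \<le> k" using powr_le_cancel_iff[of 2 1 "real_of_int k + 1"] by simp
  define j where "j = nat k"
  have kj: "real_of_int k = real j" using k0 by (simp add: j_def)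
  show ?thesis
  proof (cases j)
    case 0
    then have "t / s * 2 \<le> 2" using k kj by simp
    then have "t = s" using s by (simp add: field_simps)
    moreover have "1 \<le> 2 powr q" using q by (simp add: ge_one_powr_ge_zero)
    ultimately show ?thesis using s nonneg[of s] by (simp add: mult_right_mono)
  next
    case (Suc i)
    have 1: "2 ^ i * s \<le> t" using k(1) Suc s by (simp add: kj powr_realpow field_simps powr_add)
    have 2: "t \<le> 2 ^ i * (2 * s)" using k(2) Suc s by (simp add: kj powr_realpow field_simps powr_add)
    have "t powr q \<le> (2 ^ i * (2 * s)) powr q" using 2 s q by (intro powr_mono2) auto
    also have "... = (2 powr q) ^ i * (2 powr q * s powr q)"
      using s by (simp add: powr_mult powr_realpow[symmetric] powr_powr mult.commute)
    finally have "t powr q * P s \<le> (2 powr q) ^ i * (2 powr q * s powr q) * P s"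
      using nonneg[of s] s by (intro mult_right_mono) auto
    also have "... \<le> \<rho> ^ i * (2 powr q * s powr q) * P s"
      using q nonneg[of s] s by (intro mult_right_mono power_mono) auto
    also have "... = (2 powr q * s powr q) * (\<rho> ^ i * P s)" by simp
    also have "... \<le> (2 powr q * s powr q) * P t"
    proof (rule mult_left_mono)
      have "\<rho> ^ i * P s \<le> P (2 ^ i * s)" using s by (intro pow_lower) auto
      also have "... \<le> P t" using 1 s by (intro mono) auto
      finally show "\<rho> ^ i * P s \<le> P t" .
    qed simp
    finally show ?thesis .
  qed
qed

text \<open>Split at the height \<open>s\<close> with \<open>P s = 1 / t ^ n\<close>: lower values
  contribute at most \<open>s powr q\<close>, and for higher ones \<open>powr_le\<close> trades
  \<open>f powr q\<close> for a multiple of \<open>P f\<close>, whose integral is at most 1.\<close>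

lemma average_bound:
  fixes f :: "'a::euclidean_space \<Rightarrow> real"
  assumes q: "1 \<le> q" "2 powr q < \<rho>"
    and fm: "f \<in> borel_measurable lebesgue" and f: "\<And>y. 0 \<le> f y" and t: "0 < t"
    and le: "ball_int z t (\<lambda>y. ennreal (P (f y))) \<le> 1"
  shows "ball_int z t (\<lambda>y. ennreal (f y powr q))
    \<le> ennreal (((1 + 2 powr q / unit_ball_vol (real DIM('a))) * I (1 / t ^ DIM('a))) powr q * vol z t)"
proof -
  let ?B = "ball z t" and ?v = "unit_ball_vol (real DIM('a))"
  define s where "s = I (1 / t ^ DIM('a))"
  have s: "s > 0" unfolding s_def using t by (intro inv_pos) auto
  have Ps: "P s = 1 / t ^ DIM('a)" unfolding s_def using t by (intro inv_right) auto
  define k where "k = 2 powr q * s powr q * t ^ DIM('a)"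
  have k: "k \<ge> 0" using t by (simp add: k_def)
  note [measurable] = measurable_comp[OF fm f]
  have pw: "f y powr q \<le> s powr q + k * P (f y)" for y
  proof (cases "f y \<le> s")
    case True
    then have "f y powr q \<le> s powr q" using f q by (intro powr_mono2) auto
    moreover have "0 \<le> k * P (f y)" using k f nonneg by simp
    ultimately show ?thesis by simp
  next
    case False
    then have "f y powr q * P s \<le> 2 powr q * s powr q * P (f y)"
      using q s by (intro powr_le) auto
    then have "f y powr q \<le> k * P (f y)" using t by (simp add: Ps k_def field_simps)
    then show ?thesis by (smt (verit) powr_ge_zero)
  qed
  have "(\<integral>\<^sup>+y\<in>?B. ennreal (f y powr q) \<partial>lebesgue)
    \<le> (\<integral>\<^sup>+y. ennreal (s powr q) * indicator ?B y + ennreal k * (ennreal (P (f y)) * indicator ?B y) \<partial>lebesgue)"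
  proof (rule nn_integral_mono)
    fix y
    have "ennreal (f y powr q) \<le> ennreal (s powr q + k * P (f y))" using pw by (rule ennreal_leI)
    also have "... = ennreal (s powr q) + ennreal k * ennreal (P (f y))"
      using k f nonneg by (subst ennreal_plus) (auto simp: ennreal_mult)
    finally show "ennreal (f y powr q) * indicator ?B y \<le> ennreal (s powr q) * indicator ?B y + ennreal k * (ennreal (P (f y)) * indicator ?B y)"
      by (auto simp: indicator_def)
  qed
  also have "... = ennreal (s powr q * measure lebesgue ?B) + ennreal k * (\<integral>\<^sup>+y\<in>?B. ennreal (P (f y)) \<partial>lebesgue)"
    by (subst nn_integral_add) (auto simp: nn_integral_cmult emeasure_ball_leb ennreal_mult)
  also have "... \<le> ennreal (s powr q * measure lebesgue ?B) + ennreal k * 1"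
    using le by (intro add_left_mono mult_left_mono) auto
  also have "... = ennreal (s powr q * measure lebesgue ?B + k)" using k by simp
  also have "... \<le> ennreal (((1 + 2 powr q / ?v) * s) powr q * measure lebesgue ?B)"
  proof (rule ennreal_leI)
    have v: "?v > 0" by simp
    have "s powr q * measure lebesgue ?B + k = (1 + 2 powr q / ?v) powr 1 * s powr q * measure lebesgue ?B"
      using t unit_ball_vol_pos[of "real DIM('a)", THEN less_imp_neq, THEN not_sym]
      by (simp add: k_def content_ball field_simps)
    also have "... \<le> (1 + 2 powr q / ?v) powr q * s powr q * measure lebesgue ?B"
      using q v by (intro mult_right_mono powr_mono) auto
    also have "... = ((1 + 2 powr q / ?v) * s) powr q * measure lebesgue ?B"
      using s v by (simp add: powr_mult)
    finally show "s powr q * measure lebesgue ?B + k \<le> ((1 + 2 powr q / ?v) * s) powr q * measure lebesgue ?B" .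
  qed
  finally show ?thesis by (simp add: s_def)
qed

end

text \<open>An infinite integral gives the value 0 through \<open>enn2real\<close>, so finiteness
  has to be carried along as a separate fact.\<close>

definition qmean :: "real \<Rightarrow> ('a::euclidean_space \<Rightarrow> real) \<Rightarrow> 'a \<Rightarrow> real \<Rightarrow> real" where
  "qmean q f z t = (enn2real (ball_int z t (\<lambda>y. ennreal (f y powr q))) / vol z t) powr (1 / q)"

text \<open>The quantity \<open>c(x,t) (\<bar>b x - b_B\<bar> + \<beta>)\<close> divided by \<beta>,
  so that estimates for it are uniform in \<open>b\<close>.\<close>

abbreviation osc_mean ::
  "real \<Rightarrow> real \<Rightarrow> ('a::euclidean_space \<Rightarrow> real) \<Rightarrow> real \<Rightarrow> ('a \<Rightarrow> real) \<Rightarrow> 'a \<Rightarrow> real \<Rightarrow> real" where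
  "osc_mean \<alpha> q b \<beta> f x t \<equiv> t powr \<alpha> * qmean q f x t * (\<bar>b x - ball_avg b x t\<bar> / \<beta> + 1)"

lemma qmean_nonneg: "0 \<le> qmean q f z t" by (simp add: qmean_def)

lemma qmean_powr:
  assumes q: "0 < q" and t: "0 < t" and fin: "ball_int z t (\<lambda>y. ennreal (f y powr q)) < \<infinity>"
  shows "ball_int z t (\<lambda>y. ennreal (f y powr q)) = ennreal (qmean q f z t powr q * vol z t)"
proof -
  let ?J = "\<integral>\<^sup>+y\<in>ball z t. ennreal (f y powr q) \<partial>lebesgue"
  have "qmean q f z t powr q = enn2real ?J / vol z t"
    using q by (simp add: qmean_def powr_powr)
  then have "qmean q f z t powr q * vol z t = enn2real ?J"
    using measure_ball_pos[OF t, of z] by simp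
  then show ?thesis using fin by simp
qed

lemma qmean_le:
  assumes q: "0 < q" and t: "0 < t" and a: "0 \<le> a"
    and le: "ball_int z t (\<lambda>y. ennreal (f y powr q)) \<le> ennreal (a powr q * vol z t)"
  shows "qmean q f z t \<le> a"
proof -
  have "ball_int z t (\<lambda>y. ennreal (f y powr q)) < \<infinity>" using le by (auto intro: le_less_trans)
  from qmean_powr[OF q t this] le have "ennreal (qmean q f z t powr q * vol z t) \<le> ennreal (a powr q * vol z t)"
    by simp
  then have "qmean q f z t powr q * vol z t \<le> a powr q * vol z t"
    by (subst (asm) ennreal_le_iff) auto
  then have "qmean q f z t powr q \<le> a powr q"
    using measure_ball_pos[OF t, of z] by (simp add: mult_le_cancel_right)
  then show ?thesis using q a powr_less_mono2[of q a "qmean q f z t"] by (meson linorder_not_le)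
qed

text \<open>With \<open>w\<close> the value of \<open>layer\<close> at \<open>x\<close>, the mean is
  at most \<open>I1 w\<close> and at most a constant times \<open>I1 (1 / t ^ n)\<close>. The
  relation between \<open>I1\<close> and \<open>I2\<close> makes the two bounds, multiplied by
  \<open>t powr \<alpha>\<close>, meet up to that constant at \<open>t ^ n = 1 / w\<close>, with
  common value \<open>I2 w\<close>; applying \<open>P2\<close> returns \<open>w\<close>.\<close>

lemma hedberg:
  fixes f :: "'a::euclidean_space \<Rightarrow> real"
  assumes Y1: "young_growth P1 \<rho>1 p1 I1" and Y2: "young_growth P2 \<rho>2 p2 I2"
    and I2: "\<And>t. 0 < t \<Longrightarrow> I2 t = I1 t * t powr (- \<alpha> / real DIM('a))" and \<alpha>: "0 \<le> \<alpha>"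
    and q: "1 \<le> q" "2 powr q < \<rho>1"
    and fm: "f \<in> borel_measurable lebesgue" and f: "\<And>y. 0 \<le> f y" and t: "0 < t"
    and le: "(\<integral>\<^sup>+y. ennreal (P1 (f y)) \<partial>lebesgue) \<le> 1"
  shows "ennreal (P2 (t powr \<alpha> * qmean q f x t / (1 + 2 powr q / unit_ball_vol (real DIM('a))))) \<le> layer P1 q f x"
proof -
  interpret Y1: young_growth P1 \<rho>1 p1 I1 by fact
  interpret Y2: young_growth P2 \<rho>2 p2 I2 by fact
  define c1 where "c1 = 1 + 2 powr q / unit_ball_vol (real DIM('a))"
  have c1: "c1 \<ge> 1" by (simp add: c1_def)
  let ?A = "qmean q f x t" and ?n = "DIM('a)"
  have leB: "ball_int x t (\<lambda>y. ennreal (P1 (f y))) \<le> 1"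
    by (rule order.trans[OF _ le]) (auto intro!: nn_integral_mono simp: indicator_def)
  note avg = Y1.average_bound[OF q fm f t leB, folded c1_def]
  have A1: "?A \<le> c1 * I1 (1 / t ^ ?n)"
    using q t c1 Y1.inv_pos[of "1 / t ^ ?n"] by (intro qmean_le[OF _ t _ avg]) auto
  have fin: "ball_int x t (\<lambda>y. ennreal (f y powr q)) < \<infinity>"
    using avg by (auto intro: le_less_trans)
  show ?thesis
  proof (cases "?A = 0 \<or> layer P1 q f x = \<infinity>")
    case True
    then show ?thesis by (auto simp: Y2.zero)
  next
    case False
    then have A: "?A > 0" using qmean_nonneg[of q f x t] by (simp add: less_le)
    obtain w where w: "layer P1 q f x = ennreal w" "0 \<le> w" using False by (cases "layer P1 q f x") auto
    have "ennreal (P1 ?A) \<le> layer P1 q f x"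
      using q fin qmean_powr[OF _ t fin] by (intro Y1.layer_ge[OF A t]) auto
    then have PA: "P1 ?A \<le> w" using w by simp
    with Y1.pos[OF A] have w0: "w > 0" by simp
    have A2: "?A \<le> I1 w" using PA A w0 Y1.le_inv_iff by simp
    have "t powr \<alpha> * ?A \<le> c1 * I2 w"
    \<comment> \<open>Radii with \<open>t\<^sup>n \<le> 1 / w\<close> are bounded through the maximal function, larger ones through the norm of \<open>f\<close>.\<close>
    proof (cases "w \<le> 1 / t ^ ?n")
      case True
      have "t powr \<alpha> = (t ^ ?n) powr (\<alpha> / real ?n)" using t by (simp add: powr_realpow[symmetric] powr_powr)
      also have "... \<le> (1 / w) powr (\<alpha> / real ?n)"
        using True w0 t \<alpha> by (intro powr_mono2) (auto simp: field_simps)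
      also have "... = w powr (- \<alpha> / real ?n)" using w0 by (simp add: powr_divide powr_minus_divide)
      finally have "t powr \<alpha> * ?A \<le> w powr (- \<alpha> / real ?n) * I1 w"
        using A2 A by (intro mult_mono) auto
      also have "... = I2 w" using I2[OF w0] by simp
      also have "... \<le> c1 * I2 w" using c1 Y2.inv_pos[OF w0] by simp
      finally show ?thesis .
    next
      case False
      have "t powr \<alpha> * ?A \<le> t powr \<alpha> * (c1 * I1 (1 / t ^ ?n))" using A1 by (intro mult_left_mono) auto
      also have "... = c1 * I2 (1 / t ^ ?n)"
      proof -
        have "(1 / t ^ ?n) powr (- \<alpha> / real ?n) = t powr \<alpha>"
          using t by (simp add: powr_divide powr_minus_divide powr_realpow[symmetric] powr_powr)
        then show ?thesis using I2[of "1 / t ^ ?n"] t by simp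
      qed
      also have "... \<le> c1 * I2 w"
        using False c1 t by (intro mult_left_mono Y2.inv_mono) auto
      finally show ?thesis .
    qed
    then have "t powr \<alpha> * ?A / c1 \<le> I2 w" using c1 by (simp add: field_simps)
    then have "P2 (t powr \<alpha> * ?A / c1) \<le> w"
      using Y2.le_inv_iff[of "t powr \<alpha> * ?A / c1" w] w0 c1 A by simp
    then show ?thesis using w by (simp add: c1_def)
  qed
qed

section \<open>From indices to doubling\<close>

text \<open>Right difference quotients increase with \<open>h\<close> and dominate all left ones, so
  they converge to their infimum \<open>D\<close>. The limit in \<open>right_deriv\<close> therefore
  exists, and both claims are bounds on an infimum.\<close>

lemma right_deriv_convex:
  fixes P :: "real \<Rightarrow> real"
  assumes conv: "\<And>x y u. 0 \<le> x \<Longrightarrow> 0 \<le> y \<Longrightarrow> 0 \<le> u \<Longrightarrow> u \<le> 1 \<Longrightarrow> P (u * x + (1 - u) * y) \<le> u * P x + (1 - u) * P y"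
    and t: "0 < t"
  shows "0 < h \<Longrightarrow> h * right_deriv P t \<le> P (t + h) - P t"
    and "0 < k \<Longrightarrow> k \<le> t \<Longrightarrow> P t - P (t - k) \<le> k * right_deriv P t"
proof -
  define S where "S h = (P (t + h) - P t) / h" for h
  have mono: "S h \<le> S h'" if h: "0 < h" "h \<le> h'" for h h'
  proof -
    have "P (h / h' * (t + h') + (1 - h / h') * t) \<le> h / h' * P (t + h') + (1 - h / h') * P t"
      using h t by (intro conv) auto
    moreover have "h / h' * (t + h') + (1 - h / h') * t = t + h" using h by (simp add: field_simps)
    ultimately have "P (t + h) - P t \<le> h / h' * (P (t + h') - P t)" by (simp add: algebra_simps)
    then show ?thesis using h by (simp add: S_def field_simps)
  qed
  have low: "(P t - P (t - k)) / k \<le> S h" if h: "0 < h" and k: "0 < k" "k \<le> t" for h k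
  proof -
    have "P (k / (h + k) * (t + h) + (1 - k / (h + k)) * (t - k)) \<le> k / (h + k) * P (t + h) + (1 - k / (h + k)) * P (t - k)"
      using h k t by (intro conv) auto
    moreover have "k / (h + k) * (t + h) + (1 - k / (h + k)) * (t - k) = t - k + k / (h + k) * (h + k)"
      by (simp add: ring_distribs)
    moreover from this have "k / (h + k) * (t + h) + (1 - k / (h + k)) * (t - k) = t"
      using h k by simp
    ultimately have "P t \<le> k / (h + k) * P (t + h) + (1 - k / (h + k)) * P (t - k)" by simp
    moreover have "1 - k / (h + k) = h / (h + k)" using h k by (simp add: field_simps)
    ultimately have "P t \<le> k / (h + k) * P (t + h) + h / (h + k) * P (t - k)" by simp
    then have "(h + k) * P t \<le> (h + k) * (k / (h + k) * P (t + h) + h / (h + k) * P (t - k))"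
      using h k by (intro mult_left_mono) auto
    also have "... = k * P (t + h) + h * P (t - k)" using h k by (simp add: distrib_left)
    finally have "h * (P t - P (t - k)) \<le> k * (P (t + h) - P t)" by (simp add: algebra_simps)
    then show ?thesis using h k by (simp add: S_def field_simps)
  qed
  define D where "D = (INF h\<in>{0<..}. S h)"
  have bdd: "bdd_below (S ` {0<..})" using low[of _ t] t by (intro bdd_belowI[of _ "(P t - P (t - t)) / t"]) auto
  have D1: "D \<le> S h" if "0 < h" for h
    unfolding D_def using bdd that by (intro cINF_lower) auto
  have D2: "(P t - P (t - k)) / k \<le> D" if "0 < k" "k \<le> t" for k
    unfolding D_def using low that by (intro cINF_greatest) auto
  have "(S \<longlongrightarrow> D) (at_right 0)"
  proof (rule order_tendstoI)
    fix a assume "a < D"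
    then show "\<forall>\<^sub>F h in at_right 0. a < S h"
      using D1 by (intro eventually_at_right_less[THEN eventually_mono]) (auto intro: less_le_trans)
  next
    fix a assume "D < a"
    then obtain h0 where h0: "h0 > 0" "S h0 < a"
      unfolding D_def using cINF_less_iff[OF _ bdd] by (metis greaterThan_iff greaterThan_non_empty)
    show "\<forall>\<^sub>F h in at_right 0. S h < a"
      unfolding eventually_at_right_field
    proof (intro exI[of _ h0] conjI allI impI)
      fix h assume "0 < h" "h < h0"
      then show "S h < a" using mono[of h h0] h0 by simp
    qed (use h0 in auto)
  qed
  then have D: "right_deriv P t = D"
    unfolding right_deriv_def S_def by (intro tendsto_Lim) auto
  show "h * right_deriv P t \<le> P (t + h) - P t" if "0 < h"
    using D1[OF that] that by (simp add: D S_def field_simps)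
  show "P t - P (t - k) \<le> k * right_deriv P t" if "0 < k" "k \<le> t"
    using D2[OF that] that by (simp add: D field_simps)
qed

text \<open>Derivatives and indices enter the argument only through this lemma; afterwards only
  doubling constants and the inverse are used.\<close>

lemma young_function_growth:
  assumes Y: "young_function \<Phi>" and def: "young_indices_defined \<Phi>"
    and lo: "1 < young_lower_index \<Phi>" and up: "young_upper_index \<Phi> < \<infinity>"
  shows "\<exists>\<rho> p. young_growth (\<lambda>t. enn2real (\<Phi> t)) \<rho> p (young_inv \<Phi>)"
proof -
  define P where "P t = enn2real (\<Phi> t)" for t
  have \<Phi>0: "\<Phi> 0 = 0" using Y by (simp add: young_function_def)
  have pos: "0 < P t" if "0 < t" for t
    using def that by (auto simp: young_indices_defined_def P_def enn2real_positive_iff)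
  have \<Phi>P: "\<Phi> t = ennreal (P t)" if "0 \<le> t" for t
    using def that \<Phi>0 by (cases "t = 0") (auto simp: young_indices_defined_def P_def)
  have P0: "P 0 = 0" by (simp add: P_def \<Phi>0)
  have nn: "0 \<le> P t" for t by (simp add: P_def)
  have conv: "P (u * x + (1 - u) * y) \<le> u * P x + (1 - u) * P y" if "0 \<le> x" "0 \<le> y" "0 \<le> u" "u \<le> 1" for x y u
  proof -
    have "\<Phi> (u * x + (1 - u) * y) \<le> ennreal u * \<Phi> x + ennreal (1 - u) * \<Phi> y"
      using Y that by (simp add: young_function_def)
    then have "ennreal (P (u * x + (1 - u) * y)) \<le> ennreal (u * P x + (1 - u) * P y)"
      using that nn by (simp add: \<Phi>P ennreal_plus ennreal_mult)
    then show ?thesis using that nn by (subst (asm) ennreal_le_iff) auto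
  qed
  have contract: "P (\<theta> * t) \<le> \<theta> * P t" if "0 \<le> \<theta>" "\<theta> \<le> 1" "0 \<le> t" for \<theta> t
    using conv[of t 0 \<theta>] that by (simp add: P0)
  have smono: "P s < P t" if "0 \<le> s" "s < t" for s t
  proof -
    have "P (s / t * t) \<le> s / t * P t" using that by (intro contract) auto
    also have "... < 1 * P t" using that pos[of t] by (intro mult_strict_right_mono) auto
    finally show ?thesis using that by simp
  qed
  have mono: "P s \<le> P t" if "0 \<le> s" "s \<le> t" for s t
    using smono[of s t] that by (cases "s = t") auto
  note rd = right_deriv_convex[of P, OF conv]
  obtain a where "1 < ereal a" and a_less: "ereal a < young_lower_index \<Phi>"
    using ereal_dense2[OF lo] by blast
  then have a: "1 < a" "ereal a \<le> young_lower_index \<Phi>" by (auto simp: one_ereal_def)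
  have lower: "a * P t \<le> t * right_deriv P t" if t: "0 < t" for t
  proof -
    have "young_lower_index \<Phi> \<le> ereal (t * right_deriv P t / P t)"
      unfolding young_lower_index_def P_def using t by (intro INF_lower) auto
    then have "ereal a \<le> ereal (t * right_deriv P t / P t)" using a(2) by (rule order.trans[rotated])
    then show ?thesis using pos[OF t] by (simp add: field_simps)
  qed
  \<comment> \<open>The tangent at \<open>t\<close> lies below the graph, so an index above 1 gives a doubling ratio above 2.\<close>
  have dl: "(1 + a) * P t \<le> P (2 * t)" if "0 \<le> t" for t
  proof (cases "t = 0")
    case False
    then show ?thesis using lower[of t] rd(1)[of t t] that by (simp add: algebra_simps)
  qed (simp add: P0)
  obtain c0 where c0: "young_upper_index \<Phi> \<le> ereal c0"
    using up by (cases "young_upper_index \<Phi>") auto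
  define c where "c = max 1 c0"
  have c: "1 \<le> c" "young_upper_index \<Phi> \<le> ereal c" using c0 by (auto simp: c_def intro: order.trans)
  have upper: "t * right_deriv P t \<le> c * P t" if t: "0 < t" for t
  proof -
    have "ereal (t * right_deriv P t / P t) \<le> young_upper_index \<Phi>"
      unfolding young_upper_index_def P_def using t by (intro SUP_upper) auto
    then have "ereal (t * right_deriv P t / P t) \<le> ereal c" using c(2) by (rule order.trans)
    then show ?thesis using pos[OF t] by (simp add: field_simps)
  qed
  \<comment> \<open>A tangent bounds \<open>P\<close> only from below, so the upper index is
    exploited to the left of \<open>t\<close>: a step of \<open>t / (2 * c)\<close> loses at most
    half of \<open>P t\<close>. After \<open>p\<close> such steps the argument has at least halved,
    which yields \<open>2 ^ p\<close>.\<close>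
  define \<theta> where "\<theta> = 1 - 1 / (2 * c)"
  have \<theta>: "0 < \<theta>" "\<theta> < 1" using c by (auto simp: \<theta>_def field_simps)
  have half: "P t \<le> 2 * P (\<theta> * t)" if t: "0 < t" for t
  proof -
    have "P t - P (t - t / (2 * c)) \<le> t / (2 * c) * right_deriv P t"
      using c t by (intro rd(2)) (auto simp: field_simps)
    also have "... = (t * right_deriv P t) / (2 * c)" by simp
    also have "... \<le> (c * P t) / (2 * c)" using upper[OF t] c by (intro divide_right_mono) auto
    also have "... = P t / 2" using c by simp
    finally have "P t / 2 \<le> P (t - t / (2 * c))" by simp
    moreover have "t - t / (2 * c) = \<theta> * t" by (simp add: \<theta>_def algebra_simps)
    ultimately show ?thesis by simp
  qed
  have halfk: "P t \<le> 2 ^ k * P (\<theta> ^ k * t)" if t: "0 < t" for t k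
  proof (induction k)
    case (Suc k)
    have "2 ^ k * P (\<theta> ^ k * t) \<le> 2 ^ k * (2 * P (\<theta> * (\<theta> ^ k * t)))"
      using t \<theta> by (intro mult_left_mono half) auto
    with Suc have "P t \<le> 2 ^ k * (2 * P (\<theta> * (\<theta> ^ k * t)))" by (rule order.trans)
    then show ?case by (simp add: mult_ac)
  qed simp
  obtain p where p: "\<theta> ^ p < 1 / 2" using real_arch_pow_inv[of "1 / 2" \<theta>] \<theta> by auto
  have du: "P (2 * t) \<le> 2 ^ p * P t" if "0 \<le> t" for t
  proof (cases "t = 0")
    case False
    then have t: "t > 0" using that by simp
    have "P (2 * t) \<le> 2 ^ p * P (\<theta> ^ p * (2 * t))" using t by (intro halfk) auto
    also have "... \<le> 2 ^ p * P t"
    proof (intro mult_left_mono mono)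
      have "\<theta> ^ p * (2 * t) \<le> 1 / 2 * (2 * t)" using p t by (intro mult_right_mono) auto
      then show "\<theta> ^ p * (2 * t) \<le> t" by simp
    qed (use \<theta> t in auto)
    finally show ?thesis .
  qed (simp add: P0)
  have inv_left: "young_inv \<Phi> (P t) = t" if t: "0 < t" for t
  proof -
    have "{r. 0 \<le> r \<and> ennreal (P t) < \<Phi> r} = {t<..}"
    proof (intro set_eqI iffI)
      fix r assume "r \<in> {r. 0 \<le> r \<and> ennreal (P t) < \<Phi> r}"
      then have "0 \<le> r" "P t < P r" using nn by (auto simp: \<Phi>P ennreal_less_iff)
      then show "r \<in> {t<..}" using mono[of r t] by (cases "r \<le> t") auto
    next
      fix r assume "r \<in> {t<..}"
      then show "r \<in> {r. 0 \<le> r \<and> ennreal (P t) < \<Phi> r}"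
        using smono[of t r] t nn by (auto simp: \<Phi>P ennreal_less_iff)
    qed
    then show ?thesis by (simp add: young_inv_def)
  qed
  have "convex_on {0<..} P"
    unfolding convex_on_alt using conv by auto
  then have cont: "continuous_on {0<..} P" by (intro convex_on_continuous) auto
  \<comment> \<open>By \<open>contract\<close> the graph lies below the line \<open>t * P 1\<close>
    up to 1 and above it from 1 on, which brackets \<open>s\<close> for the intermediate value
    theorem.\<close>
  have surj: "\<exists>t>0. P t = s" if s: "0 < s" for s
  proof -
    define t0 where "t0 = min 1 (s / P 1)"
    define t1 where "t1 = max 1 (s / P 1)"
    have P1: "P 1 > 0" by (rule pos) simp
    have t0: "0 < t0" "t0 \<le> 1" "t0 \<le> s / P 1" using s P1 by (auto simp: t0_def)
    have t1: "1 \<le> t1" "s / P 1 \<le> t1" by (auto simp: t1_def)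
    have "P t0 \<le> t0 * P 1" using contract[of t0 1] t0 by simp
    also have "... \<le> s / P 1 * P 1" using t0 P1 by (intro mult_right_mono) auto
    finally have 0: "P t0 \<le> s" using P1 by simp
    have "s = s / P 1 * P 1" using P1 by simp
    also have "... \<le> t1 * P 1" using t1 P1 by (intro mult_right_mono) auto
    also have "... \<le> P t1" using contract[of "1 / t1" t1] t1 by (simp add: field_simps)
    finally have 1: "s \<le> P t1" .
    have "continuous_on {t0..t1} P" using cont by (rule continuous_on_subset) (use t0 in auto)
    then obtain t where "t0 \<le> t" "t \<le> t1" "P t = s" using IVT'[of P t0 s t1] 0 1 t0 t1 by auto
    then show ?thesis using t0 by (intro exI[of _ t]) auto
  qed
  have "young_growth P (1 + a) p (young_inv \<Phi>)"
  proof unfold_locales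
    fix s :: real assume "0 < s"
    then obtain t where "0 < t" "P t = s" using surj by blast
    then show "P (young_inv \<Phi> s) = s" "0 < young_inv \<Phi> s" using inv_left by auto
  qed (use P0 pos mono dl du a contract inv_left in auto)
  then show ?thesis unfolding P_def by blast
qed

section \<open>The global estimate\<close>

text \<open>The sharp factor is \<open>d powr (DIM('a) / q)\<close>; the larger power keeps
  \<open>q\<close> out of the later dilation constants.\<close>

lemma qmean_enlarge:
  fixes f :: "'a::euclidean_space \<Rightarrow> real"
  assumes q: "1 \<le> q" and t: "0 < t" and d: "1 \<le> d" and sub: "ball x t \<subseteq> ball y (d * t)"
    and fin: "ball_int y (d * t) (\<lambda>z. ennreal (f z powr q)) < \<infinity>"
  shows "qmean q f x t \<le> d ^ DIM('a) * qmean q f y (d * t)"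
proof (rule qmean_le)
  let ?m = "qmean q f y (d * t)"
  have "ball_int x t (\<lambda>z. ennreal (f z powr q)) \<le> ball_int y (d * t) (\<lambda>z. ennreal (f z powr q))"
    using sub by (rule nn_integral_mono_set)
  also have "... = ennreal (?m powr q * vol y (d * t))"
    using q t d fin by (intro qmean_powr) auto
  also have "... \<le> ennreal ((d ^ DIM('a) * ?m) powr q * vol x t)"
  proof (rule ennreal_leI)
    have "?m powr q * vol y (d * t) = (d ^ DIM('a)) powr 1 * ?m powr q * vol x t"
      using measure_ball_scale[of t d y x] t d by simp
    also have "... \<le> (d ^ DIM('a)) powr q * ?m powr q * vol x t"
      using q d by (intro mult_right_mono powr_mono) auto
    also have "... = (d ^ DIM('a) * ?m) powr q * vol x t"
      using d qmean_nonneg[of q f y "d * t"] by (simp add: powr_mult)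
    finally show "?m powr q * vol y (d * t) \<le> (d ^ DIM('a) * ?m) powr q * vol x t" .
  qed
  finally show "ball_int x t (\<lambda>z. ennreal (f z powr q)) \<le> ennreal ((d ^ DIM('a) * ?m) powr q * vol x t)" .
qed (use q t d qmean_nonneg[of q f y "d * t"] in auto)

lemma growth_power: "2 \<le> p \<Longrightarrow> growth (\<lambda>t. t ^ p) (2 ^ p) p"
proof unfold_locales
  assume p: "2 \<le> p"
  have "(2::real) ^ 2 \<le> 2 ^ p" using p by (intro power_increasing) auto
  then show "(2::real) < 2 ^ p" by simp
qed (auto intro: power_mono simp: power_mult_distrib power_0_left)

text \<open>The levels counted are those with \<open>dyadic k \<le> c * I V\<close>, and downwards
  the terms decay with ratio \<open>1 / \<rho>\<close>. The sum is thus comparable with its top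
  term, and that with \<open>V\<close> by doubling. It sums level sets described by
  \<open>layer\<close>.\<close>

lemma (in young_growth) dyadic_sum_le:
  assumes c: "1 \<le> c"
  shows "(\<integral>\<^sup>+k. ennreal (P (dyadic k)) * indicator {k. ennreal (P (dyadic k / c)) \<le> V} k \<partial>count_space UNIV)
    \<le> ennreal ((2 * c) ^ p * 2 ^ p / (1 - 1 / \<rho>)) * V"
proof (cases "V = \<infinity> \<or> V = 0")
  case True
  then show ?thesis
  proof
    assume "V = \<infinity>"
    moreover have "0 < (2 * c) ^ p * 2 ^ p / (1 - 1 / \<rho>)" using c rho by simp
    then have "ennreal ((2 * c) ^ p * 2 ^ p / (1 - 1 / \<rho>)) \<noteq> 0" by (simp only: ennreal_eq_0_iff not_le)
    ultimately show ?thesis by (simp only: infinity_ennreal_def ennreal_mult_top if_False top_greatest)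
  next
    assume V: "V = 0"
    have "0 < P (dyadic k / c)" for k using c by (intro pos) auto
    then have "indicator {k. ennreal (P (dyadic k / c)) \<le> V} k = (0::ennreal)" for k
      using V by (simp add: indicator_def ennreal_eq_0_iff not_le)
    then show ?thesis by simp
  qed
next
  case False
  then obtain v where v: "V = ennreal v" "0 < v" by (cases V) (auto simp: less_le)
  define s where "s = I v"
  have s: "s > 0" using v by (simp add: s_def inv_pos)
  obtain \<kappa> :: int where \<kappa>: "dyadic \<kappa> < 2 * c * s" "2 * c * s \<le> 2 powr (real_of_int \<kappa> + 1)"
    using dyadic_exponent[of "2 * c * s"] c s by auto
  have le_iff: "ennreal (P (dyadic k / c)) \<le> V \<longleftrightarrow> dyadic k / c \<le> s" for k
    using v c le_inv_iff[of "dyadic k / c" v] by (simp add: s_def)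
  have "(\<integral>\<^sup>+k. ennreal (P (dyadic k)) * indicator {k. ennreal (P (dyadic k / c)) \<le> V} k \<partial>count_space UNIV)
    \<le> ennreal (((2 * c) ^ p * (2 ^ p * v)) / (1 - 1 / \<rho>))"
  proof (rule nn_integral_int_geometric)
    fix k assume k: "\<kappa> < k"
    have "c * s < 2 * c * s" using c s by simp
    also have "... \<le> 2 powr (real_of_int \<kappa> + 1)" by (rule \<kappa>)
    also have "... \<le> dyadic k" using k by (intro powr_mono) auto
    finally have "\<not> dyadic k / c \<le> s" using c by (simp add: field_simps)
    then show "ennreal (P (dyadic k)) * indicator {k. ennreal (P (dyadic k / c)) \<le> V} k = 0"
      by (simp add: le_iff)
  next
    fix j
    let ?k = "real_of_int (\<kappa> - int j)"
    have "P (2 powr ?k) = P (2 powr (real_of_int \<kappa> - real j) * 1)" by simp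
    also have "... \<le> (1 / \<rho>) ^ j * P (dyadic \<kappa> * 1)" by (rule powr_lower) simp
    also have "... \<le> (1 / \<rho>) ^ j * ((2 * c) ^ p * (2 ^ p * v))"
    proof (rule mult_left_mono)
      have "P (dyadic \<kappa> * 1) \<le> P (c * (2 * s))" using \<kappa> c s by (intro mono) auto
      also have "... \<le> (2 * c) ^ p * P (2 * s)" using c s by (intro mult_upper) auto
      also have "... \<le> (2 * c) ^ p * (2 ^ p * P s)" using c s by (intro mult_left_mono double_upper) auto
      also have "P s = v" using v by (simp add: s_def inv_right)
      finally show "P (dyadic \<kappa> * 1) \<le> (2 * c) ^ p * (2 ^ p * v)" .
    qed (use rho in simp)
    finally have "P (2 powr ?k) \<le> (2 * c) ^ p * (2 ^ p * v) * (1 / \<rho>) ^ j" by (simp only: mult.commute)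
    then show "ennreal (P (2 powr real_of_int (\<kappa> - int j))) * indicator {k. ennreal (P (dyadic k / c)) \<le> V} (\<kappa> - int j)
        \<le> ennreal ((2 * c) ^ p * (2 ^ p * v) * (1 / \<rho>) ^ j)"
      by (auto simp: indicator_def intro!: ennreal_leI)
  qed (use c v rho in auto)
  also have "(2 * c) ^ p * (2 ^ p * v) / (1 - 1 / \<rho>) = (2 * c) ^ p * 2 ^ p / (1 - 1 / \<rho>) * v" by simp
  also have "ennreal ... = ennreal ((2 * c) ^ p * 2 ^ p / (1 - 1 / \<rho>)) * V"
    using v c rho by (subst ennreal_mult) auto
  finally show ?thesis .
qed

text \<open>Passing through the mean over \<open>ball y R\<close> leaves \<open>u x\<close> and the
  mean \<open>D\<close> of \<open>u\<close> over \<open>ball x t\<close>; \<open>layer_ge\<close>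
  with \<open>q = 1\<close> bounds \<open>D ^ p\<close> by a function of \<open>x\<close> alone. The
  point is that \<open>t\<close> disappears from the right-hand side.\<close>

lemma osc_maximal_bound:
  fixes b :: "'a::euclidean_space \<Rightarrow> real"
  assumes p: "2 \<le> p" and b: "bmo_le b \<beta>" and t: "0 < t" and R: "0 < R" and sub: "ball x t \<subseteq> ball y R"
    and u: "u = (\<lambda>z. \<bar>b z - ball_avg b y R\<bar> * indicator (ball y R) z)"
  shows "ennreal ((\<bar>b x - ball_avg b x t\<bar> / \<beta> + 1) ^ p)
    \<le> ennreal (4 ^ p) * (ennreal (1 / \<beta> ^ p) * (ennreal (u x ^ p) + layer (\<lambda>t. t ^ p) 1 u x) + 1)"
proof -
  interpret Q: growth "\<lambda>t. t ^ p" "2 ^ p" p using p by (rule growth_power)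
  have \<beta>: "\<beta> > 0" using bmo_leD(1)[OF b] .
  let ?c = "ball_avg b y R"
  let ?J = "\<integral>\<^sup>+z\<in>ball x t. ennreal \<bar>b z - ?c\<bar> \<partial>lebesgue"
  have x: "x \<in> ball x t" using t by simp
  then have xy: "x \<in> ball y R" using sub by (rule subsetD[rotated])
  have "?J \<le> ball_int y R (\<lambda>z. ennreal \<bar>b z - ?c\<bar>)" using sub by (rule nn_integral_mono_set)
  also have "... < \<infinity>" using bmo_leD(3)[OF b R, of y] by (auto intro: le_less_trans)
  finally have fin: "?J < \<infinity>" .
  define D where "D = enn2real ?J / vol x t"
  have m: "vol x t > 0" using measure_ball_pos[OF t] .
  have D0: "0 \<le> D" by (simp add: D_def)
  have JD: "?J = ennreal (D * vol x t)" using fin m by (simp add: D_def)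
  have "ennreal (\<bar>ball_avg b x t - ?c\<bar> * vol x t) \<le> ?J"
    using bmo_leD(2)[OF b t] t by (rule ball_avg_diff_le)
  then have "\<bar>ball_avg b x t - ?c\<bar> * vol x t \<le> D * vol x t"
    using D0 unfolding JD by (subst (asm) ennreal_le_iff) auto
  then have avg: "\<bar>ball_avg b x t - ?c\<bar> \<le> D" using m by (simp add: mult_le_cancel_right)
  have ux: "u x = \<bar>b x - ?c\<bar>" using xy by (simp add: u)
  have lay: "ennreal (D ^ p) \<le> layer (\<lambda>t. t ^ p) 1 u x"
  proof (cases "D = 0")
    case True
    then show ?thesis using p by (simp add: power_0_left)
  next
    case False
    have "ball_int x t (\<lambda>z. ennreal (u z powr 1)) = ?J"
      using sub by (intro nn_integral_cong) (auto simp: u indicator_def)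
    then show ?thesis using False D0 by (intro Q.layer_ge[OF _ t]) (auto simp: JD)
  qed
  have "(\<bar>b x - ball_avg b x t\<bar> / \<beta> + 1) ^ p \<le> ((u x + D) / \<beta> + 1) ^ p"
    using avg \<beta> by (intro power_mono add_right_mono divide_right_mono) (auto simp: ux)
  also have "... \<le> 2 ^ p * (((u x + D) / \<beta>) ^ p + 1 ^ p)"
    using D0 \<beta> by (intro power_add_le) (auto simp: ux)
  also have "((u x + D) / \<beta>) ^ p = (1 / \<beta> ^ p) * (u x + D) ^ p" by (simp add: power_divide)
  also have "2 ^ p * ((1 / \<beta> ^ p) * (u x + D) ^ p + 1 ^ p) \<le> 2 ^ p * ((1 / \<beta> ^ p) * (2 ^ p * (u x ^ p + D ^ p)) + 2 ^ p)"
    using D0 \<beta> by (intro mult_left_mono add_mono power_add_le) (auto simp: ux)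
  also have "... = (2 ^ p * 2 ^ p) * ((1 / \<beta> ^ p) * (u x ^ p + D ^ p) + 1)" by (simp add: algebra_simps)
  also have "(2::real) ^ p * 2 ^ p = 4 ^ p" by (simp add: power_mult_distrib[symmetric])
  finally have "ennreal ((\<bar>b x - ball_avg b x t\<bar> / \<beta> + 1) ^ p) \<le> ennreal (4 ^ p * ((1 / \<beta> ^ p) * (u x ^ p + D ^ p) + 1))"
    by (rule ennreal_leI)
  also have "... = ennreal (4 ^ p) * (ennreal (1 / \<beta> ^ p) * (ennreal (u x ^ p) + ennreal (D ^ p)) + 1)"
  proof -
    have "ennreal (4 ^ p * (k * (v + w) + 1)) = ennreal (4 ^ p) * (ennreal k * (ennreal v + ennreal w) + 1)"
      if "0 \<le> k" "0 \<le> v" "0 \<le> w" for k v w :: real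
      using that by (simp add: ennreal_mult ennreal_plus)
    then show ?thesis using D0 \<beta> by (simp only: ux abs_ge_zero zero_le_power less_imp_le zero_le_divide_1_iff)
  qed
  also have "... \<le> ennreal (4 ^ p) * (ennreal (1 / \<beta> ^ p) * (ennreal (u x ^ p) + layer (\<lambda>t. t ^ p) 1 u x) + 1)"
    using lay by (intro mult_left_mono add_mono) auto
  finally show ?thesis .
qed

text \<open>The moment bound controls the first term, and \<open>layer_integral_le\<close> for
  \<open>t ^ p\<close> with \<open>q = 1\<close>, the maximal inequality in \<open>L^p\<close>,
  reduces the second to it. The powers of \<beta> cancel.\<close>

lemma osc_maximal_integral:
  fixes b :: "'a::euclidean_space \<Rightarrow> real"
  assumes p: "2 \<le> p"
  shows "\<exists>K>0. \<forall>(b :: 'a \<Rightarrow> real) \<beta> y R. bmo_le b \<beta> \<longrightarrow> 0 < R \<longrightarrow>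
     (\<integral>\<^sup>+x. ennreal (1 / \<beta> ^ p) * (ennreal ((\<bar>b x - ball_avg b y R\<bar> * indicator (ball y R) x) ^ p)
        + layer (\<lambda>t. t ^ p) 1 (\<lambda>z. \<bar>b z - ball_avg b y R\<bar> * indicator (ball y R) z) x) \<partial>lebesgue)
     \<le> ennreal (K * vol y R)"
proof -
  interpret Q: growth "\<lambda>t. t ^ p" "2 ^ p" p using p by (rule growth_power)
  obtain C where C: "C > 0" and mom: "\<And>(b :: 'a \<Rightarrow> real) \<beta> x r. bmo_le b \<beta> \<Longrightarrow> 0 < r \<Longrightarrow>
    (ball_int x r (\<lambda>y. ennreal (\<bar>b y - ball_avg b x r\<bar> ^ p))) \<le> ennreal (C * \<beta> ^ p * vol x r)"
    using bmo_moment[of p] p by force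
  have p2: "2 powr 1 < (2::real) ^ p" using Q.rho by simp
  define L where "L = 2 * 5 ^ DIM('a) * (4 ^ p / (1 - 2 powr 1 / 2 ^ p) :: real)"
  have L: "L > 0" using p2 by (simp add: L_def)
  show ?thesis
  proof (intro exI[of _ "(1 + L) * C"] conjI allI impI)
    fix b :: "'a \<Rightarrow> real" and \<beta> R :: real and y :: 'a
    assume b: "bmo_le b \<beta>" and R: "0 < R"
    have \<beta>: "\<beta> > 0" using bmo_leD(1)[OF b] .
    note bm [measurable] = locally_integrable_measurable[OF bmo_leD(2)[OF b]]
    let ?B = "ball y R"
    define u where "u z = \<bar>b z - ball_avg b y R\<bar> * indicator ?B z" for z
    have u0: "0 \<le> u z" for z by (simp add: u_def)
    have um [measurable]: "u \<in> borel_measurable lebesgue" unfolding u_def by measurable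
    have I1: "(\<integral>\<^sup>+x. ennreal (u x ^ p) \<partial>lebesgue) \<le> ennreal (C * \<beta> ^ p * measure lebesgue ?B)"
    proof -
      have "(\<integral>\<^sup>+x. ennreal (u x ^ p) \<partial>lebesgue) = (\<integral>\<^sup>+x\<in>?B. ennreal (\<bar>b x - ball_avg b y R\<bar> ^ p) \<partial>lebesgue)"
        using p by (intro nn_integral_cong) (auto simp: u_def indicator_def power_0_left)
      also have "... \<le> ennreal (C * \<beta> ^ p * measure lebesgue ?B)" by (rule mom[OF b R])
      finally show ?thesis .
    qed
    have I2: "(\<integral>\<^sup>+x. layer (\<lambda>t. t ^ p) 1 u x \<partial>lebesgue) \<le> ennreal L * (\<integral>\<^sup>+x. ennreal (u x ^ p) \<partial>lebesgue)"
      unfolding L_def by (rule Q.layer_integral_le[OF _ p2 um u0]) simp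
    have "(\<integral>\<^sup>+x. ennreal (1 / \<beta> ^ p) * (ennreal (u x ^ p) + layer (\<lambda>t. t ^ p) 1 u x) \<partial>lebesgue)
      = ennreal (1 / \<beta> ^ p) * ((\<integral>\<^sup>+x. ennreal (u x ^ p) \<partial>lebesgue) + (\<integral>\<^sup>+x. layer (\<lambda>t. t ^ p) 1 u x \<partial>lebesgue))"
      by (simp add: nn_integral_cmult nn_integral_add)
    also have "... \<le> ennreal (1 / \<beta> ^ p) * (ennreal (C * \<beta> ^ p * measure lebesgue ?B) + ennreal L * ennreal (C * \<beta> ^ p * measure lebesgue ?B))"
      using I1 order.trans[OF I2 mult_left_mono[OF I1]] by (intro mult_left_mono add_mono) auto
    also have "... = ennreal (1 / \<beta> ^ p * (C * \<beta> ^ p * measure lebesgue ?B + L * (C * \<beta> ^ p * measure lebesgue ?B)))"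
      using \<beta> L C by (subst ennreal_mult) (auto simp: ennreal_plus ennreal_mult)
    also have "1 / \<beta> ^ p * (C * \<beta> ^ p * measure lebesgue ?B + L * (C * \<beta> ^ p * measure lebesgue ?B)) = (1 + L) * C * measure lebesgue ?B"
      using \<beta> by (simp add: field_simps)
    finally show "(\<integral>\<^sup>+x. ennreal (1 / \<beta> ^ p) * (ennreal ((\<bar>b x - ball_avg b y R\<bar> * indicator (ball y R) x) ^ p)
        + layer (\<lambda>t. t ^ p) 1 (\<lambda>z. \<bar>b z - ball_avg b y R\<bar> * indicator (ball y R) z) x) \<partial>lebesgue)
     \<le> ennreal ((1 + L) * C * vol y R)"
      by (simp add: u_def)
  qed (use L C in simp)
qed

text \<open>A single measurable \<open>W\<close> for all \<open>t\<close> is what a later supremum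
  over radii requires. On each level the size of \<open>c\<close> is frozen, the oscillation is
  integrated over slightly larger selected balls, and the disjoint selected balls lie where
  \<open>layer P1 q f\<close> is large.\<close>

lemma global_bound:
  fixes \<alpha> q :: real
  assumes Y1: "young_growth P1 \<rho>1 p1 I1" and Y2: "young_growth P2 \<rho>2 p2 I2"
    and I2: "\<And>t. 0 < t \<Longrightarrow> I2 t = I1 t * t powr (- \<alpha> / real DIM('a))" and \<alpha>: "0 \<le> \<alpha>"
    and q: "1 \<le> q" "2 powr q < \<rho>1"
  shows "\<exists>K>0. \<forall>(b :: 'a::euclidean_space \<Rightarrow> real) \<beta> f. bmo_le b \<beta> \<longrightarrow> f \<in> borel_measurable lebesgue \<longrightarrow> (\<forall>y. 0 \<le> f y) \<longrightarrow>
     (\<integral>\<^sup>+y. ennreal (P1 (f y)) \<partial>lebesgue) \<le> 1 \<longrightarrow>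
     (\<exists>W. W \<in> borel_measurable lebesgue \<and> (\<integral>\<^sup>+x. W x \<partial>lebesgue) \<le> ennreal K \<and>
       (\<forall>x. \<forall>t>0. ennreal (P2 (osc_mean \<alpha> q b \<beta> f x t)) \<le> W x))"
proof -
  interpret Y1: young_growth P1 \<rho>1 p1 I1 by fact
  interpret Y2: young_growth P2 \<rho>2 p2 I2 by fact
  \<comment> \<open>An exponent above \<open>p2\<close>, and at least 2 as
    \<open>growth_power\<close> demands.\<close>
  define p where "p = p2 + 2"
  have p: "2 \<le> p" by (simp add: p_def)
  let ?n = "DIM('a)"
  obtain M where M: "M > 0" and osc: "\<And>(b :: 'a \<Rightarrow> real) \<beta> y R. bmo_le b \<beta> \<Longrightarrow> 0 < R \<Longrightarrow>
     (\<integral>\<^sup>+x. ennreal (1 / \<beta> ^ p) * (ennreal ((\<bar>b x - ball_avg b y R\<bar> * indicator (ball y R) x) ^ p)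
        + layer (\<lambda>t. t ^ p) 1 (\<lambda>z. \<bar>b z - ball_avg b y R\<bar> * indicator (ball y R) z) x) \<partial>lebesgue)
     \<le> ennreal (M * vol y R)"
    using osc_maximal_integral[OF p, where 'a = 'a] by blast
  define c1 where "c1 = 1 + 2 powr q / unit_ball_vol (real ?n)"
  have c1: "1 \<le> c1" by (simp add: c1_def)
  \<comment> \<open>\<open>12 = 6 * 2\<close>: the 6 undoes the lowering of the level in \<mu>, the
    2 recentres a selected ball at one of its points; \<open>c1\<close> comes from
    \<open>hedberg\<close>.\<close>
  define c2 where "c2 = 12 ^ ?n * c1"
  have c2: "1 \<le> c2" unfolding c2_def using c1 mult_mono[of 1 "12 ^ ?n" 1 c1] by simp
  define L1 where "L1 = 2 * 5 ^ ?n * (4 ^ p1 / (1 - 2 powr q / \<rho>1))"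
  define L2 where "L2 = (2 * c2) ^ p2 * 2 ^ p2 / (1 - 1 / \<rho>2)"
  \<comment> \<open>One \<open>4 ^ p\<close> comes from taking the oscillation out of
    \<open>P2\<close>, the other from \<open>osc_maximal_bound\<close>; \<open>6 ^ n\<close> and
    \<open>5 ^ n\<close> compare the dilated balls in \<open>w\<close> with the selected
    one.\<close>
  define K0 where "K0 = (4 ^ p * 4 ^ p) * (M * 6 ^ ?n + 5 ^ ?n)"
  have L1: "L1 > 0" using q Y1.rho by (simp add: L1_def)
  have L2: "L2 > 0" using c2 Y2.rho by (simp add: L2_def)
  have K0: "K0 > 0" using M by (simp add: K0_def add_pos_pos)
  show ?thesis
  proof (intro exI[of _ "K0 * L2 * L1"] conjI allI impI)
    fix b f :: "'a \<Rightarrow> real" and \<beta> :: real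
    assume b: "bmo_le b \<beta>" and fm: "f \<in> borel_measurable lebesgue" and "\<forall>y. 0 \<le> f y"
      and le: "(\<integral>\<^sup>+y. ennreal (P1 (f y)) \<partial>lebesgue) \<le> 1"
    then have f: "\<And>y. 0 \<le> f y" by blast
    have \<beta>: "\<beta> > 0" using bmo_leD(1)[OF b] .
    note bm [measurable] = locally_integrable_measurable[OF bmo_leD(2)[OF b]]
    define c where "c x t = t powr \<alpha> * qmean q f x t" for x t
    have c0: "0 \<le> c x t" for x t by (simp add: c_def qmean_nonneg)
    have avg: "ball_int z t (\<lambda>y. ennreal (f y powr q)) \<le> ennreal ((c1 * I1 (1 / t ^ ?n)) powr q * vol z t)"
      if t: "0 < t" for z t
    proof -
      have "ball_int z t (\<lambda>y. ennreal (P1 (f y))) \<le> 1"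
        by (rule order.trans[OF _ le]) (auto intro!: nn_integral_mono simp: indicator_def)
      then show ?thesis unfolding c1_def by (intro Y1.average_bound[OF q fm f t])
    qed
    have fin: "ball_int z t (\<lambda>y. ennreal (f y powr q)) < \<infinity>" if "0 < t" for z t
      using avg[OF that] by (rule le_less_trans) simp
    have V: "ennreal (P2 (c x t / c1)) \<le> layer P1 q f x" if "0 < t" for x t
      unfolding c_def c1_def using hedberg[OF Y1 Y2 I2 \<alpha> q fm f that le] by simp
    have c_bound: "c x t \<le> c1 * I2 (1 / t ^ ?n)" if t: "0 < t" for x t
    proof -
      have "qmean q f x t \<le> c1 * I1 (1 / t ^ ?n)"
        using q t c1 Y1.inv_pos[of "1 / t ^ ?n"] by (intro qmean_le[OF _ t _ avg]) auto
      then have "c x t \<le> t powr \<alpha> * (c1 * I1 (1 / t ^ ?n))" unfolding c_def by (intro mult_left_mono) auto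
      also have "... = c1 * I2 (1 / t ^ ?n)"
      proof -
        have "(1 / t ^ ?n) powr (- \<alpha> / real ?n) = t powr \<alpha>"
          using t by (simp add: powr_divide powr_minus_divide powr_realpow[symmetric] powr_powr)
        then show ?thesis using I2[of "1 / t ^ ?n"] t by simp
      qed
      finally show ?thesis .
    qed
    have enlarge: "c x t \<le> d ^ ?n * c y (d * t)" if "0 < t" "1 \<le> d" "ball x t \<subseteq> ball y (d * t)" for x y t d
    proof -
      have "c x t \<le> (d * t) powr \<alpha> * (d ^ ?n * qmean q f y (d * t))"
        unfolding c_def using that \<alpha> qmean_nonneg fin[of "d * t" y] q
        by (intro mult_mono powr_mono2 qmean_enlarge) auto
      then show ?thesis by (simp add: c_def mult_ac)
    qed
    \<comment> \<open>The level is lowered by \<open>6\<^sup>n\<close> so that every ball \<open>ball x t\<close> with \<open>c x t > 2\<^sup>k\<close> and \<open>x\<close> in a selected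
      \<open>ball i (5 * r k i)\<close> has \<open>t \<le> r k i\<close>: otherwise \<open>ball i (6 * t)\<close> would contradict the near maximality
      of \<open>r k i\<close>.\<close>
    define \<mu> where "\<mu> k = dyadic k / 6 ^ ?n" for k
    have \<mu>: "0 < \<mu> k" for k by (simp add: \<mu>_def)
    define S where "S k = {x. \<exists>t>0. \<mu> k < c x t}" for k
    \<comment> \<open>A bound for the radii at level \<open>k\<close>, needed for near maximality
      and Vitali's lemma: by \<open>c_bound\<close>, \<open>c\<close> exceeds \<open>\<mu> k\<close>
      only if \<open>t ^ n \<le> 1 / P2 (\<mu> k / c1)\<close>.\<close>
    define T where "T k = max 1 (1 / P2 (\<mu> k / c1))" for k
    have bd: "t \<le> T k" if t: "0 < t" "\<mu> k < c x t" for x t k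
    proof (cases "t \<le> 1")
      case False
      have Pp: "0 < P2 (\<mu> k / c1)" using \<mu>[of k] c1 by (intro Y2.pos) auto
      have "\<mu> k / c1 < I2 (1 / t ^ ?n)" using t c_bound[OF t(1), of x] c1 by (simp add: field_simps)
      then have "P2 (\<mu> k / c1) \<le> 1 / t ^ ?n"
        using Y2.le_inv_iff[of "\<mu> k / c1" "1 / t ^ ?n"] t \<mu>[of k] c1 by simp
      then have "t ^ ?n \<le> 1 / P2 (\<mu> k / c1)" using t Pp by (simp add: field_simps)
      moreover have "t \<le> t ^ ?n" using False by (intro self_le_power) auto
      ultimately show ?thesis by (simp add: T_def)
    qed (simp add: T_def)
    have "\<exists>t>0. \<mu> k < c z t \<and> (\<forall>t'>0. \<mu> k < c z t' \<longrightarrow> t' < 2 * t)" if z: "z \<in> S k" for k z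
    proof -
      obtain t0 where "t0 > 0" "\<mu> k < c z t0" using z by (auto simp: S_def)
      then show ?thesis by (rule near_maximal[of t0 _ "T k"]) (use bd in auto)
    qed
    then have "\<exists>t. \<forall>z\<in>S k. 0 < t z \<and> \<mu> k < c z (t z) \<and> (\<forall>t'>0. \<mu> k < c z t' \<longrightarrow> t' < 2 * t z)" for k
      by (intro bchoice) blast
    then have "\<exists>r. \<forall>k. \<forall>z\<in>S k. 0 < r k z \<and> \<mu> k < c z (r k z) \<and> (\<forall>t'>0. \<mu> k < c z t' \<longrightarrow> t' < 2 * r k z)"
      by (intro choice allI)
    then obtain r where r_all: "\<forall>k. \<forall>z\<in>S k. 0 < r k z \<and> \<mu> k < c z (r k z) \<and> (\<forall>t'>0. \<mu> k < c z t' \<longrightarrow> t' < 2 * r k z)" ..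
    have r: "0 < r k z" "\<mu> k < c z (r k z)" "0 < t' \<Longrightarrow> \<mu> k < c z t' \<Longrightarrow> t' < 2 * r k z" if "z \<in> S k" for k z t'
      using r_all that by blast+
    have "\<exists>C. countable C \<and> C \<subseteq> S k \<and> pairwise (\<lambda>i j. disjnt (ball i (r k i)) (ball j (r k j))) C
       \<and> S k \<subseteq> (\<Union>i\<in>C. ball i (5 * r k i))" for k
    proof -
      have sub: "S k \<subseteq> (\<Union>i\<in>S k. ball i (r k i))" using r(1) by auto
      have rr: "0 < r k i \<and> r k i \<le> T k" if "i \<in> S k" for i
        using r(1,2)[OF that] bd by auto
      show ?thesis by (rule Vitali_covering_lemma_balls[OF sub rr]) auto
    qed
    then have "\<exists>C. \<forall>k. countable (C k) \<and> C k \<subseteq> S k \<and> pairwise (\<lambda>i j. disjnt (ball i (r k i)) (ball j (r k j))) (C k)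
       \<and> S k \<subseteq> (\<Union>i\<in>C k. ball i (5 * r k i))"
      by (intro choice allI)
    then obtain C where C_all: "\<forall>k. countable (C k) \<and> C k \<subseteq> S k \<and> pairwise (\<lambda>i j. disjnt (ball i (r k i)) (ball j (r k j))) (C k)
       \<and> S k \<subseteq> (\<Union>i\<in>C k. ball i (5 * r k i))" ..
    have C: "countable (C k)" "C k \<subseteq> S k"
       "pairwise (\<lambda>i j. disjnt (ball i (r k i)) (ball j (r k j))) (C k)"
       "S k \<subseteq> (\<Union>i\<in>C k. ball i (5 * r k i))" for k
      using C_all by blast+
    define u where "u i R = (\<lambda>z. \<bar>b z - ball_avg b i R\<bar> * indicator (ball i R) z)" for i R
    have um [measurable]: "u i R \<in> borel_measurable lebesgue" for i R unfolding u_def by measurable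
    define G where "G i R x = ennreal (1 / \<beta> ^ p) * (ennreal (u i R x ^ p) + layer (\<lambda>t. t ^ p) 1 (u i R) x)" for i R x
    have Gm [measurable]: "G i R \<in> borel_measurable lebesgue" for i R unfolding G_def by measurable
    have GI: "(\<integral>\<^sup>+x. G i R x \<partial>lebesgue) \<le> ennreal (M * vol i R)" if "0 < R" for i R
      using osc[OF b that, of i] unfolding G_def u_def .
    define A where "A k = 4 ^ p * 4 ^ p * P2 (dyadic k)" for k
    have A0: "0 \<le> A k" for k unfolding A_def using Y2.nonneg[of "dyadic k"] by simp
    define w where "w k i x = ennreal (A k) * (G i (6 * r k i) x + 1) * indicator (ball i (5 * r k i)) x" for k i x
    have wm [measurable]: "w k i \<in> borel_measurable lebesgue" for k i unfolding w_def by measurable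
    define W where "W x = (\<integral>\<^sup>+k. (\<integral>\<^sup>+i. w k i x \<partial>count_space (C k)) \<partial>count_space UNIV)" for x
    have inner_m: "(\<lambda>x. \<integral>\<^sup>+i. w k i x \<partial>count_space (C k)) \<in> borel_measurable lebesgue" for k
      using C(1) wm by (intro borel_measurable_count_space)
    have Wm: "W \<in> borel_measurable lebesgue"
      unfolding W_def by (rule borel_measurable_count_space) (use inner_m in auto)
    have pointwise: "ennreal (P2 (c x t * (\<bar>b x - ball_avg b x t\<bar> / \<beta> + 1))) \<le> W x" if t: "0 < t" for x t
    proof (cases "c x t = 0")
      case True
      then show ?thesis by (simp add: Y2.zero)
    next
      case False
      then have "0 < c x t" using c0[of x t] by simp
      then obtain k :: int where k: "dyadic k < c x t" "c x t \<le> 2 powr (real_of_int k + 1)"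
        using dyadic_exponent by blast
      have \<mu>k: "\<mu> k \<le> dyadic k" by (simp add: \<mu>_def field_simps)
      then have "x \<in> S k" using k t by (auto simp: S_def intro!: exI[of _ t])
      then obtain i where i: "i \<in> C k" "x \<in> ball i (5 * r k i)" using C(4) by blast
      then have iS: "i \<in> S k" using C(2) by blast
      have tr: "t \<le> r k i"
      proof (rule ccontr)
        assume "\<not> t \<le> r k i"
        then have tri: "r k i < t" by simp
        have "dist i x < 5 * r k i" using i(2) by simp
        then have sub: "ball x t \<subseteq> ball i (6 * t)" using tri by (intro ball_subset_ballI) (simp add: dist_commute)
        have "dyadic k < 6 ^ ?n * c i (6 * t)"
          using k(1) enlarge[OF t _ sub] by simp
        then have "\<mu> k < c i (6 * t)" by (simp add: \<mu>_def field_simps)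
        from r(3)[OF iS _ this] t tri show False by simp
      qed
      have "dist i x < 5 * r k i" using i(2) by simp
      then have sub: "ball x t \<subseteq> ball i (6 * r k i)" using tr by (intro ball_subset_ballI) (simp add: dist_commute)
      define X where "X = \<bar>b x - ball_avg b x t\<bar> / \<beta> + 1"
      have X: "1 \<le> X" using \<beta> by (simp add: X_def)
      \<comment> \<open>Here the factors separate: \<open>c\<close> is replaced by its dyadic size
        and \<open>X\<close> leaves \<open>P2\<close> as a power.\<close>
      have "P2 (c x t * X) \<le> P2 ((2 * X) * dyadic k)"
        using k X c0[of x t] by (intro Y2.mono) (auto simp: powr_add)
      also have "... \<le> (2 * (2 * X)) ^ p2 * P2 (dyadic k)" using X by (intro Y2.mult_upper) auto
      also have "... \<le> (4 * X) ^ p * P2 (dyadic k)"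
      proof (rule mult_right_mono)
        have "(4 * X) ^ p2 \<le> (4 * X) ^ p" using X by (intro power_increasing) (auto simp: p_def)
        then show "(2 * (2 * X)) ^ p2 \<le> (4 * X) ^ p" by simp
      qed (use Y2.nonneg[of "dyadic k"] in simp)
      finally have "ennreal (P2 (c x t * X)) \<le> ennreal ((4 ^ p * P2 (dyadic k)) * X ^ p)"
        by (intro ennreal_leI) (simp add: power_mult_distrib mult_ac)
      also have "... = ennreal (4 ^ p * P2 (dyadic k)) * ennreal (X ^ p)"
        using X Y2.nonneg[of "dyadic k"] by (intro ennreal_mult) auto
      also have "ennreal (X ^ p) \<le> ennreal (4 ^ p) * (G i (6 * r k i) x + 1)"
        unfolding X_def G_def
        using r(1)[OF iS] by (intro osc_maximal_bound[OF p b t _ sub]) (auto simp: u_def)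
      also have "ennreal (4 ^ p * P2 (dyadic k)) * (ennreal (4 ^ p) * (G i (6 * r k i) x + 1)) = w k i x"
        using i(2) Y2.nonneg[of "dyadic k"]
        by (simp add: w_def A_def ennreal_mult mult_ac)
      finally have "ennreal (P2 (c x t * X)) \<le> w k i x" by (simp add: mult_left_mono)
      also have "... \<le> (\<integral>\<^sup>+i. w k i x \<partial>count_space (C k))" using nn_integral_ge_point[OF i(1), of "\<lambda>i. w k i x"] .
      also have "... \<le> W x" unfolding W_def
        using nn_integral_ge_point[of k UNIV "\<lambda>k. \<integral>\<^sup>+i. w k i x \<partial>count_space (C k)"] by simp
      finally show ?thesis by (simp add: X_def)
    qed
    define U where "U k = (\<Union>i\<in>C k. ball i (r k i))" for k
    have Um: "U k \<in> sets lebesgue" for k unfolding U_def using C(1) by (intro sets.countable_UN') auto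
    have wI: "(\<integral>\<^sup>+x. w k i x \<partial>lebesgue) \<le> ennreal (K0 * P2 (dyadic k)) * emeasure lebesgue (ball i (r k i))"
      if i: "i \<in> C k" for k i
    proof -
      have iS: "i \<in> S k" using i C(2) by blast
      note ri = r(1)[OF iS]
      have "(\<integral>\<^sup>+x. w k i x \<partial>lebesgue) \<le> (\<integral>\<^sup>+x. ennreal (A k) * (G i (6 * r k i) x + indicator (ball i (5 * r k i)) x) \<partial>lebesgue)"
        by (intro nn_integral_mono) (auto simp: w_def indicator_def)
      also have "... = ennreal (A k) * ((\<integral>\<^sup>+x. G i (6 * r k i) x \<partial>lebesgue) + emeasure lebesgue (ball i (5 * r k i)))"
        by (simp add: nn_integral_cmult nn_integral_add)
      also have "... \<le> ennreal (A k) * (ennreal (M * vol i (6 * r k i)) + ennreal (vol i (5 * r k i)))"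
        using GI[of "6 * r k i" i] ri by (intro mult_left_mono add_mono) (auto simp: emeasure_ball_leb)
      also have "... = ennreal (A k * (M * vol i (6 * r k i) + vol i (5 * r k i)))"
        using A0 M by (simp add: ennreal_mult ennreal_plus)
      also have "A k * (M * vol i (6 * r k i) + vol i (5 * r k i)) = K0 * P2 (dyadic k) * vol i (r k i)"
        using measure_ball_scale[of "r k i" 6 i i] measure_ball_scale[of "r k i" 5 i i] ri
        by (simp add: A_def K0_def algebra_simps)
      also have "ennreal ... = ennreal (K0 * P2 (dyadic k)) * emeasure lebesgue (ball i (r k i))"
        using K0 Y2.nonneg[of "dyadic k"] by (simp add: emeasure_ball_leb ennreal_mult)
      finally show ?thesis .
    qed
    have level: "(\<integral>\<^sup>+x. (\<integral>\<^sup>+i. w k i x \<partial>count_space (C k)) \<partial>lebesgue) \<le> ennreal (K0 * P2 (dyadic k)) * emeasure lebesgue (U k)" for k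
    proof -
      have "(\<integral>\<^sup>+x. (\<integral>\<^sup>+i. w k i x \<partial>count_space (C k)) \<partial>lebesgue) = (\<integral>\<^sup>+i. (\<integral>\<^sup>+x. w k i x \<partial>lebesgue) \<partial>count_space (C k))"
        by (rule nn_integral_count_space_nn_integral) (use C(1) wm in auto)
      also have "... \<le> (\<integral>\<^sup>+i. ennreal (K0 * P2 (dyadic k)) * ball_int i (r k i) (\<lambda>y. 1) \<partial>count_space (C k))"
        using wI by (intro nn_integral_mono) simp
      also have "... = ennreal (K0 * P2 (dyadic k)) * (\<integral>\<^sup>+i. (ball_int i (r k i) (\<lambda>y. 1)) \<partial>count_space (C k))"
        by (rule nn_integral_cmult) simp
      also have "... \<le> ennreal (K0 * P2 (dyadic k)) * (\<integral>\<^sup>+y\<in>U k. 1 \<partial>lebesgue)"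
        unfolding U_def by (intro mult_left_mono sum_disjoint_le C) auto
      finally show ?thesis using Um by simp
    qed
    \<comment> \<open>Every point \<open>y\<close> of a selected ball sees the level itself:
      \<open>ball y (2 * r k i)\<close> contains the ball, so \<open>c\<close> at \<open>y\<close>
      is large and \<open>hedberg\<close> applies there.\<close>
    have UV: "ennreal (P2 (dyadic k / c2)) \<le> layer P1 q f y" if y: "y \<in> U k" for k y
    proof -
      obtain i where i: "i \<in> C k" "y \<in> ball i (r k i)" using y by (auto simp: U_def)
      have iS: "i \<in> S k" using i C(2) by blast
      note ri = r(1)[OF iS]
      have "dist i y < r k i" using i(2) by simp
      then have sub: "ball i (r k i) \<subseteq> ball y (2 * r k i)" by (intro ball_subset_ballI) simp
      have "\<mu> k < 2 ^ ?n * c y (2 * r k i)" using r(2)[OF iS] enlarge[OF ri _ sub] by simp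
      then have "dyadic k < 6 ^ ?n * (2 ^ ?n * c y (2 * r k i))" by (simp add: \<mu>_def field_simps)
      also have "... = (6 * 2) ^ ?n * c y (2 * r k i)" by (simp only: power_mult_distrib mult.assoc)
      finally have "dyadic k / c2 \<le> c y (2 * r k i) / c1"
        using c1 by (simp add: c2_def field_simps)
      then have "P2 (dyadic k / c2) \<le> P2 (c y (2 * r k i) / c1)"
        using c2 by (intro Y2.mono) auto
      then have "ennreal (P2 (dyadic k / c2)) \<le> ennreal (P2 (c y (2 * r k i) / c1))" by (rule ennreal_leI)
      also have "... \<le> layer P1 q f y" using ri by (intro V) auto
      finally show ?thesis .
    qed
    have "(\<integral>\<^sup>+x. W x \<partial>lebesgue) = (\<integral>\<^sup>+k. (\<integral>\<^sup>+x. (\<integral>\<^sup>+i. w k i x \<partial>count_space (C k)) \<partial>lebesgue) \<partial>count_space UNIV)"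
      unfolding W_def by (rule nn_integral_count_space_nn_integral) (use inner_m in auto)
    also have "... \<le> (\<integral>\<^sup>+k. ennreal K0 * (\<integral>\<^sup>+y. ennreal (P2 (dyadic k)) * indicator (U k) y \<partial>lebesgue) \<partial>count_space UNIV)"
    proof (rule nn_integral_mono)
      fix k
      show "(\<integral>\<^sup>+x. (\<integral>\<^sup>+i. w k i x \<partial>count_space (C k)) \<partial>lebesgue) \<le> ennreal K0 * (\<integral>\<^sup>+y. ennreal (P2 (dyadic k)) * indicator (U k) y \<partial>lebesgue)"
        using level[of k] K0 Um[of k] Y2.nonneg[of "dyadic k"]
        by (simp add: nn_integral_cmult_indicator ennreal_mult mult.assoc)
    qed
    also have "... = ennreal K0 * (\<integral>\<^sup>+k. (\<integral>\<^sup>+y. ennreal (P2 (dyadic k)) * indicator (U k) y \<partial>lebesgue) \<partial>count_space UNIV)"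
      by (rule nn_integral_cmult) simp
    also have "(\<integral>\<^sup>+k. (\<integral>\<^sup>+y. ennreal (P2 (dyadic k)) * indicator (U k) y \<partial>lebesgue) \<partial>count_space UNIV)
      = (\<integral>\<^sup>+y. (\<integral>\<^sup>+k. ennreal (P2 (dyadic k)) * indicator (U k) y \<partial>count_space UNIV) \<partial>lebesgue)"
      by (rule nn_integral_count_space_nn_integral[symmetric]) (use Um in auto)
    \<comment> \<open>At a fixed \<open>y\<close> the levels with \<open>y \<in> U k\<close> all
      satisfy \<open>UV\<close>, so their whole sum costs only a constant times
      \<open>layer\<close>.\<close>
    also have "... \<le> (\<integral>\<^sup>+y. ennreal L2 * layer P1 q f y \<partial>lebesgue)"
    proof (rule nn_integral_mono)
      fix y
      have "(\<integral>\<^sup>+k. ennreal (P2 (dyadic k)) * indicator (U k) y \<partial>count_space UNIV)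
        \<le> (\<integral>\<^sup>+k. ennreal (P2 (dyadic k)) * indicator {k. ennreal (P2 (dyadic k / c2)) \<le> layer P1 q f y} k \<partial>count_space UNIV)"
        using UV by (intro nn_integral_mono) (auto simp: indicator_def)
      also have "... \<le> ennreal L2 * layer P1 q f y"
        unfolding L2_def using c2 by (rule Y2.dyadic_sum_le)
      finally show "(\<integral>\<^sup>+k. ennreal (P2 (dyadic k)) * indicator (U k) y \<partial>count_space UNIV) \<le> ennreal L2 * layer P1 q f y" .
    qed
    also have "... = ennreal L2 * (\<integral>\<^sup>+y. layer P1 q f y \<partial>lebesgue)" by (rule nn_integral_cmult) simp
    also have "(\<integral>\<^sup>+y. layer P1 q f y \<partial>lebesgue) \<le> ennreal L1 * (\<integral>\<^sup>+y. ennreal (P1 (f y)) \<partial>lebesgue)"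
      unfolding L1_def by (rule Y1.layer_integral_le[OF q fm f])
    also have "... \<le> ennreal L1 * 1" using le by (rule mult_left_mono) simp
    finally have "(\<integral>\<^sup>+x. W x \<partial>lebesgue) \<le> ennreal K0 * (ennreal L2 * ennreal L1)"
      by (simp add: mult_left_mono)
    also have "... = ennreal (K0 * L2 * L1)" using K0 L1 L2 by (simp add: ennreal_mult mult.assoc)
    finally have "(\<integral>\<^sup>+x. W x \<partial>lebesgue) \<le> ennreal (K0 * L2 * L1)" .
    then show "\<exists>W. W \<in> borel_measurable lebesgue \<and> (\<integral>\<^sup>+x. W x \<partial>lebesgue) \<le> ennreal (K0 * L2 * L1) \<and>
       (\<forall>x. \<forall>t>0. ennreal (P2 (osc_mean \<alpha> q b \<beta> f x t)) \<le> W x)"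
      using Wm pointwise unfolding c_def by blast
  qed (use K0 L1 L2 in simp)
qed

section \<open>The local estimate\<close>

lemma comm_term:
  fixes b f :: "'a::euclidean_space \<Rightarrow> real"
  assumes m: "2 \<le> m" and q: "q = real m / (real m - 1)" and \<beta>: "0 < \<beta>" and C: "0 \<le> C" and t: "0 < t"
    and fm: "f \<in> borel_measurable lebesgue" and bm: "b \<in> borel_measurable lebesgue"
    and f: "\<And>y. 0 \<le> f y"
    and fin: "ball_int x t (\<lambda>y. ennreal (f y powr q)) < \<infinity>"
    and Ib: "ball_int x t (\<lambda>y. ennreal (\<bar>b y - ball_avg b x t\<bar> ^ m)) \<le> ennreal (C * \<beta> ^ m * vol x t)"
  shows "ennreal (vol x t powr (-1 + \<alpha> / real DIM('a))) * ball_int x t (\<lambda>y. ennreal (\<bar>b x - b y\<bar> * f y))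
    \<le> ennreal (unit_ball_vol (real DIM('a)) powr (\<alpha> / real DIM('a)) * (3 + C) * \<beta> *
        (osc_mean \<alpha> q b \<beta> f x t))"
proof -
  let ?B = "vol x t" and ?c = "ball_avg b x t" and ?a = "qmean q f x t" and ?v = "unit_ball_vol (real DIM('a))"
  have B: "?B > 0" using measure_ball_pos[OF t] .
  have q0: "0 < q" using m by (simp add: q)
  define Z where "Z = 2 * \<bar>b x - ?c\<bar> + (1 + C) * \<beta>"
  have Z: "Z \<ge> 0" using \<beta> C by (simp add: Z_def)
  have a0: "0 \<le> ?a" by (rule qmean_nonneg)
  have "ball_int x t (\<lambda>y. ennreal (\<bar>b x - b y\<bar> * f y)) \<le> ennreal (?B * (?a * Z))"
  \<comment> \<open>\<open>comm_ball_estimate\<close> divides by \<open>a\<close>, but the mean may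
    vanish; hence a slightly larger positive \<open>a\<close> and a limit.\<close>
  proof (rule ennreal_le_epsilon)
    fix e :: real assume e: "0 < e"
    define a where "a = ?a + e / (?B * Z + 1)"
    have BZ: "0 < ?B * Z + 1" using B Z by (simp add: add_nonneg_pos)
    have a: "?a \<le> a" "0 < a" unfolding a_def using e BZ a0 by (auto intro: add_nonneg_pos)
    have "ball_int x t (\<lambda>y. ennreal (f y powr q)) = ennreal (?a powr q * ?B)"
      by (rule qmean_powr[OF q0 t fin])
    also have "... \<le> ennreal (a powr q * ?B)"
      using a a0 q0 B by (intro ennreal_leI mult_right_mono powr_mono2) auto
    finally have "ball_int x t (\<lambda>y. ennreal (\<bar>b x - b y\<bar> * f y)) \<le> ennreal (?B * (a * Z))"
      unfolding Z_def by (intro comm_ball_estimate[OF m q a(2) \<beta> C fm bm f _ Ib])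
    also have "... \<le> ennreal (?B * (?a * Z) + e)"
    proof (rule ennreal_leI)
      have "?B * Z * (e / (?B * Z + 1)) \<le> e" using BZ e by (simp add: field_simps)
      then show "?B * (a * Z) \<le> ?B * (?a * Z) + e" by (simp add: a_def algebra_simps)
    qed
    also have "... = ennreal (?B * (?a * Z)) + ennreal e" using B Z a0 e by (intro ennreal_plus) auto
    finally show "ball_int x t (\<lambda>y. ennreal (\<bar>b x - b y\<bar> * f y)) \<le> ennreal (?B * (?a * Z)) + ennreal e" .
  qed
  then have "ennreal (?B powr (-1 + \<alpha> / real DIM('a))) * ball_int x t (\<lambda>y. ennreal (\<bar>b x - b y\<bar> * f y))
    \<le> ennreal (?B powr (-1 + \<alpha> / real DIM('a))) * ennreal (?B * (?a * Z))"
    by (rule mult_left_mono) simp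
  also have "... = ennreal (?B powr (-1 + \<alpha> / real DIM('a)) * (?B * (?a * Z)))"
    using B Z a0 by (intro ennreal_mult[symmetric]) auto
  also have "... \<le> ennreal (?v powr (\<alpha> / real DIM('a)) * (3 + C) * \<beta> * (t powr \<alpha> * ?a * (\<bar>b x - ?c\<bar> / \<beta> + 1)))"
  proof (rule ennreal_leI)
    have "?B powr (-1 + \<alpha> / real DIM('a)) * ?B = ?B powr (\<alpha> / real DIM('a))"
    proof -
      have "z powr (-1 + e) * z = z powr e" if "0 < z" for z e :: real
        using that by (simp add: powr_diff)
      then show ?thesis using B by blast
    qed
    also have "... = ?v powr (\<alpha> / real DIM('a)) * t powr \<alpha>"
      using t by (simp add: content_ball powr_mult powr_realpow[symmetric] powr_powr)
    finally have 1: "?B powr (-1 + \<alpha> / real DIM('a)) * ?B = ?v powr (\<alpha> / real DIM('a)) * t powr \<alpha>" .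
    have "?B powr (-1 + \<alpha> / real DIM('a)) * (?B * (?a * Z)) = (?B powr (-1 + \<alpha> / real DIM('a)) * ?B) * (?a * Z)"
      by (simp only: mult.assoc)
    also have "... = ?v powr (\<alpha> / real DIM('a)) * t powr \<alpha> * (?a * Z)" by (simp only: 1)
    also have "... \<le> ?v powr (\<alpha> / real DIM('a)) * t powr \<alpha> * (?a * ((3 + C) * \<beta> * (\<bar>b x - ?c\<bar> / \<beta> + 1)))"
    proof (intro mult_left_mono a0)
      have "0 \<le> (1 + C) * \<bar>b x - ?c\<bar>" using C by simp
      then have "Z \<le> (3 + C) * (\<bar>b x - ?c\<bar> + \<beta>)" using \<beta> by (simp add: Z_def algebra_simps)
      also have "... = (3 + C) * \<beta> * (\<bar>b x - ?c\<bar> / \<beta> + 1)" using \<beta> by (simp add: field_simps)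
      finally show "Z \<le> (3 + C) * \<beta> * (\<bar>b x - ?c\<bar> / \<beta> + 1)" .
    qed auto
    finally show "?B powr (-1 + \<alpha> / real DIM('a)) * (?B * (?a * Z))
      \<le> ?v powr (\<alpha> / real DIM('a)) * (3 + C) * \<beta> * (t powr \<alpha> * ?a * (\<bar>b x - ?c\<bar> / \<beta> + 1))"
      by (simp only: mult_ac)
  qed
  finally show ?thesis .
qed

lemma bmo_avg_doubling:
  fixes b :: "'a::euclidean_space \<Rightarrow> real"
  assumes b: "bmo_le b \<beta>" and r: "0 < r"
  shows "\<bar>ball_avg b x r - ball_avg b x (2 ^ m * r)\<bar> \<le> real m * 2 ^ DIM('a) * \<beta>"
proof (induction m)
  case (Suc m)
  have r': "0 < 2 ^ m * r" using r by simp
  have "\<bar>ball_avg b x (2 ^ m * r) - ball_avg b x (2 * (2 ^ m * r))\<bar> \<le> 2 ^ DIM('a) * \<beta>"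
    using r r' measure_ball_scale[of "2 ^ m * r" 2 x x] by (intro bmo_nested[OF b r']) (auto intro!: subset_ball)
  moreover have "2 ^ Suc m * r = 2 * (2 ^ m * r)" by simp
  moreover have "real (Suc m) * 2 ^ DIM('a) * \<beta> = real m * 2 ^ DIM('a) * \<beta> + 2 ^ DIM('a) * \<beta>"
    by (simp add: distrib_right)
  ultimately show ?case using Suc by (simp only:)
qed simp

text \<open>About \<open>m = log 2 (2 * t / r)\<close> doublings of \<open>ball x0 r\<close> reach a
  radius between \<open>2 * t\<close> and \<open>4 * t\<close>; that ball contains
  \<open>ball x t\<close> and is comparable to it. The argument \<open>2 * t / r\<close> matches the
  radius \<open>2 * t\<close> at which the weight condition is used.\<close>

lemma bmo_log:
  fixes b :: "'a::euclidean_space \<Rightarrow> real"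
  assumes b: "bmo_le b \<beta>" and r: "0 < r" "r \<le> t" and x: "x \<in> ball x0 r"
  shows "\<bar>ball_avg b x0 r - ball_avg b x t\<bar> \<le> 2 * 4 ^ DIM('a) * \<beta> * (1 + ln (2 * t / r))"
proof -
  have \<beta>: "\<beta> > 0" using bmo_leD(1)[OF b] .
  define l where "l = log 2 (2 * t / r)"
  have tr: "1 \<le> 2 * t / r" using r by (simp add: field_simps)
  have l0: "0 \<le> l" unfolding l_def using tr by (intro zero_le_log_cancel_iff[THEN iffD2]) auto
  define m where "m = nat \<lceil>l\<rceil>"
  have m: "l \<le> real m" "real m \<le> l + 1" unfolding m_def using l0 by linarith+
  have pl: "2 powr l = 2 * t / r" unfolding l_def using tr by (intro powr_log_cancel) auto
  have "2 powr l \<le> 2 powr real m" using m(1) by simp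
  then have m1: "2 * t \<le> 2 ^ m * r" using pl r by (simp add: powr_realpow field_simps)
  have "2 powr real m \<le> 2 powr (l + 1)" using m(2) by (intro powr_mono) auto
  then have m2: "2 ^ m * r \<le> 4 * t" using pl r by (simp add: powr_realpow powr_add field_simps)
  have t: "0 < t" using r by simp
  have "\<bar>ball_avg b x t - ball_avg b x0 (2 ^ m * r)\<bar> \<le> 4 ^ DIM('a) * \<beta>"
  proof (rule bmo_nested[OF b t])
    show "ball x t \<subseteq> ball x0 (2 ^ m * r)"
      using x m1 r by (intro ball_subset_ballI) (simp add: dist_commute)
    have "vol x0 (2 ^ m * r) \<le> unit_ball_vol (real DIM('a)) * (4 * t) ^ DIM('a)"
    proof (subst measure_ball_leb)
      have "(2 ^ m * r) ^ DIM('a) \<le> (4 * t) ^ DIM('a)" using m2 r by (intro power_mono) auto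
      then show "unit_ball_vol (real DIM('a)) * (2 ^ m * r) ^ DIM('a) \<le> unit_ball_vol (real DIM('a)) * (4 * t) ^ DIM('a)"
        by (rule mult_left_mono) simp
    qed (use r in simp)
    also have "... = 4 ^ DIM('a) * vol x t"
      using t by (simp add: content_ball power_mult_distrib)
    finally show "vol x0 (2 ^ m * r) \<le> 4 ^ DIM('a) * vol x t" .
  qed (use r in simp)
  moreover have "\<bar>ball_avg b x0 r - ball_avg b x0 (2 ^ m * r)\<bar> \<le> real m * 2 ^ DIM('a) * \<beta>"
    by (rule bmo_avg_doubling[OF b r(1)])
  ultimately have "\<bar>ball_avg b x0 r - ball_avg b x t\<bar> \<le> real m * 2 ^ DIM('a) * \<beta> + 4 ^ DIM('a) * \<beta>" by linarith
  also have "... \<le> real m * 4 ^ DIM('a) * \<beta> + 4 ^ DIM('a) * \<beta>"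
    using \<beta> by (intro add_right_mono mult_right_mono mult_left_mono power_mono) auto
  also have "... = 4 ^ DIM('a) * \<beta> * (real m + 1)" by (simp add: algebra_simps)
  also have "... \<le> 4 ^ DIM('a) * \<beta> * (2 * (1 + ln (2 * t / r)))"
  proof (rule mult_left_mono)
    have ln2: "2 / 3 \<le> ln (2::real)" using ln2_ge_two_thirds .
    have lnt: "0 \<le> ln (2 * t / r)" using tr by simp
    have "ln (2 * t / r) * 1 \<le> ln (2 * t / r) * (2 * ln 2)" using ln2 lnt by (intro mult_left_mono) auto
    then have "l \<le> 2 * ln (2 * t / r)" using ln2 by (simp add: l_def log_def field_simps)
    with m show "real m + 1 \<le> 2 * (1 + ln (2 * t / r))" by simp
  qed (use \<beta> in simp)
  finally show ?thesis by (simp only: mult_ac)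
qed

section \<open>Measurability of the commutator maximal function\<close>

lemma sigma_finite_lebesgue: "sigma_finite_measure (lebesgue :: 'a::euclidean_space measure)"
proof
  show "\<exists>A::'a set set. countable A \<and> A \<subseteq> sets lebesgue \<and> \<Union>A = space lebesgue \<and> (\<forall>a\<in>A. emeasure lebesgue a \<noteq> \<infinity>)"
  proof (intro exI[of _ "range (\<lambda>n::nat. ball 0 (real n))"] conjI)
    have "\<exists>n::nat. norm x < real n" for x :: 'a by (rule reals_Archimedean2)
    then show "\<Union> (range (\<lambda>n::nat. ball (0::'a) (real n))) = space lebesgue" by auto
  qed (auto simp: emeasure_ball_leb)
qed

text \<open>The supremum reduces to rational radii: open balls are exhausted from inside, and since
  \<open>-1 + \<alpha> / n\<close> is at most 0, passing to a smaller radius does not decrease the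
  weight. For a fixed radius, measurability in \<open>x\<close> comes from the product
  space.\<close>

lemma frac_max_comm_measurable:
  fixes b f :: "'a::euclidean_space \<Rightarrow> real"
  assumes bm: "b \<in> borel_measurable lebesgue" and fm: "f \<in> borel_measurable lebesgue" and \<alpha>: "\<alpha> < real DIM('a)"
  shows "frac_max_comm b \<alpha> f \<in> borel_measurable lebesgue"
proof -
  let ?e = "-1 + \<alpha> / real DIM('a)" and ?v = "unit_ball_vol (real DIM('a))"
  define J where "J t x = ball_int x t (\<lambda>y. ennreal (\<bar>b x - b y\<bar> * \<bar>f y\<bar>))" for t x
  define F where "F t x = ennreal (vol x t powr ?e) * J t x" for t x
  have J_meas: "J t \<in> borel_measurable lebesgue" for t
  proof -
    interpret sigma_finite_measure "lebesgue :: 'a measure" by (rule sigma_finite_lebesgue)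
    have id: "(\<lambda>x::'a. x) \<in> borel_measurable lebesgue" by (rule measurable_completion) simp
    have f1: "(\<lambda>p. fst p) \<in> (lebesgue \<Otimes>\<^sub>M lebesgue :: ('a \<times> 'a) measure) \<rightarrow>\<^sub>M lebesgue" by (rule measurable_fst)
    have f2: "(\<lambda>p. snd p) \<in> (lebesgue \<Otimes>\<^sub>M lebesgue :: ('a \<times> 'a) measure) \<rightarrow>\<^sub>M lebesgue" by (rule measurable_snd)
    note [measurable] = measurable_compose[OF f1 id] measurable_compose[OF f2 id] measurable_compose[OF f1 bm]
      measurable_compose[OF f2 bm] measurable_compose[OF f2 fm]
    have "(\<lambda>p. ennreal (\<bar>b (fst p) - b (snd p)\<bar> * \<bar>f (snd p)\<bar>) * (if dist (fst p) (snd p) < t then 1 else 0)) \<in> borel_measurable (lebesgue \<Otimes>\<^sub>M lebesgue)"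
      by measurable
    then have "(\<lambda>x. \<integral>\<^sup>+y. ennreal (\<bar>b x - b y\<bar> * \<bar>f y\<bar>) * (if dist x y < t then 1 else 0) \<partial>lebesgue) \<in> borel_measurable lebesgue"
      by (intro borel_measurable_nn_integral) (simp add: split_beta')
    moreover have "J t x = (\<integral>\<^sup>+y. ennreal (\<bar>b x - b y\<bar> * \<bar>f y\<bar>) * (if dist x y < t then 1 else 0) \<partial>lebesgue)" for x
      unfolding J_def by (intro nn_integral_cong) (simp add: indicator_def)
    ultimately show ?thesis by (simp cong: measurable_cong)
  qed
  have F_meas: "F t \<in> borel_measurable lebesgue" if "0 < t" for t
  proof -
    have "F t = (\<lambda>x. ennreal ((?v * t ^ DIM('a)) powr ?e) * J t x)"
      using that by (simp add: F_def fun_eq_iff content_ball)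
    then show ?thesis using J_meas by simp
  qed
  have "F t x \<le> (SUP s\<in>\<rat> \<inter> {0<..}. F s x)" if t: "0 < t" for t x
  proof -
    \<comment> \<open>Dyadic rationals increasing to \<open>t\<close> from below; the first ones may
      vanish, in which case their ball is empty.\<close>
    define s where "s i = (real_of_int \<lceil>2 ^ i * t\<rceil> - 1) / 2 ^ i" for i :: nat
    have s_less: "s i < t" for i
    proof -
      have "real_of_int \<lceil>2 ^ i * t\<rceil> - 1 < 2 ^ i * t" by linarith
      then show ?thesis by (simp add: s_def field_simps)
    qed
    have s_ge: "t - 1 / 2 ^ i \<le> s i" for i
    proof -
      have "2 ^ i * t - 1 \<le> real_of_int \<lceil>2 ^ i * t\<rceil> - 1" by linarith
      then show ?thesis by (simp add: s_def field_simps)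
    qed
    have s_inc: "s i \<le> s (Suc i)" for i
    proof -
      have "real_of_int (2 * \<lceil>2 ^ i * t\<rceil> - 2) < 2 * (2 ^ i * t)" by linarith
      then have "2 * \<lceil>2 ^ i * t\<rceil> - 2 < \<lceil>2 * (2 ^ i * t)\<rceil>" by (subst less_ceiling_iff)
      then have "real_of_int (2 * \<lceil>2 ^ i * t\<rceil> - 1) \<le> real_of_int \<lceil>2 * (2 ^ i * t)\<rceil>" by (intro of_int_le_iff[THEN iffD2]) simp
      then have le: "2 * (real_of_int \<lceil>2 ^ i * t\<rceil> - 1) \<le> real_of_int \<lceil>2 * (2 ^ i * t)\<rceil> - 1" by simp
      have "s i = 2 * (real_of_int \<lceil>2 ^ i * t\<rceil> - 1) / 2 ^ Suc i"
        by (simp only: s_def power_Suc mult_divide_mult_cancel_left_if) simp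
      also have "... \<le> (real_of_int \<lceil>2 * (2 ^ i * t)\<rceil> - 1) / 2 ^ Suc i" using le by (rule divide_right_mono) simp
      also have "... = s (Suc i)" by (simp only: s_def power_Suc mult.assoc)
      finally show ?thesis .
    qed
    have rat: "s i \<in> \<rat>" for i by (simp add: s_def)
    let ?w = "ennreal (vol x t powr ?e)"
    have Un: "ball x t = (\<Union>i. ball x (s i))"
    proof (intro set_eqI iffI)
      fix y assume "y \<in> ball x t"
      then have "0 < t - dist x y" by simp
      then obtain i where "(1 / 2) ^ i < t - dist x y"
        using real_arch_pow_inv[of "t - dist x y" "1 / 2"] by auto
      then have "dist x y < s i" using s_ge[of i] by (simp add: power_divide)
      then show "y \<in> (\<Union>i. ball x (s i))" by auto
    next
      fix y assume "y \<in> (\<Union>i. ball x (s i))"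
      then show "y \<in> ball x t" using s_less by (auto intro: less_trans)
    qed
    have ind: "indicator (ball x t) y = (SUP i. indicator (ball x (s i)) y :: ennreal)" for y
    proof (rule antisym)
      show "(SUP i. indicator (ball x (s i)) y :: ennreal) \<le> indicator (ball x t) y"
        unfolding Un by (intro SUP_least) (auto simp: indicator_def)
      show "indicator (ball x t) y \<le> (SUP i. indicator (ball x (s i)) y :: ennreal)"
      proof (cases "y \<in> ball x t")
        case True
        then obtain i where "y \<in> ball x (s i)" unfolding Un by blast
        then show ?thesis by (intro SUP_upper2[of i]) (auto simp: indicator_def)
      qed simp
    qed
    have "J t x = (\<integral>\<^sup>+y. (SUP i. ennreal (\<bar>b x - b y\<bar> * \<bar>f y\<bar>) * indicator (ball x (s i)) y) \<partial>lebesgue)"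
      unfolding J_def by (simp only: ind SUP_mult_left_ennreal)
    also have "... = (SUP i. J (s i) x)"
      unfolding J_def
    proof (rule nn_integral_monotone_convergence_SUP)
      show "incseq (\<lambda>i y. ennreal (\<bar>b x - b y\<bar> * \<bar>f y\<bar>) * indicator (ball x (s i)) y)"
      proof (intro incseq_SucI le_funI mult_left_mono)
        fix i y
        show "indicator (ball x (s i)) y \<le> (indicator (ball x (s (Suc i))) y :: ennreal)"
          using s_inc[of i] by (auto simp: indicator_def)
      qed simp
      fix i
      note [measurable] = bm fm
      show "(\<lambda>y. ennreal (\<bar>b x - b y\<bar> * \<bar>f y\<bar>) * indicator (ball x (s i)) y) \<in> borel_measurable lebesgue" by measurable
    qed
    finally have "F t x = (SUP i. ?w * J (s i) x)" by (simp add: F_def SUP_mult_left_ennreal)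
    also have "... \<le> (SUP s\<in>\<rat> \<inter> {0<..}. F s x)"
    proof (rule SUP_least)
      fix i
      show "?w * J (s i) x \<le> (SUP s\<in>\<rat> \<inter> {0<..}. F s x)"
      proof (cases "0 < s i")
        case True
        have "?e \<le> 0" using \<alpha> by (simp add: field_simps)
        then have "vol x t powr ?e \<le> vol x (s i) powr ?e"
          using True t s_less[of i] measure_ball_pos[OF True, of x]
          by (intro powr_mono2') (auto simp: content_ball intro!: mult_left_mono power_mono)
        then have "?w * J (s i) x \<le> F (s i) x" unfolding F_def by (intro mult_right_mono ennreal_leI) auto
        also have "... \<le> (SUP s\<in>\<rat> \<inter> {0<..}. F s x)" using True rat by (intro SUP_upper) auto
        finally show ?thesis .
      next
        case False
        then have "J (s i) x = 0" by (simp add: J_def ball_empty)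
        then show ?thesis by simp
      qed
    qed
    finally show ?thesis .
  qed
  then have "frac_max_comm b \<alpha> f x = (SUP s\<in>\<rat> \<inter> {0<..}. F s x)" for x
    unfolding frac_max_comm_def F_def[symmetric] J_def[symmetric]
    by (intro antisym SUP_least SUP_mono) (auto intro: SUP_upper)
  then have "frac_max_comm b \<alpha> f = (\<lambda>x. SUP s\<in>\<rat> \<inter> {0<..}. F s x)" by (rule ext)
  moreover have "(\<lambda>x. SUP s\<in>\<rat> \<inter> {0<..}. F s x) \<in> borel_measurable lebesgue"
    using F_meas countable_rat by (intro borel_measurable_SUP) auto
  ultimately show ?thesis by simp
qed

section \<open>Localisation to a fixed ball\<close>

lemma qmean_scale:
  assumes q: "0 < q" and k: "0 \<le> k" and g: "\<And>y. y \<in> ball x t \<Longrightarrow> f y = k * g y" "\<And>y. 0 \<le> g y"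
    and gm: "g \<in> borel_measurable lebesgue"
  shows "qmean q f x t = k * qmean q g x t"
proof -
  have [measurable]: "(\<lambda>y. g y powr q) \<in> borel_measurable lebesgue"
    by (rule powr_real_measurable) (use gm in auto)
  have "ball_int x t (\<lambda>y. ennreal (f y powr q)) = (\<integral>\<^sup>+y. ennreal (k powr q) * (ennreal (g y powr q) * indicator (ball x t) y) \<partial>lebesgue)"
    using g k by (intro nn_integral_cong) (auto simp: indicator_def powr_mult ennreal_mult)
  also have "... = ennreal (k powr q) * ball_int x t (\<lambda>y. ennreal (g y powr q))"
    by (rule nn_integral_cmult) measurable
  finally have eq: "ball_int x t (\<lambda>y. ennreal (f y powr q)) = ennreal (k powr q) * ball_int x t (\<lambda>y. ennreal (g y powr q))" .
  let ?J = "enn2real (ball_int x t (\<lambda>y. ennreal (g y powr q)))" and ?B = "vol x t"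
  have "qmean q f x t = (k powr q * (?J / ?B)) powr (1 / q)"
    by (simp add: qmean_def eq enn2real_mult)
  also have "... = (k powr q) powr (1 / q) * (?J / ?B) powr (1 / q)"
    by (rule powr_mult)
  also have "(k powr q) powr (1 / q) = k" using q k by (simp add: powr_powr)
  finally show ?thesis by (simp add: qmean_def)
qed

text \<open>The hypothesis on \<open>A\<close> is the only form in which the Morrey norm and the
  condition on the weights enter. For \<open>t < r\<close> the function is cut off to
  \<open>ball x0 (2 * r)\<close> and normalised by its \<open>k\<close>, and
  \<open>global_bound\<close> applies. For \<open>t \<ge> r\<close> the hypothesis at radius
  \<open>2 * t\<close> absorbs both the mean of \<open>f\<close> and the logarithm of
  \<open>bmo_log\<close>, leaving only the oscillation \<open>Y\<close> on the fixed ball.\<close>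

lemma local_bound:
  fixes \<alpha> q :: real
  assumes Y1: "young_growth P1 \<rho>1 p1 I1" and Y2: "young_growth P2 \<rho>2 p2 I2"
    and I2: "\<And>t. 0 < t \<Longrightarrow> I2 t = I1 t * t powr (- \<alpha> / real DIM('a))" and \<alpha>: "0 \<le> \<alpha>"
    and q: "1 \<le> q" "2 powr q < \<rho>1"
  shows "\<exists>K\<ge>1. \<exists>L\<ge>1. \<forall>(b :: 'a::euclidean_space \<Rightarrow> real) \<beta> f x0 r A. bmo_le b \<beta> \<longrightarrow> f \<in> borel_measurable lebesgue \<longrightarrow> (\<forall>y. 0 \<le> f y) \<longrightarrow>
     0 < r \<longrightarrow> 0 < A \<longrightarrow>
     (\<forall>\<tau>>r. \<exists>k>0. (ball_int x0 \<tau> (\<lambda>y. ennreal (P1 (f y / k)))) \<le> 1 \<and> (1 + ln (\<tau> / r)) * I2 (1 / \<tau> ^ DIM('a)) * k \<le> A) \<longrightarrow>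
     (\<exists>W. W \<in> borel_measurable lebesgue \<and> (ball_int x0 r W) \<le> ennreal L \<and>
       (\<forall>x\<in>ball x0 r. \<forall>t>0. (ball_int x t (\<lambda>y. ennreal (f y powr q))) < \<infinity> \<and>
         ennreal (P2 (I2 (1 / r ^ DIM('a)) / (K * A) * (osc_mean \<alpha> q b \<beta> f x t))) \<le> W x))"
proof -
  interpret Y1: young_growth P1 \<rho>1 p1 I1 by fact
  interpret Y2: young_growth P2 \<rho>2 p2 I2 by fact
  let ?n = "DIM('a)" and ?v = "unit_ball_vol (real DIM('a))"
  obtain K0 where K0: "K0 > 0" and glob: "\<And>(b :: 'a \<Rightarrow> real) \<beta> f. bmo_le b \<beta> \<Longrightarrow> f \<in> borel_measurable lebesgue \<Longrightarrow> (\<forall>y. 0 \<le> f y) \<Longrightarrow>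
     (\<integral>\<^sup>+y. ennreal (P1 (f y)) \<partial>lebesgue) \<le> 1 \<Longrightarrow>
     (\<exists>W. W \<in> borel_measurable lebesgue \<and> (\<integral>\<^sup>+x. W x \<partial>lebesgue) \<le> ennreal K0 \<and>
       (\<forall>x. \<forall>t>0. ennreal (P2 (osc_mean \<alpha> q b \<beta> f x t)) \<le> W x))"
    using global_bound[OF Y1 Y2 I2 \<alpha> q] by blast
  define p where "p = p2 + 1"
  have p: "1 \<le> p" by (simp add: p_def)
  obtain C where C: "C > 0" and mom: "\<And>(b :: 'a \<Rightarrow> real) \<beta> x r. bmo_le b \<beta> \<Longrightarrow> 0 < r \<Longrightarrow>
    (ball_int x r (\<lambda>y. ennreal (\<bar>b y - ball_avg b x r\<bar> ^ p))) \<le> ennreal (C * \<beta> ^ p * vol x r)"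
    using bmo_moment[OF p] by blast
  define c1 where "c1 = 1 + 2 powr q / ?v"
  have c1: "1 \<le> c1" by (simp add: c1_def)
  \<comment> \<open>The constant of \<open>bmo_log\<close>, plus 1 for the summand 1 in
    \<open>X\<close>.\<close>
  define D where "D = 2 * 4 ^ ?n + (1::real)"
  have D: "1 \<le> D" by (simp add: D_def)
  define K where "K = 2 ^ ?n * c1 * D"
  have K2: "2 ^ ?n \<le> K"
  proof -
    have "2 ^ ?n * 1 * 1 \<le> 2 ^ ?n * c1 * D" using c1 D by (intro mult_mono) auto
    then show ?thesis by (simp add: K_def)
  qed
  have "(1::real) \<le> 2 ^ ?n" by simp
  with K2 have K1: "1 \<le> K" by linarith
  \<comment> \<open>\<open>K0\<close> bounds the integral of \<open>W1\<close>, the last term that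
    of \<open>W2\<close> over the ball; the leading 1 ensures \<open>1 \<le> L\<close>.\<close>
  define L where "L = 1 + K0 + 4 ^ p * (C + 1) * ?v"
  have vpos: "0 < ?v" by simp
  have L1: "1 \<le> L" using K0 C vpos by (simp add: L_def less_imp_le)
  show ?thesis
  proof (rule exI[of _ K], intro conjI K1, rule exI[of _ L], intro conjI L1 allI impI)
    fix b f :: "'a \<Rightarrow> real" and \<beta> r A :: real and x0 :: 'a
    assume b: "bmo_le b \<beta>" and fm: "f \<in> borel_measurable lebesgue" and "\<forall>y. 0 \<le> f y" and r: "0 < r" and A: "0 < A"
      and k_ex: "\<forall>\<tau>>r. \<exists>k>0. (ball_int x0 \<tau> (\<lambda>y. ennreal (P1 (f y / k)))) \<le> 1 \<and> (1 + ln (\<tau> / r)) * I2 (1 / \<tau> ^ ?n) * k \<le> A"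
    then have f: "\<And>y. 0 \<le> f y" by blast
    have \<beta>: "\<beta> > 0" using bmo_leD(1)[OF b] .
    note bm [measurable] = locally_integrable_measurable[OF bmo_leD(2)[OF b]]
    define s where "s = I2 (1 / r ^ ?n)"
    have s: "0 < s" unfolding s_def using r by (intro Y2.inv_pos) auto
    define c where "c x t = t powr \<alpha> * qmean q f x t" for x t
    define X where "X x t = \<bar>b x - ball_avg b x t\<bar> / \<beta> + 1" for x t
    have X: "1 \<le> X x t" for x t using \<beta> by (simp add: X_def)
    define g where "g k \<tau> y = f y / k * indicator (ball x0 \<tau>) y" for k \<tau> y
    have gm: "g k \<tau> \<in> borel_measurable lebesgue" for k \<tau> unfolding g_def using fm by measurable
    have g0: "0 \<le> g k \<tau> y" if "0 < k" for k \<tau> y using f that by (simp add: g_def)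
    have gI: "(\<integral>\<^sup>+y. ennreal (P1 (g k \<tau> y)) \<partial>lebesgue) = ball_int x0 \<tau> (\<lambda>y. ennreal (P1 (f y / k)))" for k \<tau>
      by (intro nn_integral_cong) (auto simp: g_def indicator_def Y1.zero)
    have fg: "f y = k * g k \<tau> y" if "y \<in> ball x0 \<tau>" "0 < k" for y k \<tau> using that by (simp add: g_def)
    have avg: "ball_int z t (\<lambda>y. ennreal (g k \<tau> y powr q)) \<le> ennreal ((c1 * I1 (1 / t ^ ?n)) powr q * vol z t)"
      if "0 < k" "(\<integral>\<^sup>+y. ennreal (P1 (g k \<tau> y)) \<partial>lebesgue) \<le> 1" "0 < t" for k \<tau> z t
    proof -
      have "ball_int z t (\<lambda>y. ennreal (P1 (g k \<tau> y))) \<le> 1"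
        by (rule order.trans[OF _ that(2)]) (auto intro!: nn_integral_mono simp: indicator_def)
      then show ?thesis unfolding c1_def using that g0 by (intro Y1.average_bound[OF q gm]) auto
    qed
    have g_fin: "ball_int z t (\<lambda>y. ennreal (g k \<tau> y powr q)) < \<infinity>"
      if "0 < k" "(\<integral>\<^sup>+y. ennreal (P1 (g k \<tau> y)) \<partial>lebesgue) \<le> 1" "0 < t" for k \<tau> z t
      using avg[OF that] by (rule le_less_trans) simp
    obtain k0 where k0: "0 < k0" "(\<integral>\<^sup>+y. ennreal (P1 (g k0 (2 * r) y)) \<partial>lebesgue) \<le> 1" "(1 + ln (2 * r / r)) * I2 (1 / (2 * r) ^ ?n) * k0 \<le> A"
      using k_ex[rule_format, of "2 * r"] r by (auto simp: gI)
    obtain W1 where W1: "W1 \<in> borel_measurable lebesgue" "(\<integral>\<^sup>+x. W1 x \<partial>lebesgue) \<le> ennreal K0"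
      "\<And>x t. 0 < t \<Longrightarrow> ennreal (P2 (osc_mean \<alpha> q b \<beta> (g k0 (2 * r)) x t)) \<le> W1 x"
      using glob[OF b gm _ k0(2)] g0[OF k0(1)] by blast
    define Y where "Y x = \<bar>b x - ball_avg b x0 r\<bar> / \<beta>" for x
    have Y0: "0 \<le> Y x" for x using \<beta> by (simp add: Y_def)
    have Ym [measurable]: "Y \<in> borel_measurable lebesgue" unfolding Y_def by measurable
    define W2 where "W2 x = ennreal (4 ^ p / r ^ ?n) * (ennreal (Y x ^ p) + 1)" for x
    have W2m: "W2 \<in> borel_measurable lebesgue" unfolding W2_def by measurable
    have small: "ennreal (P2 (s / (K * A) * (c x t * X x t))) \<le> W1 x" if x: "x \<in> ball x0 r" and t: "0 < t" "t < r" for x t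
    proof -
      have sub: "ball x t \<subseteq> ball x0 (2 * r)" using x t by (intro ball_subset_ballI) (simp add: dist_commute)
      have "qmean q f x t = k0 * qmean q (g k0 (2 * r)) x t"
        using q k0 sub fg g0 by (intro qmean_scale gm) auto
      then have c: "c x t = k0 * (t powr \<alpha> * qmean q (g k0 (2 * r)) x t)" by (simp add: c_def)
      \<comment> \<open>The hypothesis is used at radius \<open>2 * r\<close>; returning to the
        normalisation at \<open>r\<close> costs \<open>2 ^ n\<close> by
        \<open>inv_scale\<close>.\<close>
      have "s \<le> 2 ^ ?n * I2 (1 / (2 * r) ^ ?n)"
        using Y2.inv_scale[of "2 ^ ?n" "1 / (2 * r) ^ ?n"] r by (simp add: s_def power_mult_distrib)
      also have "... * k0 \<le> 2 ^ ?n * ((1 + ln (2 * r / r)) * I2 (1 / (2 * r) ^ ?n) * k0)"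
        using r k0(1) Y2.inv_pos[of "1 / (2 * r) ^ ?n"] by (simp add: mult_right_mono)
      also have "... \<le> 2 ^ ?n * A" using k0(3) by (intro mult_left_mono) auto
      also have "... \<le> K * A" using K2 A by (intro mult_right_mono) auto
      finally have "s * k0 \<le> K * A" using k0 by (simp add: mult_right_mono)
      then have sk: "s * k0 / (K * A) \<le> 1" using K1 A by simp
      have "s / (K * A) * (c x t * X x t) = (s * k0 / (K * A)) * (t powr \<alpha> * qmean q (g k0 (2 * r)) x t * X x t)"
        by (simp add: c)
      also have "... \<le> 1 * (t powr \<alpha> * qmean q (g k0 (2 * r)) x t * X x t)"
        using sk X[of x t] qmean_nonneg[of q "g k0 (2 * r)" x t] by (intro mult_right_mono) auto
      finally have "P2 (s / (K * A) * (c x t * X x t)) \<le> P2 (t powr \<alpha> * qmean q (g k0 (2 * r)) x t * X x t)"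
        using s K1 A X[of x t] qmean_nonneg[of q f x t] by (intro Y2.mono) (auto simp: c_def)
      then have "ennreal (P2 (s / (K * A) * (c x t * X x t))) \<le> ennreal (P2 (t powr \<alpha> * qmean q (g k0 (2 * r)) x t * X x t))"
        by (rule ennreal_leI)
      also have "... \<le> W1 x" unfolding X_def by (rule W1(3)[OF t(1)])
      finally show ?thesis .
    qed
    have large: "ball_int x t (\<lambda>y. ennreal (f y powr q)) < \<infinity> \<and> ennreal (P2 (s / (K * A) * (c x t * X x t))) \<le> W2 x"
      if x: "x \<in> ball x0 r" and t: "r \<le> t" for x t
    proof -
      have t0: "0 < t" using r t by simp
      have sub: "ball x t \<subseteq> ball x0 (2 * t)" using x t by (intro ball_subset_ballI) (simp add: dist_commute)
      have "r < 2 * t" using r t by simp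
      then obtain k where k: "0 < k" "(\<integral>\<^sup>+y. ennreal (P1 (g k (2 * t) y)) \<partial>lebesgue) \<le> 1" "(1 + ln (2 * t / r)) * I2 (1 / (2 * t) ^ ?n) * k \<le> A"
        using k_ex by (auto simp: gI)
      let ?g = "g k (2 * t)" and ?I = "1 / (2 * t) ^ ?n"
      have Ipos: "0 < I1 ?I" "0 < I2 ?I" using t0 by (auto intro!: Y1.inv_pos Y2.inv_pos)
      have fin2: "ball_int x0 (2 * t) (\<lambda>y. ennreal (f y powr q)) < \<infinity>"
      proof -
        have "(\<lambda>y. ?g y powr q) \<in> borel_measurable lebesgue"
          by (rule powr_real_measurable) (use gm in auto)
        then have gq: "(\<lambda>y. ennreal (?g y powr q) * indicator (ball x0 (2 * t)) y) \<in> borel_measurable lebesgue" by measurable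
        have "ball_int x0 (2 * t) (\<lambda>y. ennreal (f y powr q))
          = (\<integral>\<^sup>+y. ennreal (k powr q) * (ennreal (?g y powr q) * indicator (ball x0 (2 * t)) y) \<partial>lebesgue)"
          using k(1) g0[OF k(1)] by (intro nn_integral_cong) (auto simp: indicator_def fg[of _ "2 * t" k] powr_mult ennreal_mult)
        also have "... = ennreal (k powr q) * ball_int x0 (2 * t) (\<lambda>y. ennreal (?g y powr q))"
          by (rule nn_integral_cmult[OF gq])
        also have "... < \<infinity>" using g_fin[OF k(1,2), of "2 * t" x0] t0 by (simp add: ennreal_mult_less_top)
        finally show ?thesis .
      qed
      have fin: "ball_int x t (\<lambda>y. ennreal (f y powr q)) < \<infinity>"
        using nn_integral_mono_set[OF sub] fin2 by (rule le_less_trans)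
      have "qmean q f x t \<le> 2 ^ ?n * qmean q f x0 (2 * t)"
        using q t0 sub fin2 by (intro qmean_enlarge) auto
      also have "qmean q f x0 (2 * t) = k * qmean q ?g x0 (2 * t)"
        using q k fg g0 by (intro qmean_scale gm) auto
      also have "qmean q ?g x0 (2 * t) \<le> c1 * I1 ?I"
        using q t0 c1 Ipos avg[OF k(1,2), of "2 * t" x0] by (intro qmean_le) auto
      finally have "qmean q f x t \<le> 2 ^ ?n * (k * (c1 * I1 ?I))" using k(1) by (simp add: mult_left_mono)
      then have "c x t \<le> (2 * t) powr \<alpha> * (2 ^ ?n * (k * (c1 * I1 ?I)))"
        unfolding c_def using \<alpha> t0 qmean_nonneg by (intro mult_mono powr_mono2) auto
      also have "... = 2 ^ ?n * c1 * (I2 ?I * k)"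
      proof -
        have "?I powr (- \<alpha> / real ?n) = ((2 * t) ^ ?n) powr (\<alpha> / real ?n)"
          using t0 by (simp add: powr_divide powr_minus_divide)
        also have "... = (2 * t) powr \<alpha>"
        proof -
          have "(z ^ ?n) powr (\<alpha> / real ?n) = z powr \<alpha>" if "0 < z" for z :: real
            using that by (simp add: powr_realpow[symmetric] powr_powr)
          from this[of "2 * t"] show ?thesis using t0 by linarith
        qed
        finally have "I2 ?I = I1 ?I * (2 * t) powr \<alpha>" using I2[of ?I] t0 by simp
        then show ?thesis by simp
      qed
      finally have c: "c x t \<le> 2 ^ ?n * c1 * (I2 ?I * k)" .
      let ?l = "1 + ln (2 * t / r)"
      have l: "1 \<le> ?l" using r t by simp
      have "X x t \<le> (Y x + 1) * (D * ?l)"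
      proof -
        have "\<bar>b x - ball_avg b x t\<bar> \<le> \<bar>b x - ball_avg b x0 r\<bar> + 2 * 4 ^ ?n * \<beta> * ?l"
          using bmo_log[OF b r t x] by linarith
        then have "X x t \<le> (\<bar>b x - ball_avg b x0 r\<bar> + 2 * 4 ^ ?n * \<beta> * ?l) / \<beta> + 1"
          unfolding X_def using \<beta> by (intro add_right_mono divide_right_mono) auto
        also have "... = Y x * 1 + 2 * 4 ^ ?n * ?l + 1" using \<beta> by (simp add: Y_def field_simps)
        also have "... \<le> Y x * (D * ?l) + 2 * 4 ^ ?n * ?l + ?l"
          using Y0 D l mult_mono[of 1 D 1 ?l] by (intro add_mono mult_left_mono) auto
        also have "... = (Y x + 1) * (D * ?l)" by (simp only: D_def) (simp add: algebra_simps)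
        finally show ?thesis .
      qed
      then have "c x t * X x t \<le> (2 ^ ?n * c1 * (I2 ?I * k)) * ((Y x + 1) * (D * ?l))"
        using c X[of x t] qmean_nonneg Ipos k(1) c1 by (intro mult_mono) (auto simp: c_def)
      also have "... = K * (Y x + 1) * (?l * I2 ?I * k)" by (simp only: K_def mult_ac)
      also have "... \<le> K * (Y x + 1) * A" using k(3) K1 Y0[of x] by (intro mult_left_mono) auto
      finally have "s / (K * A) * (c x t * X x t) \<le> s / (K * A) * (K * (Y x + 1) * A)"
        using s K1 A by (intro mult_left_mono) auto
      also have "... = (Y x + 1) * s" using K1 A by (simp add: field_simps)
      finally have "P2 (s / (K * A) * (c x t * X x t)) \<le> P2 ((Y x + 1) * s)"
        using s K1 A X[of x t] qmean_nonneg[of q f x t] by (intro Y2.mono) (auto simp: c_def)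
      also have "... \<le> (2 * (Y x + 1)) ^ p2 * P2 s" using Y0[of x] s by (intro Y2.mult_upper) auto
      also have "... \<le> (2 * (Y x + 1)) ^ p * P2 s"
        using Y0[of x] Y2.nonneg[of s] s by (intro mult_right_mono power_increasing) (auto simp: p_def)
      also have "... = 2 ^ p * (Y x + 1) ^ p * P2 s" by (simp only: power_mult_distrib)
      also have "... \<le> 2 ^ p * (2 ^ p * (Y x ^ p + 1 ^ p)) * P2 s"
        using Y0[of x] Y2.nonneg[of s] s by (intro mult_right_mono mult_left_mono power_add_le) auto
      \<comment> \<open>\<open>P2 s\<close> is exactly \<open>1 / r ^ n\<close>, which cancels the
        volume of \<open>ball x0 r\<close> when \<open>W2\<close> is integrated.\<close>
      also have "... = 4 ^ p / r ^ ?n * (Y x ^ p + 1)"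
      proof -
        have "P2 s = 1 / r ^ ?n" unfolding s_def using r by (intro Y2.inv_right) auto
        moreover have "(2::real) ^ p * 2 ^ p = 4 ^ p" by (simp add: power_mult_distrib[symmetric])
        ultimately show ?thesis by (simp add: mult.assoc[symmetric])
      qed
      finally have "ennreal (P2 (s / (K * A) * (c x t * X x t))) \<le> ennreal (4 ^ p / r ^ ?n * (Y x ^ p + 1))" by (rule ennreal_leI)
      also have "... = W2 x"
      proof -
        have "ennreal (u * (v + 1)) = ennreal u * (ennreal v + 1)" if "0 \<le> u" "0 \<le> v" for u v :: real
          using that by (simp add: ennreal_mult ennreal_plus)
        from this[of "4 ^ p / r ^ ?n" "Y x ^ p"] show ?thesis using r Y0[of x] by (simp add: W2_def)
      qed
      finally show ?thesis using fin by simp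
    qed
    have I_W2: "ball_int x0 r W2 \<le> ennreal (4 ^ p * (C + 1) * ?v)"
    proof -
      let ?B = "vol x0 r"
      have "ball_int x0 r W2 = (\<integral>\<^sup>+x. ennreal (4 ^ p / r ^ ?n) * (ennreal (1 / \<beta> ^ p) * (ennreal (\<bar>b x - ball_avg b x0 r\<bar> ^ p) * indicator (ball x0 r) x) + indicator (ball x0 r) x) \<partial>lebesgue)"
        using \<beta> by (intro nn_integral_cong) (auto simp: W2_def Y_def indicator_def power_divide ennreal_mult[symmetric])
      also have "... = ennreal (4 ^ p / r ^ ?n) * (ennreal (1 / \<beta> ^ p) * ball_int x0 r (\<lambda>x. ennreal (\<bar>b x - ball_avg b x0 r\<bar> ^ p)) + ennreal ?B)"
        by (simp add: nn_integral_cmult nn_integral_add emeasure_ball_leb)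
      also have "... \<le> ennreal (4 ^ p / r ^ ?n) * (ennreal (1 / \<beta> ^ p) * ennreal (C * \<beta> ^ p * ?B) + ennreal ?B)"
        using mom[OF b r, of x0] by (intro mult_left_mono add_right_mono) auto
      also have "... = ennreal (4 ^ p / r ^ ?n * (1 / \<beta> ^ p * (C * \<beta> ^ p * ?B) + ?B))"
      proof -
        have "ennreal u * (ennreal v * ennreal w + ennreal z) = ennreal (u * (v * w + z))"
          if "0 \<le> u" "0 \<le> v" "0 \<le> w" "0 \<le> z" for u v w z :: real
          using that by (simp add: ennreal_mult ennreal_plus)
        then show ?thesis using r \<beta> C by simp
      qed
      also have "4 ^ p / r ^ ?n * (1 / \<beta> ^ p * (C * \<beta> ^ p * ?B) + ?B) = 4 ^ p * (C + 1) * ?v"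
        using r \<beta> by (simp add: content_ball field_simps)
      finally show ?thesis .
    qed
    show "\<exists>W. W \<in> borel_measurable lebesgue \<and> (ball_int x0 r W) \<le> ennreal L \<and>
       (\<forall>x\<in>ball x0 r. \<forall>t>0. (ball_int x t (\<lambda>y. ennreal (f y powr q))) < \<infinity> \<and>
         ennreal (P2 (I2 (1 / r ^ ?n) / (K * A) * (osc_mean \<alpha> q b \<beta> f x t))) \<le> W x)"
    proof (intro exI[of _ "\<lambda>x. W1 x + W2 x"] conjI ballI allI impI)
      show "(\<lambda>x. W1 x + W2 x) \<in> borel_measurable lebesgue" using W1(1) W2m by (rule borel_measurable_add)
      have "ball_int x0 r (\<lambda>x. (W1 x + W2 x)) = ball_int x0 r W1 + ball_int x0 r W2"
        using W1(1) W2m by (simp add: distrib_right nn_integral_add)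
      also have "... \<le> ennreal K0 + ennreal (4 ^ p * (C + 1) * ?v)"
      proof (intro add_mono I_W2)
        have "ball_int x0 r W1 \<le> (\<integral>\<^sup>+x. W1 x \<partial>lebesgue)"
          by (intro nn_integral_mono) (auto simp: indicator_def)
        with W1(2) show "ball_int x0 r W1 \<le> ennreal K0" by simp
      qed
      also have "... = ennreal (K0 + 4 ^ p * (C + 1) * ?v)" using K0 C by (intro ennreal_plus[symmetric]) auto
      also have "... \<le> ennreal L" by (intro ennreal_leI) (simp add: L_def)
      finally show "ball_int x0 r (\<lambda>x. (W1 x + W2 x)) \<le> ennreal L" .
    next
      fix x :: 'a and t :: real assume x: "x \<in> ball x0 r" and t: "0 < t"
      show "ball_int x t (\<lambda>y. ennreal (f y powr q)) < \<infinity>"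
      proof (rule le_less_trans)
        show "ball_int x t (\<lambda>y. ennreal (f y powr q)) \<le> ball_int x (max t r) (\<lambda>y. ennreal (f y powr q))"
          by (intro nn_integral_mono_set subset_ball) simp
        show "... < \<infinity>" using large[OF x, of "max t r"] by simp
      qed
      show "ennreal (P2 (I2 (1 / r ^ ?n) / (K * A) * (osc_mean \<alpha> q b \<beta> f x t))) \<le> W1 x + W2 x"
      proof (cases "t < r")
        case True
        from small[OF x t True] have "ennreal (P2 (s / (K * A) * (c x t * X x t))) \<le> W1 x + W2 x"
          by (rule order.trans) simp
        then show ?thesis by (simp only: s_def c_def X_def)
      next
        case False
        then have "ennreal (P2 (s / (K * A) * (c x t * X x t))) \<le> W2 x" using large[OF x, of t] by simp
        then have "ennreal (P2 (s / (K * A) * (c x t * X x t))) \<le> W1 x + W2 x"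
          by (rule order.trans) simp
        then show ?thesis by (simp only: s_def c_def X_def)
      qed
    qed
  qed
qed

section \<open>Luxemburg and Morrey norms in terms of modulars\<close>

lemma bmo_le_of_norm:
  fixes b :: "'a::euclidean_space \<Rightarrow> real"
  assumes b: "in_BMO b" and \<beta>: "0 < \<beta>" and le: "bmo_norm b \<le> ennreal \<beta>"
  shows "bmo_le b \<beta>"
  unfolding bmo_le_def
proof (intro conjI allI impI \<beta>)
  fix x :: 'a and r :: real assume r: "0 < r"
  let ?c = "ball_avg b x r" and ?B = "ball x r"
  show int: "set_integrable lebesgue ?B b" using b r by (simp add: in_BMO_def)
  have c: "set_integrable lebesgue ?B (\<lambda>_. ?c)"
    unfolding set_integrable_def by (intro integrable_scaleR_left integrable_real_indicator) (auto simp: emeasure_ball_leb)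
  have "set_integrable lebesgue ?B (\<lambda>y. b y - ?c)" using int c by (rule set_integral_diff)
  then have "set_integrable lebesgue ?B (\<lambda>y. \<bar>b y - ?c\<bar>)" by (rule set_integrable_abs)
  then have int': "integrable lebesgue (\<lambda>y. indicator ?B y *\<^sub>R \<bar>b y - ?c\<bar>)" by (simp add: set_integrable_def)
  have "(\<integral>\<^sup>+y\<in>?B. ennreal \<bar>b y - ?c\<bar> \<partial>lebesgue) = (\<integral>\<^sup>+y. ennreal (indicator ?B y *\<^sub>R \<bar>b y - ?c\<bar>) \<partial>lebesgue)"
    by (intro nn_integral_cong) (auto simp: indicator_def)
  also have "... = ennreal (LINT y:?B|lebesgue. \<bar>b y - ?c\<bar>)"
    unfolding set_lebesgue_integral_def by (rule nn_integral_eq_integral[OF int']) simp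
  finally have eq: "(\<integral>\<^sup>+y\<in>?B. ennreal \<bar>b y - ?c\<bar> \<partial>lebesgue) = ennreal (LINT y:?B|lebesgue. \<bar>b y - ?c\<bar>)" .
  have "ennreal ((LINT y:?B|lebesgue. \<bar>b y - ?c\<bar>) / measure lebesgue ?B) \<le> bmo_norm b"
    unfolding bmo_norm_def using r by (intro SUP_upper2[of "(x, r)"]) auto
  also note le
  finally have "(LINT y:?B|lebesgue. \<bar>b y - ?c\<bar>) / measure lebesgue ?B \<le> \<beta>" using \<beta> by simp
  then have "(LINT y:?B|lebesgue. \<bar>b y - ?c\<bar>) \<le> \<beta> * measure lebesgue ?B"
    using measure_ball_pos[OF r, of x] by (simp add: pos_divide_le_eq)
  then show "(\<integral>\<^sup>+y\<in>?B. ennreal \<bar>b y - ?c\<bar> \<partial>lebesgue) \<le> ennreal (\<beta> * measure lebesgue ?B)"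
    unfolding eq by (rule ennreal_leI)
qed

text \<open>The inverse carries the bound through the supremum: each \<open>z i\<close> is at most
  \<open>I w\<close>, hence so is \<open>T\<close>, which could a priori be infinite, and applying
  \<Phi> gives \<open>w\<close> back. The case \<open>w = 0\<close> is separate because
  \<open>I\<close> is controlled only at positive arguments.\<close>

lemma young_ext_SUP_le:
  assumes Y: "young_growth (\<lambda>t. enn2real (\<Phi> t)) \<rho> p I" and fin: "\<And>t. 0 \<le> t \<Longrightarrow> \<Phi> t < \<infinity>"
    and T: "T \<le> (SUP i\<in>S. ennreal (z i))" and z: "\<And>i. i \<in> S \<Longrightarrow> 0 \<le> z i"
    and W: "\<And>i. i \<in> S \<Longrightarrow> ennreal (enn2real (\<Phi> (z i))) \<le> W"
  shows "young_ext \<Phi> T \<le> W"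
proof (cases "W = \<infinity>")
  case False
  then obtain w where w: "W = ennreal w" "0 \<le> w" by (cases W) auto
  interpret young_growth "\<lambda>t. enn2real (\<Phi> t)" \<rho> p I by fact
  have \<Phi>: "\<Phi> t = ennreal (enn2real (\<Phi> t))" if "0 \<le> t" for t using fin[OF that] by simp
  have "T \<le> ennreal (if w = 0 then 0 else I w)"
  proof (rule order.trans[OF T SUP_least])
    fix i assume i: "i \<in> S"
    have le: "enn2real (\<Phi> (z i)) \<le> w" using W[OF i] w by simp
    show "ennreal (z i) \<le> ennreal (if w = 0 then 0 else I w)"
    proof (cases "w = 0")
      case True
      then have "\<not> 0 < z i" using pos[of "z i"] le by auto
      then show ?thesis using True by (simp add: ennreal_neg)
    next
      case False
      then show ?thesis using le z[OF i] w le_inv_iff[of "z i" w] by (auto intro!: ennreal_leI)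
    qed
  qed
  then obtain \<tau> where \<tau>: "T = ennreal \<tau>" "0 \<le> \<tau>" "\<tau> \<le> (if w = 0 then 0 else I w)"
    using w inv_pos[of w] by (cases T) (auto simp: top_unique split: if_splits)
  have "enn2real (\<Phi> \<tau>) \<le> w"
  proof (cases "w = 0")
    case True
    then show ?thesis using \<tau> zero by simp
  next
    case False
    then show ?thesis using \<tau> w le_inv_iff[of \<tau> w] by simp
  qed
  then have "\<Phi> \<tau> \<le> ennreal w" using \<Phi>[OF \<tau>(2)] by (metis ennreal_leI)
  then show ?thesis using \<tau> w by (simp add: young_ext_def)
qed simp

text \<open>Strictly above the norm some admissible \<open>c < k\<close> exists, so the infimum need
  not be attained.\<close>

lemma orlicz_norm_ball_less_modular:
  fixes f :: "'a::euclidean_space \<Rightarrow> real"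
  assumes Y: "young_growth (\<lambda>t. enn2real (\<Phi> t)) \<rho> p I" and fin: "\<And>t. 0 \<le> t \<Longrightarrow> \<Phi> t < \<infinity>"
    and less: "orlicz_norm_ball \<Phi> (\<lambda>y. ennreal \<bar>f y\<bar>) x r < ennreal k"
  shows "ball_int x r (\<lambda>y. ennreal (enn2real (\<Phi> (\<bar>f y\<bar> / k)))) \<le> 1"
proof -
  interpret young_growth "\<lambda>t. enn2real (\<Phi> t)" \<rho> p I by fact
  obtain c where c: "0 < c" "(\<integral>\<^sup>+y. young_ext \<Phi> (indicator (ball x r) y * ennreal \<bar>f y\<bar> / ennreal c) \<partial>lebesgue) \<le> 1" "ennreal c < ennreal k"
    using less unfolding orlicz_norm_ball_def orlicz_norm_def INF_less_iff by blast
  have ck: "c < k" using c by (simp add: ennreal_less_iff)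
  have "ball_int x r (\<lambda>y. ennreal (enn2real (\<Phi> (\<bar>f y\<bar> / k)))) \<le> (\<integral>\<^sup>+y. young_ext \<Phi> (indicator (ball x r) y * ennreal \<bar>f y\<bar> / ennreal c) \<partial>lebesgue)"
  proof (rule nn_integral_mono)
    fix y
    show "ennreal (enn2real (\<Phi> (\<bar>f y\<bar> / k))) * indicator (ball x r) y \<le> young_ext \<Phi> (indicator (ball x r) y * ennreal \<bar>f y\<bar> / ennreal c)"
    proof (cases "y \<in> ball x r")
      case True
      have "enn2real (\<Phi> (\<bar>f y\<bar> / k)) \<le> enn2real (\<Phi> (\<bar>f y\<bar> / c))"
        using c ck by (intro mono divide_left_mono) auto
      then have "ennreal (enn2real (\<Phi> (\<bar>f y\<bar> / k))) \<le> ennreal (enn2real (\<Phi> (\<bar>f y\<bar> / c)))" by (rule ennreal_leI)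
      also have "... = \<Phi> (\<bar>f y\<bar> / c)" using fin[of "\<bar>f y\<bar> / c"] c by simp
      also have "... = young_ext \<Phi> (indicator (ball x r) y * ennreal \<bar>f y\<bar> / ennreal c)"
        using True c by (simp add: young_ext_def divide_ennreal)
      finally show ?thesis using True by simp
    qed simp
  qed
  with c(2) show ?thesis by simp
qed

lemma AE_ex_of_positive:
  assumes "AE x in M. P x" "emeasure M (space M) \<noteq> 0"
  shows "\<exists>x\<in>space M. P x"
proof (rule ccontr)
  assume no: "\<not> (\<exists>x\<in>space M. P x)"
  have "AE x in M. False" using assms(1) AE_space[of M] by eventually_elim (use no in blast)
  then show False using assms(2) by (simp add: eventually_False ae_filter_eq_bot_iff)
qed

text \<open>A single radius \<open>s > \<tau>\<close> at which the quotient does not exceed its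
  essential supremum is enough: \<open>ball x s\<close> contains \<open>ball x \<tau>\<close>, and
  the norm there is at most \<open>N\<close> times the quotient. The factor 2 makes that bound
  strict.\<close>

lemma morrey_local:
  fixes f :: "'a::euclidean_space \<Rightarrow> real" and \<phi>1 \<phi>2 :: "'a \<Rightarrow> real \<Rightarrow> real"
  assumes Y1: "young_growth (\<lambda>t. enn2real (\<Phi> t)) \<rho>1 p1 (young_inv \<Phi>)" and fin: "\<And>t. 0 \<le> t \<Longrightarrow> \<Phi> t < \<infinity>"
    and Y2: "young_growth P2 \<rho>2 p2 (young_inv \<Psi>)"
    and \<phi>: "\<And>s. 0 < s \<Longrightarrow> 0 < \<phi>1 x s"
    and cond: "(SUP t\<in>{r<..}. ereal ((1 + ln (t / r)) * young_inv \<Psi> (1 / t ^ DIM('a)))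
          * esssup (lebesgue_on {t<..}) (\<lambda>s. ereal (\<phi>1 x s / young_inv \<Phi> (1 / s ^ DIM('a)))))
       \<le> ereal B"
    and N: "0 < N" "morrey_norm \<Phi> \<phi>1 (\<lambda>y. ennreal \<bar>f y\<bar>) \<le> ennreal N"
    and r: "0 < r" and \<tau>: "r < \<tau>"
  shows "\<exists>k>0. (ball_int x \<tau> (\<lambda>y. ennreal (enn2real (\<Phi> (\<bar>f y\<bar> / k))))) \<le> 1
    \<and> (1 + ln (\<tau> / r)) * young_inv \<Psi> (1 / \<tau> ^ DIM('a)) * k \<le> 2 * N * B"
proof -
  interpret Y1: young_growth "\<lambda>t. enn2real (\<Phi> t)" \<rho>1 p1 "young_inv \<Phi>" by fact
  interpret Y2: young_growth P2 \<rho>2 p2 "young_inv \<Psi>" by fact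
  let ?I1 = "young_inv \<Phi>" and ?n = "DIM('a)"
  define g where "g s = \<phi>1 x s / ?I1 (1 / s ^ ?n)" for s
  define E where "E = esssup (lebesgue_on {\<tau><..}) (\<lambda>s. ereal (g s))"
  define a where "a = (1 + ln (\<tau> / r)) * young_inv \<Psi> (1 / \<tau> ^ ?n)"
  have a: "0 \<le> a" unfolding a_def using r \<tau> Y2.inv_pos[of "1 / \<tau> ^ ?n"] by (intro mult_nonneg_nonneg add_nonneg_nonneg) auto
  have aE: "ereal a * E \<le> ereal B"
    unfolding a_def E_def g_def using \<tau> by (intro order.trans[OF SUP_upper cond]) simp
  have "emeasure (lebesgue_on {\<tau><..}) (space (lebesgue_on {\<tau><..})) \<noteq> 0"
  proof -
    have "emeasure lebesgue {\<tau><..<\<tau> + 1} \<le> emeasure lebesgue {\<tau><..}" by (intro emeasure_mono) auto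
    moreover have "emeasure lebesgue {\<tau><..<\<tau> + 1} = 1" by (simp add: emeasure_completion main_part_sets)
    ultimately show ?thesis by (auto simp: emeasure_restrict_space space_restrict_space)
  qed
  from AE_ex_of_positive[OF esssup_AE this, of "\<lambda>s. ereal (g s)"]
  obtain s where s: "\<tau> < s" "ereal (g s) \<le> E" by (auto simp: E_def space_restrict_space)
  have s0: "0 < s" using r \<tau> s by simp
  have I1: "0 < ?I1 (1 / s ^ ?n)" using s0 by (intro Y1.inv_pos) auto
  have gs: "0 < g s" unfolding g_def using \<phi>[OF s0] I1 by simp
  have "ereal a * ereal (g s) \<le> ereal a * E" using s(2) a by (intro ereal_mult_left_mono) auto
  with aE have ag: "a * g s \<le> B" by (metis order.trans ereal_less_eq(3) times_ereal.simps(1))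
  let ?norm = "orlicz_norm_ball \<Phi> (\<lambda>y. ennreal \<bar>f y\<bar>) x s"
  have "ennreal (1 / g s) * ?norm \<le> morrey_norm \<Phi> \<phi>1 (\<lambda>y. ennreal \<bar>f y\<bar>)"
    unfolding morrey_norm_def using s0 by (intro SUP_upper2[of "(x, s)"]) (auto simp: g_def)
  also note N(2)
  finally have "ennreal (g s) * (ennreal (1 / g s) * ?norm) \<le> ennreal (g s) * ennreal N" by (rule mult_left_mono) simp
  also have "ennreal (g s) * (ennreal (1 / g s) * ?norm) = ?norm"
    using gs by (simp add: mult.assoc[symmetric] ennreal_mult[symmetric])
  also have "ennreal (g s) * ennreal N = ennreal (g s * N)" using gs N by (simp add: ennreal_mult)
  also have "... < ennreal (2 * N * g s)" using gs N by (simp add: ennreal_less_iff)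
  finally have less: "?norm < ennreal (2 * N * g s)" .
  have "ball_int x s (\<lambda>y. ennreal (enn2real (\<Phi> (\<bar>f y\<bar> / (2 * N * g s))))) \<le> 1"
    by (rule orlicz_norm_ball_less_modular[OF Y1 _ less]) (rule fin)
  moreover have "ball_int x \<tau> (\<lambda>y. ennreal (enn2real (\<Phi> (\<bar>f y\<bar> / (2 * N * g s)))))
     \<le> ball_int x s (\<lambda>y. ennreal (enn2real (\<Phi> (\<bar>f y\<bar> / (2 * N * g s)))))"
    using s by (intro nn_integral_mono_set subset_ball) simp
  moreover have "a * (2 * N * g s) \<le> 2 * N * B" using mult_left_mono[OF ag, of "2 * N"] N by (simp add: mult_ac)
  ultimately show ?thesis using gs N unfolding a_def by (intro exI[of _ "2 * N * g s"]) auto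
qed

text \<open>Taking \<open>q\<close> conjugate to a natural number \<open>m\<close> means that only
  integer moments of \<open>b\<close> occur; for large \<open>m\<close> it is close enough to
  1.\<close>

lemma conjugate_exponent:
  assumes "2 < (\<rho>::real)"
  obtains m :: nat where "2 \<le> m" "1 \<le> real m / (real m - 1)" "2 powr (real m / (real m - 1)) < \<rho>"
proof -
  have "0 < log 2 \<rho> - 1" using assms by (simp add: less_log_iff)
  then obtain k where k: "1 / real (Suc k) < log 2 \<rho> - 1" by (metis nat_approx_posE)
  have eq: "real (k + 2) / (real (k + 2) - 1) = 1 + 1 / real (Suc k)" by (simp add: field_simps)
  have "1 + 1 / real (Suc k) < log 2 \<rho>" using k by simp
  then have "2 powr (real (k + 2) / (real (k + 2) - 1)) < \<rho>"
    unfolding eq using assms by (subst (asm) less_log_iff) auto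
  moreover have "1 \<le> real (k + 2) / (real (k + 2) - 1)" unfolding eq by simp
  ultimately show ?thesis by (intro that[of "k + 2"]) auto
qed

theorem theorem5p14:
  fixes \<alpha> :: real
    and \<Phi> \<Psi> :: "real \<Rightarrow> ennreal"
    and \<phi>1 \<phi>2 :: "'a::euclidean_space \<Rightarrow> real \<Rightarrow> real"
  assumes alpha: "0 \<le> \<alpha>" "\<alpha> < real DIM('a)"
    and Phi: "young_function \<Phi>"
    and Psi: "young_function \<Psi>"
    and Psi_inv: "\<forall>t>0. young_inv \<Psi> t = young_inv \<Phi> t * t powr (- \<alpha> / real DIM('a))"
    and Phi_idx: "young_indices_defined \<Phi>"
      "1 < young_lower_index \<Phi>" "young_lower_index \<Phi> \<le> young_upper_index \<Phi>"
      "young_upper_index \<Phi> < \<infinity>"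
    and Psi_idx: "young_indices_defined \<Psi>"
      "1 < young_lower_index \<Psi>" "young_lower_index \<Psi> \<le> young_upper_index \<Psi>"
      "young_upper_index \<Psi> < \<infinity>"
    and phi_pos: "\<forall>x. \<forall>r>0. 0 < \<phi>1 x r \<and> 0 < \<phi>2 x r"
    and phi_meas: "(\<lambda>p. \<phi>1 (fst p) (snd p)) \<in> borel_measurable (restrict_space borel (UNIV \<times> {0<..}))"
      "(\<lambda>p. \<phi>2 (fst p) (snd p)) \<in> borel_measurable (restrict_space borel (UNIV \<times> {0<..}))"
    and cond: "\<exists>C. \<forall>x. \<forall>r>0.
       (SUP t\<in>{r<..}. ereal ((1 + ln (t / r)) * young_inv \<Psi> (1 / t ^ DIM('a)))
          * esssup (lebesgue_on {t<..}) (\<lambda>s. ereal (\<phi>1 x s / young_inv \<Phi> (1 / s ^ DIM('a)))))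
       \<le> ereal (C * \<phi>2 x r)"
  shows "\<exists>C'>0. \<forall>b f. in_BMO b \<longrightarrow> f \<in> borel_measurable lebesgue \<longrightarrow>
            in_morrey \<Phi> \<phi>1 (\<lambda>y. ennreal \<bar>f y\<bar>) \<longrightarrow>
              in_morrey \<Psi> \<phi>2 (frac_max_comm b \<alpha> f)
            \<and> morrey_norm \<Psi> \<phi>2 (frac_max_comm b \<alpha> f)
                \<le> ennreal C' * bmo_norm b * morrey_norm \<Phi> \<phi>1 (\<lambda>y. ennreal \<bar>f y\<bar>)"
proof -
  let ?n = "DIM('a)" and ?v = "unit_ball_vol (real DIM('a))"
  obtain \<rho>1 p1 where Y1: "young_growth (\<lambda>t. enn2real (\<Phi> t)) \<rho>1 p1 (young_inv \<Phi>)"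
    using young_function_growth[OF Phi Phi_idx(1,2,4)] by blast
  obtain \<rho>2 p2 where Y2: "young_growth (\<lambda>t. enn2real (\<Psi> t)) \<rho>2 p2 (young_inv \<Psi>)"
    using young_function_growth[OF Psi Psi_idx(1,2,4)] by blast
  interpret Y1: young_growth "\<lambda>t. enn2real (\<Phi> t)" \<rho>1 p1 "young_inv \<Phi>" by fact
  interpret Y2: young_growth "\<lambda>t. enn2real (\<Psi> t)" \<rho>2 p2 "young_inv \<Psi>" by fact
  have fin1: "\<Phi> t < \<infinity>" if "0 \<le> t" for t
    using Phi Phi_idx(1) that by (cases "t = 0") (auto simp: young_function_def young_indices_defined_def)
  have fin2: "\<Psi> t < \<infinity>" if "0 \<le> t" for t
    using Psi Psi_idx(1) that by (cases "t = 0") (auto simp: young_function_def young_indices_defined_def)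
  have I2: "young_inv \<Psi> t = young_inv \<Phi> t * t powr (- \<alpha> / real ?n)" if "0 < t" for t
    using Psi_inv that by simp
  obtain m :: nat where m: "2 \<le> m" "1 \<le> real m / (real m - 1)" "2 powr (real m / (real m - 1)) < \<rho>1"
    using conjugate_exponent[OF Y1.rho] .
  define q where "q = real m / (real m - 1)"
  have q: "1 \<le> q" "2 powr q < \<rho>1" using m by (simp_all add: q_def)
  obtain C where C: "C > 0" and mom: "\<And>(b :: 'a \<Rightarrow> real) \<beta> x r. bmo_le b \<beta> \<Longrightarrow> 0 < r \<Longrightarrow>
    (ball_int x r (\<lambda>y. ennreal (\<bar>b y - ball_avg b x r\<bar> ^ m))) \<le> ennreal (C * \<beta> ^ m * vol x r)"
    using bmo_moment[of m] m(1) by force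
  obtain K L where K: "1 \<le> K" and L: "1 \<le> L" and loc: "\<And>(b :: 'a \<Rightarrow> real) \<beta> f x0 r A. bmo_le b \<beta> \<Longrightarrow> f \<in> borel_measurable lebesgue \<Longrightarrow> (\<forall>y. 0 \<le> f y) \<Longrightarrow>
     0 < r \<Longrightarrow> 0 < A \<Longrightarrow>
     (\<forall>\<tau>>r. \<exists>k>0. (ball_int x0 \<tau> (\<lambda>y. ennreal (enn2real (\<Phi> (f y / k))))) \<le> 1 \<and> (1 + ln (\<tau> / r)) * young_inv \<Psi> (1 / \<tau> ^ DIM('a)) * k \<le> A) \<Longrightarrow>
     (\<exists>W. W \<in> borel_measurable lebesgue \<and> (ball_int x0 r W) \<le> ennreal L \<and>
       (\<forall>x\<in>ball x0 r. \<forall>t>0. (ball_int x t (\<lambda>y. ennreal (f y powr q))) < \<infinity> \<and>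
         ennreal (enn2real (\<Psi> (young_inv \<Psi> (1 / r ^ DIM('a)) / (K * A) * (osc_mean \<alpha> q b \<beta> f x t)))) \<le> W x))"
    using local_bound[OF Y1 Y2 I2 alpha(1) q] by blast
  obtain C0 where C0: "\<And>x r. 0 < r \<Longrightarrow>
       (SUP t\<in>{r<..}. ereal ((1 + ln (t / r)) * young_inv \<Psi> (1 / t ^ DIM('a)))
          * esssup (lebesgue_on {t<..}) (\<lambda>s. ereal (\<phi>1 x s / young_inv \<Phi> (1 / s ^ DIM('a)))))
       \<le> ereal (C0 * \<phi>2 x r)"
    using cond by blast
  \<comment> \<open>The constant of the hypothesis carries no sign, whereas \<open>A\<close> has to
    be positive.\<close>
  define C1 where "C1 = max C0 1"
  define C5 where "C5 = ?v powr (\<alpha> / real ?n) * (3 + C)"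
  have C5: "0 < C5"
    using C unit_ball_vol_pos[of "real ?n", THEN less_imp_neq, THEN not_sym] by (simp add: C5_def)
  \<comment> \<open>The 2 stems from \<open>morrey_local\<close>, \<open>C5\<close> from
    \<open>comm_term\<close>, \<open>K\<close> from \<open>local_bound\<close>; \<open>L\<close>
    brings the modular bound down to 1.\<close>
  define C' where "C' = 2 * L * C5 * K * C1"
  have C': "0 < C'" using K L C5 by (simp add: C'_def C1_def)
  have ball_bound: "ennreal (young_inv \<Psi> (1 / r ^ ?n) / \<phi>2 x0 r) * orlicz_norm_ball \<Psi> (frac_max_comm b \<alpha> f) x0 r \<le> ennreal (C' * \<beta> * N)"
    if b: "in_BMO b" and fm: "f \<in> borel_measurable lebesgue"
      and \<beta>: "0 < \<beta>" "bmo_norm b \<le> ennreal \<beta>" and N: "0 < N" "morrey_norm \<Phi> \<phi>1 (\<lambda>y. ennreal \<bar>f y\<bar>) \<le> ennreal N" and r: "0 < r"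
    for b f :: "'a \<Rightarrow> real" and \<beta> N r :: real and x0 :: 'a
  proof -
    note bl = bmo_le_of_norm[OF b \<beta>]
    note bm = locally_integrable_measurable[OF bmo_leD(2)[OF bl]]
    have \<phi>2: "0 < \<phi>2 x0 r" using phi_pos r by blast
    define A where "A = 2 * N * (C1 * \<phi>2 x0 r)"
    have A: "0 < A" using N \<phi>2 by (simp add: A_def C1_def)
    have condC1: "(SUP t\<in>{r<..}. ereal ((1 + ln (t / r)) * young_inv \<Psi> (1 / t ^ DIM('a)))
          * esssup (lebesgue_on {t<..}) (\<lambda>s. ereal (\<phi>1 x0 s / young_inv \<Phi> (1 / s ^ DIM('a)))))
       \<le> ereal (C1 * \<phi>2 x0 r)"
    proof (rule order.trans[OF C0[OF r, of x0]])
      have "C0 * \<phi>2 x0 r \<le> C1 * \<phi>2 x0 r" using \<phi>2 by (intro mult_right_mono) (auto simp: C1_def)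
      then show "ereal (C0 * \<phi>2 x0 r) \<le> ereal (C1 * \<phi>2 x0 r)" by simp
    qed
    have "\<forall>\<tau>>r. \<exists>k>0. (ball_int x0 \<tau> (\<lambda>y. ennreal (enn2real (\<Phi> (\<bar>f y\<bar> / k))))) \<le> 1 \<and> (1 + ln (\<tau> / r)) * young_inv \<Psi> (1 / \<tau> ^ DIM('a)) * k \<le> A"
      unfolding A_def using morrey_local[OF Y1 fin1 Y2 _ condC1 N r] phi_pos by blast
    from loc[OF bl _ _ r A this] fm
    obtain W where W: "W \<in> borel_measurable lebesgue" "ball_int x0 r W \<le> ennreal L"
      "\<And>x t. x \<in> ball x0 r \<Longrightarrow> 0 < t \<Longrightarrow> (ball_int x t (\<lambda>y. ennreal (\<bar>f y\<bar> powr q))) < \<infinity>"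
      "\<And>x t. x \<in> ball x0 r \<Longrightarrow> 0 < t \<Longrightarrow> ennreal (enn2real (\<Psi> (young_inv \<Psi> (1 / r ^ DIM('a)) / (K * A) * (osc_mean \<alpha> q b \<beta> (\<lambda>y. \<bar>f y\<bar>) x t)))) \<le> W x"
      by auto
    define s where "s = young_inv \<Psi> (1 / r ^ ?n)"
    have s: "0 < s" unfolding s_def using r by (intro Y2.inv_pos) auto
    define Z where "Z x t = osc_mean \<alpha> q b \<beta> (\<lambda>y. \<bar>f y\<bar>) x t" for x t
    have Z0: "0 \<le> Z x t" for x t using \<beta> qmean_nonneg[of q "\<lambda>y. \<bar>f y\<bar>" x t] by (simp add: Z_def)
    \<comment> \<open>Chosen so that \<open>C5 * \<beta> * Z x t = \<Lambda> * ?z t\<close>: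
      dividing by \<Lambda> leaves the argument controlled by \<open>W\<close>, shrunk by
      \<open>1 / L\<close>, and \<open>contract\<close> turns that shrinking into a factor
      \<open>1 / L\<close> on the modular.\<close>
    define \<Lambda> where "\<Lambda> = L * (C5 * \<beta>) * (K * A) / s"
    have \<Lambda>: "0 < \<Lambda>" using L C5 \<beta> K A s by (simp add: \<Lambda>_def)
    have pw: "young_ext \<Psi> (frac_max_comm b \<alpha> f x / ennreal \<Lambda>) \<le> ennreal (1 / L) * W x" if x: "x \<in> ball x0 r" for x
    proof (rule young_ext_SUP_le[OF Y2 fin2])
      let ?z = "\<lambda>t. (1 / L) * (s / (K * A) * Z x t)"
      have "frac_max_comm b \<alpha> f x \<le> (SUP t\<in>{0<..}. ennreal \<Lambda> * ennreal (?z t))"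
        unfolding frac_max_comm_def
      proof (rule SUP_mono)
        fix t :: real assume "t \<in> {0<..}"
        then have t: "0 < t" by simp
        have "ennreal (vol x t powr (-1 + \<alpha> / real DIM('a))) * ball_int x t (\<lambda>y. ennreal (\<bar>b x - b y\<bar> * \<bar>f y\<bar>))
           \<le> ennreal (C5 * \<beta> * Z x t)"
          unfolding C5_def Z_def using C fm bm
          by (intro comm_term[OF m(1) q_def \<beta>(1) _ t _ _ _ W(3)[OF x t] mom[OF bl t]]) auto
        also have "C5 * \<beta> * Z x t = \<Lambda> * ?z t" using L K A s by (simp add: \<Lambda>_def)
        also have "ennreal (\<Lambda> * ?z t) = ennreal \<Lambda> * ennreal (?z t)"
          using \<Lambda> L K A s Z0[of x t] by (intro ennreal_mult) auto
        finally show "\<exists>t'\<in>{0<..}. ennreal (vol x t powr (-1 + \<alpha> / real DIM('a))) * ball_int x t (\<lambda>y. ennreal (\<bar>b x - b y\<bar> * \<bar>f y\<bar>)) \<le> ennreal \<Lambda> * ennreal (?z t')"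
          using t by auto
      qed
      also have "... = ennreal \<Lambda> * (SUP t\<in>{0<..}. ennreal (?z t))"
        by (rule SUP_mult_left_ennreal[symmetric])
      finally have "frac_max_comm b \<alpha> f x / ennreal \<Lambda> \<le> (ennreal \<Lambda> * (SUP t\<in>{0<..}. ennreal (?z t))) / ennreal \<Lambda>"
        by (rule divide_right_mono_ennreal)
      also have "... = (SUP t\<in>{0<..}. ennreal (?z t))"
        by (subst mult.commute, rule ennreal_mult_divide_eq) (use \<Lambda> in \<open>auto simp: ennreal_eq_0_iff\<close>)
      finally show "frac_max_comm b \<alpha> f x / ennreal \<Lambda> \<le> (SUP t\<in>{0<..}. ennreal (?z t))" .
      fix t :: real assume "t \<in> {0<..}"
      then have t: "0 < t" by simp
      have z0: "0 \<le> s / (K * A) * Z x t" using s K A Z0[of x t] by simp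
      then show "0 \<le> ?z t" using L by (intro mult_nonneg_nonneg[of "1 / L"]) simp_all
      have "enn2real (\<Psi> (?z t)) \<le> (1 / L) * enn2real (\<Psi> (s / (K * A) * Z x t))"
        using L z0 by (intro Y2.contract) auto
      then have "ennreal (enn2real (\<Psi> (?z t))) \<le> ennreal (1 / L) * ennreal (enn2real (\<Psi> (s / (K * A) * Z x t)))"
        using L by (simp add: ennreal_mult[symmetric] ennreal_leI)
      also have "... \<le> ennreal (1 / L) * W x"
        using W(4)[OF x t] by (intro mult_left_mono) (auto simp: s_def Z_def)
      finally show "ennreal (enn2real (\<Psi> (?z t))) \<le> ennreal (1 / L) * W x" .
    qed
    have "(\<integral>\<^sup>+x. young_ext \<Psi> (indicator (ball x0 r) x * frac_max_comm b \<alpha> f x / ennreal \<Lambda>) \<partial>lebesgue)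
      \<le> (\<integral>\<^sup>+x. ennreal (1 / L) * (W x * indicator (ball x0 r) x) \<partial>lebesgue)"
    proof (rule nn_integral_mono)
      fix x
      show "young_ext \<Psi> (indicator (ball x0 r) x * frac_max_comm b \<alpha> f x / ennreal \<Lambda>) \<le> ennreal (1 / L) * (W x * indicator (ball x0 r) x)"
      proof (cases "x \<in> ball x0 r")
        case True
        then show ?thesis using pw[OF True] by simp
      next
        case False
        then show ?thesis using Psi by (simp add: young_ext_def young_function_def)
      qed
    qed
    also have "... = ennreal (1 / L) * ball_int x0 r W"
      using W(1) by (intro nn_integral_cmult) simp
    also have "... \<le> ennreal (1 / L) * ennreal L" using W(2) by (rule mult_left_mono) simp
    also have "... = 1" using L by (simp add: ennreal_mult[symmetric])
    finally have "orlicz_norm_ball \<Psi> (frac_max_comm b \<alpha> f) x0 r \<le> ennreal \<Lambda>"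
      unfolding orlicz_norm_ball_def orlicz_norm_def using \<Lambda> by (intro INF_lower) simp
    then have "ennreal (s / \<phi>2 x0 r) * orlicz_norm_ball \<Psi> (frac_max_comm b \<alpha> f) x0 r \<le> ennreal (s / \<phi>2 x0 r) * ennreal \<Lambda>"
      by (rule mult_left_mono) simp
    also have "... = ennreal (s / \<phi>2 x0 r * \<Lambda>)" using s \<phi>2 \<Lambda> by (intro ennreal_mult[symmetric]) auto
    also have "s / \<phi>2 x0 r * \<Lambda> = C' * \<beta> * N" using s \<phi>2 by (simp add: \<Lambda>_def C'_def A_def field_simps)
    finally show ?thesis by (simp add: s_def)
  qed
  show ?thesis
  proof (intro exI[of _ C'] conjI C' allI impI)
    fix b f :: "'a \<Rightarrow> real"
    assume b: "in_BMO b" and fm: "f \<in> borel_measurable lebesgue" and fM: "in_morrey \<Phi> \<phi>1 (\<lambda>y. ennreal \<bar>f y\<bar>)"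
    obtain \<beta>0 where \<beta>0: "bmo_norm b = ennreal \<beta>0" "0 \<le> \<beta>0"
      using b by (cases "bmo_norm b") (auto simp: in_BMO_def)
    obtain N0 where N0: "morrey_norm \<Phi> \<phi>1 (\<lambda>y. ennreal \<bar>f y\<bar>) = ennreal N0" "0 \<le> N0"
      using fM by (cases "morrey_norm \<Phi> \<phi>1 (\<lambda>y. ennreal \<bar>f y\<bar>)") (auto simp: in_morrey_def)
    let ?T = "frac_max_comm b \<alpha> f"
    \<comment> \<open>Either norm may vanish, so the estimate is used with strict majorants and \<open>e\<close> tends to 0.\<close>
    have bound: "ennreal (young_inv \<Psi> (1 / r ^ ?n) / \<phi>2 x r) * orlicz_norm_ball \<Psi> ?T x r \<le> ennreal (C' * (\<beta>0 + e) * (N0 + e))"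
      if "0 < e" "0 < r" for e r x
      using that \<beta>0 N0 by (intro ball_bound[OF b fm]) auto
    have norm_e: "morrey_norm \<Psi> \<phi>2 ?T \<le> ennreal (C' * (\<beta>0 + e) * (N0 + e))" if "0 < e" for e
      unfolding morrey_norm_def using bound[OF that] by (intro SUP_least) auto
    have "((\<lambda>e. ennreal (C' * (\<beta>0 + e) * (N0 + e))) \<longlongrightarrow> ennreal (C' * (\<beta>0 + 0) * (N0 + 0))) (at_right 0)"
      by (intro tendsto_intros)
    moreover have "\<forall>\<^sub>F e in at_right 0. morrey_norm \<Psi> \<phi>2 ?T \<le> ennreal (C' * (\<beta>0 + e) * (N0 + e))"
      using eventually_at_right_less[of "0::real"] by (rule eventually_mono) (rule norm_e)
    ultimately have "morrey_norm \<Psi> \<phi>2 ?T \<le> ennreal (C' * (\<beta>0 + 0) * (N0 + 0))"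
      by (rule tendsto_lowerbound) simp
    also have "... = ennreal C' * bmo_norm b * morrey_norm \<Phi> \<phi>1 (\<lambda>y. ennreal \<bar>f y\<bar>)"
      using C' \<beta>0 N0 by (simp add: ennreal_mult)
    finally show norm: "morrey_norm \<Psi> \<phi>2 ?T \<le> ennreal C' * bmo_norm b * morrey_norm \<Phi> \<phi>1 (\<lambda>y. ennreal \<bar>f y\<bar>)" .
    have "b \<in> borel_measurable lebesgue" using b by (intro locally_integrable_measurable) (simp add: in_BMO_def)
    then have Tm: "?T \<in> borel_measurable lebesgue" using fm alpha(2) by (rule frac_max_comm_measurable)
    have "orlicz_norm_ball \<Psi> ?T x r < \<infinity>" if r: "0 < r" for x r
    proof -
      have pos: "0 < young_inv \<Psi> (1 / r ^ ?n) / \<phi>2 x r"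
        using r phi_pos by (intro divide_pos_pos Y2.inv_pos) auto
      have "ennreal (young_inv \<Psi> (1 / r ^ ?n) / \<phi>2 x r) * orlicz_norm_ball \<Psi> ?T x r < \<infinity>"
        using bound[of 1 r x] r by (auto intro: le_less_trans)
      then show ?thesis using pos by (auto simp: ennreal_mult_less_top)
    qed
    then show "in_morrey \<Psi> \<phi>2 ?T"
      using Tm norm_e[of 1] by (auto simp: in_morrey_def orlicz_loc_def intro: le_less_trans)
  qed
qed

end
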